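(* Let $\mu(x,w)$ denote the coefficient of $q^{(\ell(w)-\ell(x)-1)/2}$ in the Kazhdan–Lusztig polynomial $P_{x,w}(q)$ of the symmetric group. Identify elements of $S_{16}$ with permutations of the set $\{0,1,\dots,9,a,b,c,d,e,f\}$ (where $a,b,c,d,e,f$ stand for $10,11,12,13,14,15$), and elements of $S_{10}$ with permutations of $\{0,1,\dots,9\}$, written in one-line notation. Then: 1. $\mu(\mathrm{54109832dc76bafe},\ \mathrm{c810d942fa53b6e7}) = 5$ in $S_{16}$; 2. $\mu(4321098765,\ 9467182350) = 4$ in $S_{10}$.
   Context: Elements of $S_n$ are permutations of $\{0,1,\dots,n-1\}$; a permutation $w$ is written in one-line notation $w(0)w(1)\cdots w(n-1)$. The Coxeter generators are the adjacent transpositions $s_i=(i,i+1)$, $0\le i\le n-2$, and the length is $\ell(w)=|\{0\le i<j<n : w(i)>w(j)\}|$. $P_{x,w}(q)$ denotes the Kazhdan–Lusztig polynomial of $S_n$ with respect to this Coxeter system (with $P_{w,w}=1$, $P_{x,w}=0$ unless $x\le w$ in Bruhat order). $\mu(x,w)$ is the coefficient of $q^{(\ell(w)-\ell(x)-1)/2}$ in $P_{x,w}$ (taken to be $0$ if this exponent is not a nonnegative integer). *)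

theory Defs
  imports
    "HOL-Combinatorics.Permutations"
    "HOL-Computational_Algebra.Polynomial"
    "HOL-Library.Poly_Mapping"
    "HOL-Algebra.Ring"
begin

subsection \<open>Symmetric groups\<close>

text \<open>
  The group \<open>S\<^sub>n\<close> acts on \<open>{0,\<dots>,n-1}\<close>; its elements are represented as functions on all
  natural numbers that fix every \<open>i \<ge> n\<close>. Products are compositions of functions.
\<close>

type_synonym perm = "nat \<Rightarrow> nat"

definition symgrp :: "nat \<Rightarrow> perm set" where
  "symgrp n = {w. w permutes {..<n}}"

definition one_line :: "nat list \<Rightarrow> perm" where
  "one_line xs = (\<lambda>i. if i < length xs then xs ! i else i)"

definition perm_length :: "nat \<Rightarrow> perm \<Rightarrow> nat" where
  "perm_length n w = card {(i, j). i < j \<and> j < n \<and> w i > w j}"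

definition simple_refl :: "nat \<Rightarrow> perm" where
  "simple_refl i = transpose i (Suc i)"

definition is_word :: "nat \<Rightarrow> nat list \<Rightarrow> perm \<Rightarrow> bool" where
  "is_word n is w \<longleftrightarrow>
     (\<forall>i\<in>set is. Suc i < n) \<and> w = foldr (\<lambda>i u. simple_refl i \<circ> u) is id"

definition reduced_word :: "nat \<Rightarrow> nat list \<Rightarrow> perm \<Rightarrow> bool" where
  "reduced_word n is w \<longleftrightarrow> is_word n is w \<and> length is = perm_length n w"

definition bruhat_le :: "nat \<Rightarrow> perm \<Rightarrow> perm \<Rightarrow> bool" where
  "bruhat_le n x w \<longleftrightarrow> x \<in> symgrp n \<and>
     (\<lambda>u u'. \<exists>a b. a < b \<and> b < n \<and> u' = u \<circ> transpose a b
        \<and> perm_length n u < perm_length n u')\<^sup>*\<^sup>* x w"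


subsection \<open>The Hecke algebra\<close>

text \<open>
  The coefficient ring is \<open>\<int>[v, v\<^sup>-\<^sup>1]\<close> with \<open>v = q\<^bsup>1/2\<^esup>\<close>, realised as the group ring of the
  additive group of integers: the coefficient of \<open>v\<^sup>k\<close> in \<open>a\<close> is \<open>lookup a k\<close>.
\<close>

type_synonym laurent = "int \<Rightarrow>\<^sub>0 int"

definition v_pow :: "int \<Rightarrow> laurent" where
  "v_pow k = Poly_Mapping.single k 1"

definition hecke_q :: laurent where
  "hecke_q = v_pow 2"

definition laurent_bar :: "laurent \<Rightarrow> laurent" where
  "laurent_bar = Poly_Mapping.map_key uminus"

definition laurent_of_poly :: "int poly \<Rightarrow> laurent" where
  "laurent_of_poly p = poly (map_poly of_int p) hecke_q"

text \<open>
  The element \<open>\<Sum>w. h w \<cdot> T\<^sub>w\<close> of the Hecke algebra is represented by the function \<open>h\<close>, which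
  vanishes outside \<open>symgrp n\<close>.
\<close>

type_synonym hecke = "perm \<Rightarrow> laurent"

definition hecke_T :: "perm \<Rightarrow> hecke" where
  "hecke_T w = (\<lambda>x. if x = w then 1 else 0)"

text \<open>
  Left multiplication by \<open>T\<^sub>s\<close> for \<open>s = s\<^sub>i\<close>. This is the coefficientwise form of
  \<open>T\<^sub>s T\<^sub>w = T\<^bsub>sw\<^esub>\<close> if \<open>\<ell>(sw) > \<ell>(w)\<close> and \<open>T\<^sub>s T\<^sub>w = (q - 1) T\<^sub>w + q T\<^bsub>sw\<^esub>\<close> otherwise.
\<close>

definition T_simple_mult :: "nat \<Rightarrow> nat \<Rightarrow> hecke \<Rightarrow> hecke" where
  "T_simple_mult n i h = (\<lambda>w.
     let sw = simple_refl i \<circ> w in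
     if perm_length n sw < perm_length n w
     then h sw + (hecke_q - 1) * h w
     else hecke_q * h sw)"

text \<open>
  Left multiplication by \<open>T\<^sub>w\<close> is the product of the operators above along a reduced word
  of \<open>w\<close>; by Matsumoto's theorem the choice of reduced word is immaterial.
\<close>

definition T_mult :: "nat \<Rightarrow> perm \<Rightarrow> hecke \<Rightarrow> hecke" where
  "T_mult n w h = foldr (T_simple_mult n) (SOME is. reduced_word n is w) h"

definition hecke_algebra :: "nat \<Rightarrow> hecke ring" where
  "hecke_algebra n =
     \<lparr> carrier = {h. \<forall>w. w \<notin> symgrp n \<longrightarrow> h w = 0},
       mult = (\<lambda>g h x. \<Sum>w\<in>symgrp n. g w * T_mult n w h x),
       one = hecke_T id,
       zero = (\<lambda>_. 0),
       add = (\<lambda>g h x. g x + h x) \<rparr>"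

text \<open>
  The bar involution
  \<open>\<Sum>w. a\<^sub>w T\<^sub>w \<mapsto> \<Sum>w. bar a\<^sub>w \<cdot> (T\<^bsub>u\<^esub>)\<^sup>-\<^sup>1\<close> where \<open>u = w\<^sup>-\<^sup>1\<close>.
\<close>

definition hecke_bar :: "nat \<Rightarrow> hecke \<Rightarrow> hecke" where
  "hecke_bar n h = (\<lambda>x. \<Sum>w\<in>symgrp n.
     laurent_bar (h w) * (inv\<^bsub>hecke_algebra n\<^esub> (hecke_T (inv_into UNIV w))) x)"


subsection \<open>Kazhdan--Lusztig polynomials\<close>

text \<open>
  The polynomials \<open>P\<^bsub>x,w\<^esub>\<close> (for fixed \<open>w\<close>) are the unique family making the Kazhdan--Lusztig
  basis element \<open>C'\<^sub>w = q\<^bsup>-\<ell>(w)/2\<^esup> \<Sum>x\<le>w. P\<^bsub>x,w\<^esub>(q) T\<^sub>x\<close> invariant under the bar involution,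
  subject to \<open>P\<^bsub>w,w\<^esub> = 1\<close> and \<open>deg P\<^bsub>x,w\<^esub> \<le> (\<ell>(w) - \<ell>(x) - 1)/2\<close> for \<open>x < w\<close>.
\<close>

definition kl_element :: "nat \<Rightarrow> perm \<Rightarrow> (perm \<Rightarrow> int poly) \<Rightarrow> hecke" where
  "kl_element n w p = (\<lambda>x. v_pow (- int (perm_length n w)) * laurent_of_poly (p x))"

definition is_kl_family :: "nat \<Rightarrow> perm \<Rightarrow> (perm \<Rightarrow> int poly) \<Rightarrow> bool" where
  "is_kl_family n w p \<longleftrightarrow>
     p w = 1 \<and>
     (\<forall>x. \<not> bruhat_le n x w \<longrightarrow> p x = 0) \<and>
     (\<forall>x. bruhat_le n x w \<and> x \<noteq> w \<longrightarrow>
        2 * degree (p x) + 1 \<le> perm_length n w - perm_length n x) \<and>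
     hecke_bar n (kl_element n w p) = kl_element n w p"

definition kl_poly :: "nat \<Rightarrow> perm \<Rightarrow> perm \<Rightarrow> int poly" where
  "kl_poly n x w = (THE p. is_kl_family n w p) x"

definition kl_mu :: "nat \<Rightarrow> perm \<Rightarrow> perm \<Rightarrow> int" where
  "kl_mu n x w =
     (if perm_length n x < perm_length n w \<and> odd (perm_length n w - perm_length n x)
      then coeff (kl_poly n x w) ((perm_length n w - perm_length n x - 1) div 2)
      else 0)"

end

theory Submission
  imports Defs "HOL-Library.Multiset"
begin

text \<open>
  Multiplying the Kazhdan--Lusztig element of \<open>u = s w < w\<close> by the one of a simple reflection
  \<open>s\<close> gives the classical recursion
  \<open>P\<^bsub>y,w\<^esub> = P\<^bsub>sy,u\<^esub> + q P\<^bsub>y,u\<^esub> - \<Sum> \<mu>(z,u) q\<^bsup>(\<ell>(w)-\<ell>(z))/2\<^esup> P\<^bsub>y,z\<^esub>\<close>, where \<open>s y < y\<close> and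
  \<open>z\<close> ranges over the elements with \<open>s z < z\<close>. It is used here one coefficient at a time:
  the coefficient with index \<open>m\<close> of \<open>P\<^bsub>y,w\<^esub>\<close> is the one at exponent \<open>(\<ell>(w) - \<ell>(y) - m)/2\<close>, so
  that \<open>\<mu>\<close> has index 1. If \<open>w\<close> has a descent that \<open>y\<close> lacks, multiplying \<open>y\<close> by it lowers the index
  by one, and index 0 vanishes unless \<open>y = w\<close>; hence a coefficient is either trivial or
  belongs to a pair in which \<open>y\<close> has all descents of \<open>w\<close>. The same principle shows that a \<open>z\<close> with
  \<open>\<mu>(z,u) \<noteq> 0\<close> has all descents of \<open>u\<close> or is a neighbour \<open>t u\<close> with \<open>t\<close> adjacent to \<open>s\<close>, which leaves
  so few correction terms that they are found by a search of the Bruhat interval.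
  Well-chosen descents, recorded in a certificate tree, make the whole recursion small enough to be
  carried out by rewriting.
\<close>

section \<open>Lengths\<close>

text \<open>\<open>kl_poly\<close> is a definite description over bar-invariant families, and the
  bar map is built from ring inverses in an algebra whose product picks reduced words by choice.
  Before any recursion can be stated, the product has to be shown associative, so that inverses are
  unique, and families have to be shown to exist uniquely. Matsumoto's theorem and the braid
  relations are bypassed: left multiplications by generators commute with right multiplications, and
  as every standard basis element is reached from \<open>hecke_T id\<close> from either side, this
  alone yields associativity. On the computational side \<open>S_16\<close> has about 2 * 10^13
  elements, and the delicate point is that the sum over \<open>z\<close> must be complete. Hence the
  necessary half of the rank criterion for the Bruhat order suffices, and the certificate need not
  be trusted: it only steers the computation, and a wrong choice ends in
  \<open>None\<close>.\<close>

abbreviation pinv :: "perm \<Rightarrow> perm" where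
  "pinv \<equiv> inv_into UNIV"

lemma simple_refl_invol [simp]: "simple_refl i (simple_refl i x) = x"
  by (simp add: simple_refl_def)

lemma simple_refl_comp_self [simp]: "simple_refl i \<circ> (simple_refl i \<circ> w) = w"
  "(w \<circ> simple_refl i) \<circ> simple_refl i = w"
  by (auto simp: fun_eq_iff)

lemma simple_refl_apply:
  "simple_refl i x = (if x = i then Suc i else if x = Suc i then i else x)"
  by (auto simp: simple_refl_def transpose_def)

lemma simple_refl_less_iff:
  "simple_refl i a < simple_refl i b \<longleftrightarrow>
     (if a = i \<and> b = Suc i then False else if a = Suc i \<and> b = i then True else a < b)"
  by (auto simp: simple_refl_apply)

section \<open>Closure properties of the symmetric groups\<close>

lemma simple_refl_mem: "Suc i < n \<Longrightarrow> simple_refl i \<in> symgrp n"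
  by (auto simp: symgrp_def simple_refl_def intro!: permutes_swap_id)

lemma symgrp_comp: "u \<in> symgrp n \<Longrightarrow> w \<in> symgrp n \<Longrightarrow> u \<circ> w \<in> symgrp n"
  by (auto simp: symgrp_def intro: permutes_compose)

lemma symgrp_inv: "w \<in> symgrp n \<Longrightarrow> pinv w \<in> symgrp n"
  by (auto simp: symgrp_def intro: permutes_inv)

lemma symgrp_id [simp]: "id \<in> symgrp n"
  by (simp add: symgrp_def permutes_id)

lemma symgrp_inv_inv: "w \<in> symgrp n \<Longrightarrow> pinv (pinv w) = w"
  by (auto simp: symgrp_def intro: permutes_inv_inv)

lemma symgrp_bij: "w \<in> symgrp n \<Longrightarrow> bij w"
  by (auto simp: symgrp_def intro: permutes_bij)

lemma symgrp_inv_f [simp]: "w \<in> symgrp n \<Longrightarrow> pinv w (w x) = x" "w \<in> symgrp n \<Longrightarrow> w (pinv w x) = x"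
  by (auto simp: symgrp_def permutes_inverses)

lemma symgrp_inj: "w \<in> symgrp n \<Longrightarrow> w a = w b \<longleftrightarrow> a = b"
  by (metis symgrp_inv_f(1))

lemma symgrp_less: "w \<in> symgrp n \<Longrightarrow> w i < n \<longleftrightarrow> i < n"
  unfolding symgrp_def by (auto dest: permutes_in_image)

lemma symgrp_fix: "w \<in> symgrp n \<Longrightarrow> n \<le> i \<Longrightarrow> w i = i"
  by (auto simp: symgrp_def permutes_def)

lemma finite_symgrp [simp]: "finite (symgrp n)"
  by (simp add: symgrp_def finite_permutations)

lemma symgrp_simple_left [simp]:
  "Suc i < n \<Longrightarrow> simple_refl i \<circ> w \<in> symgrp n \<longleftrightarrow> w \<in> symgrp n"
  by (metis simple_refl_comp_self(1) simple_refl_mem symgrp_comp)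

lemma symgrp_simple_right [simp]:
  "Suc i < n \<Longrightarrow> w \<circ> simple_refl i \<in> symgrp n \<longleftrightarrow> w \<in> symgrp n"
  by (metis simple_refl_comp_self(2) simple_refl_mem symgrp_comp)

lemma inv_simple_left: "w \<in> symgrp n \<Longrightarrow> pinv (simple_refl i \<circ> w) = pinv w \<circ> simple_refl i"
  by (subst o_inv_distrib) (auto simp: symgrp_bij simple_refl_def)

lemma inv_simple_right: "w \<in> symgrp n \<Longrightarrow> pinv (w \<circ> simple_refl i) = simple_refl i \<circ> pinv w"
  by (subst o_inv_distrib) (auto simp: symgrp_bij simple_refl_def)

section \<open>Inversions and the length\<close>

definition inversions :: "nat \<Rightarrow> perm \<Rightarrow> (nat \<times> nat) set" where
  "inversions n w = {(i, j). i < j \<and> j < n \<and> w i > w j}"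

lemma finite_inversions [simp]: "finite (inversions n w)"
  by (rule finite_subset[of _ "{..<n} \<times> {..<n}"]) (auto simp: inversions_def)

lemma perm_length_eq: "perm_length n w = card (inversions n w)"
  by (simp add: perm_length_def inversions_def)

text \<open>Relabelling both positions by \<open>simple_refl i\<close> keeps the order of every pair
  of positions except \<open>(i, Suc i)\<close>. Hence the inversions of the product are the
  relabelled inversions of \<open>w\<close> plus this one new pair.\<close>

lemma perm_length_right_up:
  assumes w: "w \<in> symgrp n" and i: "Suc i < n" and lt: "w i < w (Suc i)"
  shows "perm_length n (w \<circ> simple_refl i) = Suc (perm_length n w)"
proof -
  let ?s = "simple_refl i" and ?f = "\<lambda>(a, b). (simple_refl i a, simple_refl i b)"
  have "inversions n (w \<circ> ?s) = insert (i, Suc i) (?f ` inversions n w)"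
  proof (intro subset_antisym subrelI)
    fix a b assume mem: "(a, b) \<in> inversions n (w \<circ> ?s)"
    then have ab: "a < b" "b < n" "w (?s a) > w (?s b)" by (auto simp: inversions_def)
    show "(a, b) \<in> insert (i, Suc i) (?f ` inversions n w)"
    proof (cases "a = i \<and> b = Suc i")
      case ne: False
      then have "?s a < ?s b" using ab by (auto simp: simple_refl_less_iff)
      moreover have "?s b < n" using ab i by (auto simp: simple_refl_apply)
      ultimately have "(?s a, ?s b) \<in> inversions n w" using ab by (auto simp: inversions_def)
      then have "?f (?s a, ?s b) \<in> ?f ` inversions n w" by blast
      then show ?thesis by simp
    qed simp
  next
    fix a b assume "(a, b) \<in> insert (i, Suc i) (?f ` inversions n w)"
    then consider "a = i" "b = Suc i" | c d where "(c, d) \<in> inversions n w" "a = ?s c" "b = ?s d"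
      by auto
    then show "(a, b) \<in> inversions n (w \<circ> ?s)"
    proof cases
      case 1
      then show ?thesis using lt i by (auto simp: inversions_def simple_refl_apply)
    next
      case 2
      then have cd: "c < d" "d < n" "w c > w d" by (auto simp: inversions_def)
      with lt have "\<not> (c = i \<and> d = Suc i)" by auto
      with cd have "?s c < ?s d" by (auto simp: simple_refl_less_iff)
      then show ?thesis using 2 cd i by (auto simp: inversions_def simple_refl_apply split: if_splits)
    qed
  qed
  moreover have "(i, Suc i) \<notin> ?f ` inversions n w"
  proof
    assume "(i, Suc i) \<in> ?f ` inversions n w"
    then obtain c d where cd: "c < d" "i = ?s c" "Suc i = ?s d" by (auto simp: inversions_def)
    then have "c = Suc i" "d = i" by (auto simp: simple_refl_apply split: if_splits)
    with cd(1) show False by simp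
  qed
  moreover have "inj_on ?f (inversions n w)"
    by (rule inj_onI) (auto, (metis simple_refl_invol)+)
  ultimately show ?thesis by (simp add: perm_length_eq card_image)
qed

lemma perm_length_right_down:
  assumes w: "w \<in> symgrp n" and i: "Suc i < n" and lt: "w (Suc i) < w i"
  shows "Suc (perm_length n (w \<circ> simple_refl i)) = perm_length n w"
proof -
  have "perm_length n ((w \<circ> simple_refl i) \<circ> simple_refl i) = Suc (perm_length n (w \<circ> simple_refl i))"
    by (rule perm_length_right_up) (use assms in \<open>auto simp: simple_refl_apply\<close>)
  then show ?thesis by simp
qed

text \<open>An inversion at positions \<open>(i, j)\<close> of \<open>w\<close> becomes the
  inversion \<open>(w j, w i)\<close> of the inverse, where positions and values trade
  roles.\<close>

lemma perm_length_inv: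
  assumes w: "w \<in> symgrp n" shows "perm_length n (pinv w) = perm_length n w"
proof -
  have "bij_betw (\<lambda>(i, j). (w j, w i)) (inversions n w) (inversions n (pinv w))"
    by (rule bij_betw_byWitness[where f' = "\<lambda>(i, j). (pinv w j, pinv w i)"])
       (use w symgrp_inv[OF w] in \<open>auto simp: inversions_def symgrp_less\<close>)
  then show ?thesis by (simp add: perm_length_eq bij_betw_same_card)
qed

text \<open>Left descent: the value \<open>Suc i\<close> stands to the left of \<open>i\<close> in
  one-line notation. Expressed through the inverse, it lets statements about left multiplication be
  transported from right multiplication.\<close>

definition ldesc :: "perm \<Rightarrow> nat \<Rightarrow> bool" where
  "ldesc w i \<longleftrightarrow> pinv w (Suc i) < pinv w i"

lemma perm_length_left_up:
  assumes w: "w \<in> symgrp n" and i: "Suc i < n" and "\<not> ldesc w i"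
  shows "perm_length n (simple_refl i \<circ> w) = Suc (perm_length n w)"
proof -
  have "pinv w i \<noteq> pinv w (Suc i)" using symgrp_inj[OF symgrp_inv[OF w]] by simp
  then have "perm_length n (pinv w \<circ> simple_refl i) = Suc (perm_length n (pinv w))"
    using assms by (intro perm_length_right_up symgrp_inv) (auto simp: ldesc_def)
  then show ?thesis
    using w i by (metis inv_simple_left perm_length_inv symgrp_simple_left)
qed

lemma perm_length_left_down:
  assumes w: "w \<in> symgrp n" and i: "Suc i < n" and "ldesc w i"
  shows "Suc (perm_length n (simple_refl i \<circ> w)) = perm_length n w"
proof -
  have "Suc (perm_length n (pinv w \<circ> simple_refl i)) = perm_length n (pinv w)"
    using assms by (intro perm_length_right_down symgrp_inv) (auto simp: ldesc_def)
  then show ?thesis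
    using w i by (metis inv_simple_left perm_length_inv symgrp_simple_left)
qed

lemma ldesc_left:
  assumes "w \<in> symgrp n"
  shows "ldesc (simple_refl i \<circ> w) i \<longleftrightarrow> \<not> ldesc w i"
  using symgrp_inj[OF symgrp_inv[OF assms], of i "Suc i"]
  by (auto simp: ldesc_def inv_simple_left[OF assms] simple_refl_apply)

lemma length_left_less_iff:
  assumes "w \<in> symgrp n" "Suc i < n"
  shows "perm_length n (simple_refl i \<circ> w) < perm_length n w \<longleftrightarrow> ldesc w i"
  using perm_length_left_up[OF assms] perm_length_left_down[OF assms] by (cases "ldesc w i") auto

lemma length_right_less_iff:
  assumes "w \<in> symgrp n" "Suc i < n"
  shows "perm_length n (w \<circ> simple_refl i) < perm_length n w \<longleftrightarrow> w (Suc i) < w i"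
  using perm_length_right_up[OF assms] perm_length_right_down[OF assms]
    symgrp_inj[OF assms(1), of i "Suc i"] by (cases "w (Suc i) < w i") auto

lemma perm_length_id [simp]: "perm_length n id = 0"
proof -
  have "inversions n id = {}" by (auto simp: inversions_def)
  then show ?thesis by (simp add: perm_length_eq)
qed

text \<open>The least moved point \<open>i\<close> satisfies \<open>w i > i\<close>, and its
  preimage \<open>k\<close> lies above \<open>i\<close> by minimality; monotonicity then gives
  \<open>w i < w k = i\<close>, a contradiction.\<close>

lemma symgrp_no_descent:
  assumes w: "w \<in> symgrp n" and "\<And>i. Suc i < n \<Longrightarrow> w i < w (Suc i)"
  shows "w = id"
proof -
  have mono: "i < j \<Longrightarrow> j < n \<Longrightarrow> w i < w j" for i j
  proof (induction j)
    case (Suc j)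
    then show ?case using assms(2)[of j] by (cases "i = j") auto
  qed simp
  have ge: "i < n \<Longrightarrow> i \<le> w i" for i
  proof (induction i)
    case (Suc i)
    then show ?case using mono[of i "Suc i"] by simp
  qed simp
  have "w i = i" if "i < n" for i
    using that
  proof (induction i rule: less_induct)
    case (less i)
    show ?case
    proof (rule ccontr)
      assume "w i \<noteq> i"
      then have gt: "w i > i" using ge[of i] less.prems by simp
      define k where "k = pinv w i"
      have k: "w k = i" "k < n" using w less.prems symgrp_less[OF symgrp_inv[OF w]]
        by (auto simp: k_def)
      then have "k \<noteq> i" using gt by auto
      then consider "k < i" | "i < k" by linarith
      then show False
      proof cases
        case 1
        then show ?thesis using less.IH[of k] k by simp
      next
        case 2
        then show ?thesis using mono[of i k] k gt by simp
      qed
    qed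
  qed
  moreover have "w i = i" if "\<not> i < n" for i using symgrp_fix[OF w] that by simp
  ultimately show ?thesis by (auto simp: fun_eq_iff)
qed

lemma exists_ldesc:
  assumes w: "w \<in> symgrp n" and "w \<noteq> id"
  shows "\<exists>i. Suc i < n \<and> ldesc w i"
proof (rule ccontr)
  assume *: "\<not> ?thesis"
  have "pinv w i < pinv w (Suc i)" if "Suc i < n" for i
    using * that symgrp_inj[OF symgrp_inv[OF w], of i "Suc i"] by (metis ldesc_def linorder_neqE_nat n_not_Suc_n)
  then have "pinv w = id" by (rule symgrp_no_descent[OF symgrp_inv[OF w]])
  then show False using assms by (metis inv_id symgrp_inv_inv)
qed

text \<open>Removing left descents one at a time ends at the identity. Properties are thus carried
  upwards through length-increasing left multiplications only, the case in which
  \<open>T_simple_mult\<close> merely relabels a basis element.\<close>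

lemma symgrp_left_induct [consumes 1, case_names id step]:
  assumes "w \<in> symgrp n" and "P id"
    and "\<And>i w. w \<in> symgrp n \<Longrightarrow> Suc i < n \<Longrightarrow> \<not> ldesc w i \<Longrightarrow> P w \<Longrightarrow> P (simple_refl i \<circ> w)"
  shows "P w"
  using assms(1)
proof (induction "perm_length n w" arbitrary: w rule: less_induct)
  case less
  show ?case
  proof (cases "w = id")
    case False
    then obtain i where i: "Suc i < n" "ldesc w i" using exists_ldesc less.prems by blast
    let ?u = "simple_refl i \<circ> w"
    have u: "?u \<in> symgrp n" "\<not> ldesc ?u i" "perm_length n ?u < perm_length n w"
      using i less.prems by (auto simp: ldesc_left length_left_less_iff)
    have "P (simple_refl i \<circ> ?u)"
      by (rule assms(3)[OF u(1) i(1) u(2) less.hyps[OF u(3) u(1)]])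
    then show ?thesis by (simp only: simple_refl_comp_self)
  qed (use assms(2) in simp)
qed

section \<open>The Hecke algebra acting on itself\<close>

definition hcar :: "nat \<Rightarrow> hecke set" where
  "hcar n = {h. \<forall>w. w \<notin> symgrp n \<longrightarrow> h w = 0}"

text \<open>Coefficientwise right multiplication by a generator, the mirror image of
  \<open>T_simple_mult\<close>. It serves as an operator that can be moved past all left
  multiplications.\<close>

definition T_right :: "nat \<Rightarrow> nat \<Rightarrow> hecke \<Rightarrow> hecke" where
  "T_right n i h = (\<lambda>w. if w (Suc i) < w i then h (w \<circ> simple_refl i) + (hecke_q - 1) * h w
     else hecke_q * h (w \<circ> simple_refl i))"

lemma hcarD: "h \<in> hcar n \<Longrightarrow> w \<notin> symgrp n \<Longrightarrow> h w = 0"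
  by (simp add: hcar_def)

lemma hcar_T [simp]: "w \<in> symgrp n \<Longrightarrow> hecke_T w \<in> hcar n"
  by (auto simp: hcar_def hecke_T_def)

lemma T_simple_mult_apply:
  assumes "w \<in> symgrp n" "Suc i < n"
  shows "T_simple_mult n i h w = (if ldesc w i then h (simple_refl i \<circ> w) + (hecke_q - 1) * h w
     else hecke_q * h (simple_refl i \<circ> w))"
  using assms by (simp add: T_simple_mult_def Let_def length_left_less_iff)

lemma T_simple_mult_out:
  assumes "w \<notin> symgrp n" "Suc i < n" "h \<in> hcar n"
  shows "T_simple_mult n i h w = 0"
  using assms by (simp add: T_simple_mult_def Let_def hcarD)

lemma T_simple_mult_car [simp]: "Suc i < n \<Longrightarrow> h \<in> hcar n \<Longrightarrow> T_simple_mult n i h \<in> hcar n"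
  by (auto simp: hcar_def T_simple_mult_out[unfolded hcar_def])

lemma T_right_car [simp]: "Suc i < n \<Longrightarrow> h \<in> hcar n \<Longrightarrow> T_right n i h \<in> hcar n"
  by (auto simp: hcar_def T_right_def)

text \<open>Right multiplication by \<open>simple_refl j\<close> exchanges positions
  \<open>j\<close> and \<open>Suc j\<close>. It can change the order of the values \<open>i\<close>
  and \<open>Suc i\<close> only if they occupy exactly these positions, which is the excluded case
  \<open>s w = w t\<close>.\<close>

lemma ldesc_right:
  assumes w: "w \<in> symgrp n" and "simple_refl i \<circ> w \<noteq> w \<circ> simple_refl j"
  shows "ldesc (w \<circ> simple_refl j) i \<longleftrightarrow> ldesc w i"
proof -
  have "\<not> (pinv w (Suc i) = j \<and> pinv w i = Suc j)" "\<not> (pinv w (Suc i) = Suc j \<and> pinv w i = j)"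
  proof -
    have *: "simple_refl i \<circ> w = w \<circ> simple_refl j"
      if h: "(w j = Suc i \<and> w (Suc j) = i) \<or> (w (Suc j) = Suc i \<and> w j = i)"
    proof (rule ext)
      fix x
      show "(simple_refl i \<circ> w) x = (w \<circ> simple_refl j) x"
        using h symgrp_inj[OF w, of x j] symgrp_inj[OF w, of x "Suc j"]
        by (cases "x = j"; cases "x = Suc j") (auto simp: simple_refl_apply)
    qed
    show "\<not> (pinv w (Suc i) = j \<and> pinv w i = Suc j)" "\<not> (pinv w (Suc i) = Suc j \<and> pinv w i = j)"
      using * assms(2) w by (metis symgrp_inv_f(2))+
  qed
  then show ?thesis
    by (auto simp: ldesc_def inv_simple_right[OF w] simple_refl_less_iff)
qed

lemma rdesc_left:
  assumes w: "w \<in> symgrp n" and ne: "simple_refl i \<circ> w \<noteq> w \<circ> simple_refl j"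
  shows "(simple_refl i \<circ> w) (Suc j) < (simple_refl i \<circ> w) j \<longleftrightarrow> w (Suc j) < w j"
proof -
  have *: "ldesc (pinv w) j \<longleftrightarrow> w (Suc j) < w j" if "w \<in> symgrp n" for w
    using that by (simp add: ldesc_def symgrp_inv_inv)
  have sw: "simple_refl i \<circ> w \<in> symgrp n \<or> \<not> Suc i < n" using w by auto
  show ?thesis
  proof (cases "w (Suc j) = i \<and> w j = Suc i \<or> w (Suc j) = Suc i \<and> w j = i")
    case True
    have "simple_refl i \<circ> w = w \<circ> simple_refl j"
    proof (rule ext)
      fix x
      show "(simple_refl i \<circ> w) x = (w \<circ> simple_refl j) x"
        using True symgrp_inj[OF w, of x j] symgrp_inj[OF w, of x "Suc j"]
        by (cases "x = j"; cases "x = Suc j") (auto simp: simple_refl_apply)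
    qed
    then show ?thesis using ne by simp
  next
    case False
    then show ?thesis by (auto simp: simple_refl_less_iff)
  qed
qed

text \<open>The classical dichotomy: if \<open>s w\<close> and \<open>w t\<close> differ, the two
  descent conditions do not influence each other and the operators commute formally; if they agree,
  \<open>s\<close> is a left descent of \<open>w\<close> exactly when \<open>t\<close> is a right
  descent, and both sides reduce to the same expression. This takes the place of the braid
  relations.\<close>

lemma T_left_right_comm:
  assumes h: "h \<in> hcar n" and i: "Suc i < n" and j: "Suc j < n"
  shows "T_simple_mult n i (T_right n j h) = T_right n j (T_simple_mult n i h)"
proof (rule ext)
  fix w
  show "T_simple_mult n i (T_right n j h) w = T_right n j (T_simple_mult n i h) w"
  proof (cases "w \<in> symgrp n")
    case False
    then show ?thesis using assms T_simple_mult_car T_right_car by (metis hcarD)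
  next
    case w: True
    let ?s = "simple_refl i" and ?t = "simple_refl j"
    have assoc: "(?s \<circ> w) \<circ> ?t = ?s \<circ> (w \<circ> ?t)" by (simp add: o_assoc)
    have sw: "?s \<circ> w \<in> symgrp n" "w \<circ> ?t \<in> symgrp n" using w i j by auto
    show ?thesis
    proof (cases "?s \<circ> w = w \<circ> ?t")
      case False
      then have *: "ldesc (w \<circ> ?t) i \<longleftrightarrow> ldesc w i"
        "(?s \<circ> w) (Suc j) < (?s \<circ> w) j \<longleftrightarrow> w (Suc j) < w j"
        using w ldesc_right rdesc_left by blast+
      show ?thesis
        unfolding T_simple_mult_apply[OF w i] T_right_def T_simple_mult_apply[OF sw(2) i] * assoc
        by (simp add: algebra_simps)
    next
      case True
      have swt: "?s \<circ> (w \<circ> ?t) = w" using True by (metis simple_refl_comp_self(1))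
      have r: "(w \<circ> ?t) (Suc j) < (w \<circ> ?t) j \<longleftrightarrow> \<not> w (Suc j) < w j"
        using symgrp_inj[OF w, of j "Suc j"] by (auto simp: simple_refl_apply)
      have l: "ldesc (w \<circ> ?t) i \<longleftrightarrow> \<not> ldesc w i"
        using ldesc_left[OF w, of i] True by simp
      have lr: "ldesc w i \<longleftrightarrow> w (Suc j) < w j"
        using length_left_less_iff[OF w i] length_right_less_iff[OF w j] True by simp
      show ?thesis
        unfolding T_simple_mult_apply[OF w i] T_right_def T_simple_mult_apply[OF sw(2) i] True swt r l lr
        by (auto simp: algebra_simps)
    qed
  qed
qed

abbreviation hmult :: "nat \<Rightarrow> hecke \<Rightarrow> hecke \<Rightarrow> hecke" where
  "hmult n g h \<equiv> g \<otimes>\<^bsub>hecke_algebra n\<^esub> h"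

lemma hmult_def: "hmult n g h = (\<lambda>x. \<Sum>w\<in>symgrp n. g w * T_mult n w h x)"
  by (simp add: hecke_algebra_def)

text \<open>Linearity over sums indexed by the group. This form is enough to compare two operators
  on the standard basis, as in \<open>hlin_eq\<close>.\<close>

definition hlin :: "nat \<Rightarrow> (hecke \<Rightarrow> hecke) \<Rightarrow> bool" where
  "hlin n \<Phi> \<longleftrightarrow> (\<forall>c F. \<Phi> (\<lambda>x. \<Sum>w\<in>symgrp n. c w * F w x) = (\<lambda>x. \<Sum>w\<in>symgrp n. c w * \<Phi> (F w) x))"

lemma hlinD: "hlin n \<Phi> \<Longrightarrow> \<Phi> (\<lambda>x. \<Sum>w\<in>symgrp n. c w * F w x) = (\<lambda>x. \<Sum>w\<in>symgrp n. c w * \<Phi> (F w) x)"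
  by (simp add: hlin_def)

lemma hlin_comp: "hlin n \<Phi> \<Longrightarrow> hlin n \<Psi> \<Longrightarrow> hlin n (\<lambda>h. \<Phi> (\<Psi> h))"
  by (simp add: hlin_def)

lemma hecke_T_expand:
  assumes "h \<in> hcar n" shows "(\<lambda>x. \<Sum>w\<in>symgrp n. h w * hecke_T w x) = h"
proof (rule ext)
  fix x
  have "(\<Sum>w\<in>symgrp n. h w * hecke_T w x) = (\<Sum>w\<in>symgrp n. if x = w then h x else 0)"
    by (intro sum.cong) (auto simp: hecke_T_def)
  also have "\<dots> = h x" using assms by (auto simp: hcar_def)
  finally show "(\<Sum>w\<in>symgrp n. h w * hecke_T w x) = h x" .
qed

lemma hlin_eq:
  assumes "hlin n \<Phi>" "hlin n \<Psi>" "h \<in> hcar n"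
    and "\<And>w. w \<in> symgrp n \<Longrightarrow> \<Phi> (hecke_T w) = \<Psi> (hecke_T w)"
  shows "\<Phi> h = \<Psi> h"
proof -
  have "\<Phi> (\<lambda>x. \<Sum>w\<in>symgrp n. h w * hecke_T w x) = \<Psi> (\<lambda>x. \<Sum>w\<in>symgrp n. h w * hecke_T w x)"
    unfolding hlinD[OF assms(1)] hlinD[OF assms(2)] using assms(4) by (intro ext sum.cong) auto
  then show ?thesis using hecke_T_expand[OF assms(3)] by simp
qed

lemma hlin_T_simple_mult: "hlin n (T_simple_mult n i)"
  unfolding hlin_def T_simple_mult_def Let_def
  by (auto simp: fun_eq_iff sum_distrib_left algebra_simps sum.distrib sum_subtractf)

lemma hlin_T_right: "hlin n (T_right n i)"
  unfolding hlin_def T_right_def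
  by (auto simp: fun_eq_iff sum_distrib_left algebra_simps sum.distrib sum_subtractf)

lemma hlin_foldr: "hlin n (foldr (T_simple_mult n) is)"
proof (induction "is")
  case (Cons i "is")
  then show ?case using hlin_comp[OF hlin_T_simple_mult Cons.IH] by (simp add: comp_def)
qed (simp add: hlin_def)

lemma hlin_T_mult: "hlin n (T_mult n w)"
  using hlin_foldr by (simp add: T_mult_def [abs_def])

lemma hlin_hmult_right: "hlin n (hmult n g)"
  unfolding hlin_def hmult_def
proof (intro allI ext)
  fix c :: "perm \<Rightarrow> laurent" and F :: "perm \<Rightarrow> hecke" and x :: perm
  show "(\<Sum>w\<in>symgrp n. g w * T_mult n w (\<lambda>x. \<Sum>w\<in>symgrp n. c w * F w x) x) =
    (\<Sum>w\<in>symgrp n. c w * (\<Sum>v\<in>symgrp n. g v * T_mult n v (F w) x))"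
    unfolding hlinD[OF hlin_T_mult] sum_distrib_left
    by (subst sum.swap) (simp add: ac_simps)
qed

lemma hlin_hmult_left: "hlin n (\<lambda>g. hmult n g h)"
  unfolding hlin_def hmult_def
proof (intro allI ext)
  fix c :: "perm \<Rightarrow> laurent" and F :: "perm \<Rightarrow> hecke" and x :: perm
  show "(\<Sum>w\<in>symgrp n. (\<Sum>v\<in>symgrp n. c v * F v w) * T_mult n w h x) =
    (\<Sum>w\<in>symgrp n. c w * (\<Sum>v\<in>symgrp n. F w v * T_mult n v h x))"
    unfolding sum_distrib_left sum_distrib_right
    by (subst sum.swap) (simp add: ac_simps)
qed

lemma T_simple_mult_T:
  assumes u: "u \<in> symgrp n" and i: "Suc i < n" and nd: "\<not> ldesc u i"
  shows "T_simple_mult n i (hecke_T u) = hecke_T (simple_refl i \<circ> u)"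
proof (rule ext)
  fix w
  have su: "simple_refl i \<circ> u \<in> symgrp n" "ldesc (simple_refl i \<circ> u) i"
    using assms by (auto simp: ldesc_left)
  show "T_simple_mult n i (hecke_T u) w = hecke_T (simple_refl i \<circ> u) w"
  proof (cases "w \<in> symgrp n")
    case w: True
    have "simple_refl i \<circ> w = u \<longleftrightarrow> w = simple_refl i \<circ> u"
      by (metis simple_refl_comp_self(1))
    then show ?thesis using w i su nd by (auto simp: T_simple_mult_apply hecke_T_def)
  next
    case False
    then show ?thesis using T_simple_mult_out[OF False i hcar_T[OF u]] su by (auto simp: hecke_T_def)
  qed
qed

lemma T_right_T:
  assumes u: "u \<in> symgrp n" and i: "Suc i < n" and nd: "u i < u (Suc i)"
  shows "T_right n i (hecke_T u) = hecke_T (u \<circ> simple_refl i)"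
proof (rule ext)
  fix w
  have iff: "w \<circ> simple_refl i = u \<longleftrightarrow> w = u \<circ> simple_refl i"
    by (metis simple_refl_comp_self(2))
  show "T_right n i (hecke_T u) w = hecke_T (u \<circ> simple_refl i) w"
  proof -
    have "u \<circ> simple_refl i \<noteq> u" using nd by (metis comp_apply less_irrefl simple_refl_apply)
    then show ?thesis using nd unfolding T_right_def hecke_T_def iff
      by (auto simp: simple_refl_apply)
  qed
qed

section \<open>Reduced words\<close>

lemma is_word_Nil [simp]: "is_word n [] w \<longleftrightarrow> w = id"
  by (simp add: is_word_def)

lemma is_word_Cons:
  "is_word n (i # is) w \<longleftrightarrow> Suc i < n \<and> (\<exists>u. is_word n is u \<and> w = simple_refl i \<circ> u)"
  by (auto simp: is_word_def)

lemma is_word_length: "is_word n is w \<Longrightarrow> w \<in> symgrp n \<and> perm_length n w \<le> length is"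
proof (induction "is" arbitrary: w)
  case (Cons i "is")
  then obtain u where u: "Suc i < n" "is_word n is u" "w = simple_refl i \<circ> u"
    by (auto simp: is_word_Cons)
  with Cons.IH have IH: "u \<in> symgrp n" "perm_length n u \<le> length is" by auto
  have "simple_refl i \<circ> u \<in> symgrp n \<and> perm_length n (simple_refl i \<circ> u) \<le> Suc (length is)"
    using u(1) IH perm_length_left_up[OF IH(1) u(1)] perm_length_left_down[OF IH(1) u(1)]
    by (cases "ldesc u i") auto
  then show ?case by (subst (1 2) u(3)) (simp only: list.size(4) add_Suc_right add_0_right)
qed (metis is_word_Nil list.size(3) order_refl perm_length_id symgrp_id)

text \<open>A tail of a reduced word is again reduced, so each letter acts in the length-increasing
  case and simply relabels the basis element. The result does not depend on which reduced word was
  taken.\<close>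

lemma reduced_word_T:
  assumes "reduced_word n is w"
  shows "foldr (T_simple_mult n) is (hecke_T id) = hecke_T w"
  using assms
proof (induction "is" arbitrary: w)
  case (Cons i "is")
  then obtain u where u: "Suc i < n" "is_word n is u" "w = simple_refl i \<circ> u"
    by (auto simp: reduced_word_def is_word_Cons)
  have lu: "u \<in> symgrp n" "perm_length n u \<le> length is" using is_word_length[OF u(2)] by auto
  have lw: "perm_length n w = Suc (length is)" using Cons.prems by (simp add: reduced_word_def)
  have nd: "\<not> ldesc u i" using perm_length_left_down[OF lu(1) u(1)] lu(2) lw u(3) by force
  then have "perm_length n u = length is"
    using perm_length_left_up[OF lu(1) u(1)] lw u(3) by simp
  then have "reduced_word n is u" using u(2) by (simp add: reduced_word_def)
  then have "foldr (T_simple_mult n) is (hecke_T id) = hecke_T u" by (rule Cons.IH)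
  then show ?case by (metis u(3) T_simple_mult_T[OF lu(1) u(1) nd] foldr.simps(2) comp_apply)
next
  case Nil
  then have "w = id" by (simp only: reduced_word_def is_word_Nil)
  then show ?case by (metis foldr.simps(1) id_apply)
qed

lemma reduced_word_exists: "w \<in> symgrp n \<Longrightarrow> \<exists>is. reduced_word n is w"
proof (induction rule: symgrp_left_induct)
  case id
  have "reduced_word n [] id" by (simp only: reduced_word_def is_word_Nil perm_length_id list.size(3))
  then show ?case by (rule exI)
next
  case (step i w)
  then obtain "is" where "reduced_word n is w" by blast
  then have "reduced_word n (i # is) (simple_refl i \<circ> w)"
    using step perm_length_left_up[of w n i] by (auto simp: reduced_word_def is_word_Cons)
  then show ?case by blast
qed

lemma T_mult_T: "w \<in> symgrp n \<Longrightarrow> T_mult n w (hecke_T id) = hecke_T w"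
  unfolding T_mult_def by (rule reduced_word_T) (rule someI_ex[OF reduced_word_exists])

lemma T_mult_id: "T_mult n id h = h"
proof -
  have "reduced_word n (SOME is. reduced_word n is id) id"
    by (rule someI_ex[OF reduced_word_exists]) simp
  then have "(SOME is. reduced_word n is id) = []"
    by (simp add: reduced_word_def)
  then show ?thesis by (simp only: T_mult_def foldr.simps id_apply)
qed

lemma foldr_T_simple_mult:
  assumes "\<forall>i\<in>set is. Suc i < n" "h \<in> hcar n"
  shows "foldr (T_simple_mult n) is h \<in> hcar n"
    "Suc j < n \<Longrightarrow> foldr (T_simple_mult n) is (T_right n j h) = T_right n j (foldr (T_simple_mult n) is h)"
  using assms by (induction "is") (auto simp: T_left_right_comm)

text \<open>Collects what the choice operator in \<open>T_mult\<close> guarantees: a composition of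
  left multiplications by generators that sends the unit to \<open>hecke_T w\<close>.\<close>

lemma T_mult_word:
  assumes "w \<in> symgrp n"
  obtains "is" where "\<forall>i\<in>set is. Suc i < n" "T_mult n w = foldr (T_simple_mult n) is"
    "foldr (T_simple_mult n) is (hecke_T id) = hecke_T w"
proof -
  let ?is = "SOME is. reduced_word n is w"
  have "reduced_word n ?is w" using someI_ex[OF reduced_word_exists[OF assms]] .
  then show ?thesis
    using that[of ?is] reduced_word_T[of n ?is w]
    by (auto simp: T_mult_def [abs_def] reduced_word_def is_word_def)
qed

section \<open>Unit and associativity of the product\<close>

lemma hmult_car:
  assumes "h \<in> hcar n" shows "hmult n g h \<in> hcar n"
proof -
  have "T_mult n w h \<in> hcar n" if "w \<in> symgrp n" for w
    using that assms foldr_T_simple_mult(1) by (metis T_mult_word)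
  then show ?thesis by (auto simp: hcar_def hmult_def)
qed

text \<open>Multiplication by \<open>g\<close> from the left is a combination of compositions of
  left operators, each of which commutes with \<open>T_right\<close>.\<close>

lemma hmult_T_right:
  assumes h: "h \<in> hcar n" and j: "Suc j < n"
  shows "hmult n g (T_right n j h) = T_right n j (hmult n g h)"
proof -
  have "T_mult n w (T_right n j h) = T_right n j (T_mult n w h)" if "w \<in> symgrp n" for w
    using that foldr_T_simple_mult(2)[OF _ h j] by (metis T_mult_word)
  then show ?thesis unfolding hmult_def hlinD[OF hlin_T_right] by (intro ext sum.cong) auto
qed

lemma hmult_one_right: "g \<in> hcar n \<Longrightarrow> hmult n g (hecke_T id) = g"
  unfolding hmult_def by (subst (3) hecke_T_expand [symmetric, of _ n]) (auto simp: T_mult_T intro!: sum.cong)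

lemma hmult_one_left: "h \<in> hcar n \<Longrightarrow> hmult n (hecke_T id) h = h"
proof (rule ext)
  fix x
  have "(\<Sum>w\<in>symgrp n. hecke_T id w * T_mult n w h x) = (\<Sum>w\<in>symgrp n. if w = id then T_mult n w h x else 0)"
    by (intro sum.cong) (auto simp: hecke_T_def)
  then show "hmult n (hecke_T id) h x = h x"
    by (simp add: hmult_def T_mult_id)
qed

lemma symgrp_right_induct [consumes 1, case_names id step]:
  assumes "w \<in> symgrp n" and "P id"
    and "\<And>i w. w \<in> symgrp n \<Longrightarrow> Suc i < n \<Longrightarrow> w i < w (Suc i) \<Longrightarrow> P w \<Longrightarrow> P (w \<circ> simple_refl i)"
  shows "P w"
proof -
  have "P (pinv v)" if "v \<in> symgrp n" for v
    using that
  proof (induction rule: symgrp_left_induct)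
    case (step i v)
    have "pinv v i < pinv v (Suc i)"
      using step symgrp_inj[OF symgrp_inv[OF step(1)], of i "Suc i"] by (auto simp: ldesc_def)
    then have "P (pinv v \<circ> simple_refl i)" using step symgrp_inv by (intro assms(3)) auto
    then show ?case using inv_simple_left[OF step(1), of i] by (simp only: comp_def)
  next
    case id
    show ?case using assms(2) by (simp only: inv_id)
  qed
  from this[OF symgrp_inv[OF assms(1)]] show ?thesis by (simp add: symgrp_inv_inv[OF assms(1)])
qed

text \<open>The reduced words chosen for \<open>w\<close> and \<open>s w\<close> are unrelated, so
  this is not immediate from the definition. Both sides are linear in \<open>h\<close> and commute
  with \<open>T_right\<close>; building \<open>hecke_T u\<close> up from the right reduces the claim
  to \<open>h = hecke_T id\<close>, where it is the unit law.\<close>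

lemma hmult_T_left:
  assumes g: "g \<in> hcar n" and h: "h \<in> hcar n" and i: "Suc i < n"
  shows "hmult n (T_simple_mult n i g) h = T_simple_mult n i (hmult n g h)"
proof -
  have T: "hmult n (T_simple_mult n i g) (hecke_T u) = T_simple_mult n i (hmult n g (hecke_T u))"
    if "u \<in> symgrp n" for u
    using that
  proof (induction rule: symgrp_right_induct)
    case id
    have "hmult n g (hecke_T id) = g" "hmult n (T_simple_mult n i g) (hecke_T id) = T_simple_mult n i g"
      using g i by (auto intro!: hmult_one_right)
    then show ?case by (simp only: id_def)
  next
    case (step j u)
    have "hmult n (T_simple_mult n i g) (hecke_T (u \<circ> simple_refl j)) =
        T_right n j (hmult n (T_simple_mult n i g) (hecke_T u))"
      using step by (simp add: T_right_T [symmetric] hmult_T_right)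
    also have "\<dots> = T_simple_mult n i (T_right n j (hmult n g (hecke_T u)))"
      using step i by (simp add: T_left_right_comm hmult_car)
    also have "\<dots> = T_simple_mult n i (hmult n g (hecke_T (u \<circ> simple_refl j)))"
      using step by (simp add: T_right_T [symmetric] hmult_T_right)
    finally show ?case .
  qed
  show ?thesis
    by (rule hlin_eq[OF hlin_hmult_right hlin_comp[OF hlin_T_simple_mult hlin_hmult_right] h])
       (use T in auto)
qed

text \<open>By linearity \<open>f\<close> may be a basis element, built up from the left;
  \<open>hmult_T_left\<close> moves each generator outside on both sides until only the unit
  remains.\<close>

lemma hmult_assoc:
  assumes f: "f \<in> hcar n" and g: "g \<in> hcar n" and h: "h \<in> hcar n"
  shows "hmult n (hmult n f g) h = hmult n f (hmult n g h)"
proof -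
  have T: "hmult n (hmult n (hecke_T w) g) h = hmult n (hecke_T w) (hmult n g h)" if "w \<in> symgrp n" for w
    using that
  proof (induction rule: symgrp_left_induct)
    case id
    have "hmult n (hecke_T id) g = g" "hmult n (hecke_T id) (hmult n g h) = hmult n g h"
      using g h by (auto intro!: hmult_one_left hmult_car)
    then show ?case by (simp only: id_def)
  next
    case (step i w)
    have T: "hecke_T (simple_refl i \<circ> w) = T_simple_mult n i (hecke_T w)"
      by (rule T_simple_mult_T [symmetric]) (rule step)+
    show ?case unfolding T using step g h by (simp add: hmult_T_left hmult_car)
  qed
  show ?thesis
    by (rule hlin_eq[OF hlin_comp[OF hlin_hmult_left hlin_hmult_left] hlin_hmult_left f])
       (use T in auto)
qed

lemma hecke_algebra_simps [simp]:
  "carrier (hecke_algebra n) = hcar n" "\<one>\<^bsub>hecke_algebra n\<^esub> = hecke_T id"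
  by (simp_all add: hecke_algebra_def hcar_def)

lemma monoid_hecke: "monoid (hecke_algebra n)"
  by (rule monoidI) (auto simp: hmult_car hmult_assoc hmult_one_left hmult_one_right)

section \<open>Coefficients of Laurent polynomials\<close>

abbreviation lk :: "laurent \<Rightarrow> int \<Rightarrow> int" where
  "lk \<equiv> Poly_Mapping.lookup"

abbreviation lmon :: "int \<Rightarrow> int \<Rightarrow> laurent" where
  "lmon k c \<equiv> Poly_Mapping.single k c"

lemma lk_lmon_mult: "lk (lmon k c * a) j = c * lk a (j - k)"
proof -
  have "lk (lmon k c * a) j = Sum_any (\<lambda>l. (c when k = l) * Sum_any (\<lambda>q. lk a q when j = l + q))"
    by (simp add: lookup_mult lookup_single)
  also have "\<dots> = Sum_any (\<lambda>l. (c * Sum_any (\<lambda>q. lk a q when q = j - l)) when l = k)"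
    by (intro Sum_any.cong) (auto simp: when_def algebra_simps intro!: Sum_any.cong)
  finally show ?thesis by simp
qed

lemma lk_laurent_bar: "lk (laurent_bar a) k = lk a (- k)"
  unfolding laurent_bar_def by (simp add: map_key.rep_eq)

lemma laurent_bar_lmon_mult: "laurent_bar (lmon k c * a) = lmon (- k) c * laurent_bar a"
  by (rule poly_mapping_eqI, simp only: lk_laurent_bar lk_lmon_mult) (simp add: algebra_simps)

lemma laurent_bar_add: "laurent_bar (a + b) = laurent_bar a + laurent_bar b"
  by (rule poly_mapping_eqI) (simp add: lk_laurent_bar lookup_add)

lemma laurent_bar_diff: "laurent_bar (a - b) = laurent_bar a - laurent_bar b"
  by (rule poly_mapping_eqI) (simp add: lk_laurent_bar lookup_minus)

lemma laurent_bar_0 [simp]: "laurent_bar 0 = 0"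
  by (rule poly_mapping_eqI) (simp add: lk_laurent_bar)

lemma laurent_bar_1 [simp]: "laurent_bar 1 = 1"
  by (rule poly_mapping_eqI) (auto simp: lk_laurent_bar lookup_one when_def)

lemma v_pow_mult: "v_pow a * v_pow b = v_pow (a + b)"
  by (simp add: v_pow_def mult_single)

lemma v_pow_mult_left: "v_pow a * (v_pow b * c) = v_pow (a + b) * c"
  by (simp add: v_pow_mult [symmetric] mult.assoc)

lemma v_pow_0 [simp]: "v_pow 0 = 1"
  by (simp add: v_pow_def)

lemma laurent_bar_v_pow_mult: "laurent_bar (v_pow k * a) = v_pow (- k) * laurent_bar a"
  by (simp add: v_pow_def laurent_bar_lmon_mult)

lemma lk_v_pow_mult: "lk (v_pow k * a) j = lk a (j - k)"
  by (simp add: v_pow_def lk_lmon_mult)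

section \<open>The bar involution\<close>

text \<open>Left multiplication by the inverse of a generator, read off from the quadratic relation:
  \<open>T_s^(-1) = q^(-1) (T_s - (q - 1))\<close>.\<close>

definition T_inv :: "nat \<Rightarrow> nat \<Rightarrow> hecke \<Rightarrow> hecke" where
  "T_inv n i h = (\<lambda>w. v_pow (- 2) * (T_simple_mult n i h w - (hecke_q - 1) * h w))"

lemma T_inv_apply:
  assumes "w \<in> symgrp n" "Suc i < n"
  shows "T_inv n i h w = (if ldesc w i then v_pow (- 2) * h (simple_refl i \<circ> w)
     else h (simple_refl i \<circ> w) + (v_pow (- 2) - 1) * h w)"
  using assms
  by (simp add: T_inv_def T_simple_mult_apply hecke_q_def algebra_simps v_pow_mult_left v_pow_mult)

lemma hlin_T_inv: "hlin n (T_inv n i)"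
proof -
  have "T_inv n i (\<lambda>x. \<Sum>w\<in>symgrp n. c w * F w x) = (\<lambda>x. \<Sum>w\<in>symgrp n. c w * T_inv n i (F w) x)"
    for c and F :: "perm \<Rightarrow> hecke"
    unfolding T_inv_def hlinD[OF hlin_T_simple_mult]
    by (intro ext) (simp add: sum_distrib_left sum_subtractf [symmetric] algebra_simps)
  then show ?thesis by (simp add: hlin_def)
qed

lemma T_inv_car [simp]: "Suc i < n \<Longrightarrow> h \<in> hcar n \<Longrightarrow> T_inv n i h \<in> hcar n"
  using T_simple_mult_car[of i n h] by (auto simp: hcar_def T_inv_def)

lemma hcar_eqI:
  assumes "g \<in> hcar n" "h \<in> hcar n" "\<And>w. w \<in> symgrp n \<Longrightarrow> g w = h w" shows "g = h"
  using assms by (metis ext hcarD)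

lemma T_inv_T_simple_mult:
  assumes i: "Suc i < n" and h: "h \<in> hcar n"
  shows "T_inv n i (T_simple_mult n i h) = h" "T_simple_mult n i (T_inv n i h) = h"
proof -
  show "T_inv n i (T_simple_mult n i h) = h"
    by (rule hcar_eqI[of _ n])
      (use i h in \<open>auto simp: T_inv_apply T_simple_mult_apply ldesc_left hecke_q_def v_pow_mult_left algebra_simps v_pow_mult\<close>)
  show "T_simple_mult n i (T_inv n i h) = h"
    by (rule hcar_eqI[of _ n])
      (use i h in \<open>auto simp: T_inv_apply T_simple_mult_apply ldesc_left hecke_q_def v_pow_mult_left algebra_simps v_pow_mult\<close>)
qed

lemma hmult_T_inv:
  assumes g: "g \<in> hcar n" and h: "h \<in> hcar n" and i: "Suc i < n"
  shows "hmult n (T_inv n i g) h = T_inv n i (hmult n g h)"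
  using hmult_T_left[OF T_inv_car[OF i g] h i] T_inv_T_simple_mult[OF i g]
    T_inv_T_simple_mult(1)[OF i hmult_car[OF h]] by metis

text \<open>The image of \<open>hecke_T w\<close> under the bar involution.\<close>

definition T_bar :: "nat \<Rightarrow> perm \<Rightarrow> hecke" where
  "T_bar n w = inv\<^bsub>hecke_algebra n\<^esub> (hecke_T (pinv w))"

lemma hecke_bar_eq: "hecke_bar n h = (\<lambda>x. \<Sum>w\<in>symgrp n. laurent_bar (h w) * T_bar n w x)"
  by (simp add: hecke_bar_def T_bar_def)

lemma T_bar_eqI:
  assumes "y \<in> hcar n" "w \<in> symgrp n"
    "hmult n (hecke_T (pinv w)) y = hecke_T id" "hmult n y (hecke_T (pinv w)) = hecke_T id"
  shows "T_bar n w = y"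
  unfolding T_bar_def
  using monoid.inv_unique'[OF monoid_hecke, of "hecke_T (pinv w)" n y] assms
  by (simp add: symgrp_inv)

text \<open>If \<open>s w > w\<close>, then the basis element of
  \<open>(s w)^(-1) = w^(-1) s\<close> is the one of \<open>w^(-1)\<close> times \<open>T_s\<close>,
  so its inverse is \<open>T_s^(-1)\<close> times the earlier inverse. Recursion and two-sided
  invertibility are proved together, because the ring inverse carries no information before an
  inverse has been exhibited.\<close>

lemma T_bar_aux:
  assumes "w \<in> symgrp n"
  shows "T_bar n w \<in> hcar n \<and> hmult n (hecke_T (pinv w)) (T_bar n w) = hecke_T id \<and>
    hmult n (T_bar n w) (hecke_T (pinv w)) = hecke_T id \<and>
    (\<forall>i. Suc i < n \<longrightarrow> \<not> ldesc w i \<longrightarrow> T_bar n (simple_refl i \<circ> w) = T_inv n i (T_bar n w))"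
proof -
  define good where "good w \<longleftrightarrow> T_bar n w \<in> hcar n \<and> hmult n (hecke_T (pinv w)) (T_bar n w) = hecke_T id \<and>
    hmult n (T_bar n w) (hecke_T (pinv w)) = hecke_T id" for w
  have step: "T_bar n (simple_refl i \<circ> w) = T_inv n i (T_bar n w) \<and> good (simple_refl i \<circ> w)"
    if w: "w \<in> symgrp n" and i: "Suc i < n" and nd: "\<not> ldesc w i" and good: "good w" for w i
  proof -
    let ?y = "T_inv n i (T_bar n w)" and ?u = "pinv w"
    have u: "?u \<in> symgrp n" and sw: "simple_refl i \<circ> w \<in> symgrp n"
      using w i by (auto simp: symgrp_inv)
    have D: "T_bar n w \<in> hcar n" and Du: "hmult n (hecke_T ?u) (T_bar n w) = hecke_T id"
      "hmult n (T_bar n w) (hecke_T ?u) = hecke_T id"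
      using good by (auto simp: good_def)
    have y: "?y \<in> hcar n" using D i by simp
    let ?Ts = "T_simple_mult n i (hecke_T id)"
    have Ts: "?Ts \<in> hcar n" by (rule T_simple_mult_car[OF i hcar_T]) (rule symgrp_id)
    have T1: "hecke_T id \<in> hcar n" by (rule hcar_T) (rule symgrp_id)
    have "ldesc w i \<longleftrightarrow> ?u (Suc i) < ?u i" by (simp add: ldesc_def)
    then have asc: "?u i < ?u (Suc i)" using nd symgrp_inj[OF u, of i "Suc i"] by simp
    have id_asc: "id i < id (Suc i)" "\<not> ldesc id i" by (auto simp: ldesc_def)
    \<comment> \<open>The generator arises from the unit by either multiplication, so as a right
      factor it can be absorbed into \<open>T_right\<close>.\<close>
    have Ts_eq: "?Ts = T_right n i (hecke_T id)"
      using T_right_T[OF symgrp_id i id_asc(1)] T_simple_mult_T[OF symgrp_id i id_asc(2)]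
      by (metis comp_id id_comp)
    have inv_sw: "pinv (simple_refl i \<circ> w) = ?u \<circ> simple_refl i" by (rule inv_simple_left[OF w])
    have T_eq: "hecke_T (pinv (simple_refl i \<circ> w)) = hmult n (hecke_T ?u) ?Ts"
    proof -
      have "hmult n (hecke_T ?u) ?Ts = T_right n i (hmult n (hecke_T ?u) (hecke_T id))"
        unfolding Ts_eq by (rule hmult_T_right[OF T1 i])
      also have "\<dots> = T_right n i (hecke_T ?u)" using hmult_one_right[OF hcar_T[OF u]] by simp
      also have "\<dots> = hecke_T (?u \<circ> simple_refl i)" by (rule T_right_T[OF u i asc])
      finally show ?thesis using inv_sw by simp
    qed
    have Ts_mult: "hmult n ?Ts x = T_simple_mult n i x" if "x \<in> hcar n" for x
      using hmult_T_left[OF T1 that i] hmult_one_left[OF that] by simp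
    have l: "hmult n (hecke_T (pinv (simple_refl i \<circ> w))) ?y = hecke_T id"
      unfolding T_eq using hmult_assoc[OF hcar_T[OF u] Ts y] Ts_mult[OF y]
        T_inv_T_simple_mult(2)[OF i D] Du by simp
    have r: "hmult n ?y (hecke_T (pinv (simple_refl i \<circ> w))) = hecke_T id"
      unfolding T_eq hmult_assoc[OF y hcar_T[OF u] Ts, symmetric]
        hmult_T_inv[OF D hcar_T[OF u] i] Du hmult_T_inv[OF T1 Ts i] hmult_one_left[OF Ts]
      by (rule T_inv_T_simple_mult(1)[OF i T1])
    have "T_bar n (simple_refl i \<circ> w) = ?y" by (rule T_bar_eqI[OF y sw l r])
    then show ?thesis using y l r by (simp add: good_def)
  qed
  have "good w"
    using assms
  proof (induction rule: symgrp_left_induct)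
    case id
    have 1: "hmult n (hecke_T id) (hecke_T id) = hecke_T id"
      by (rule hmult_one_left[OF hcar_T[OF symgrp_id]])
    have 2: "T_bar n id = hecke_T id"
      by (rule T_bar_eqI[OF hcar_T[OF symgrp_id] symgrp_id]) (simp_all only: inv_id 1)
    show ?case unfolding good_def 2 inv_id using 1 hcar_T[OF symgrp_id] by simp
  qed (use step in blast)
  then show ?thesis using step assms by (auto simp: good_def)
qed

lemma T_bar_car [simp]: "w \<in> symgrp n \<Longrightarrow> T_bar n w \<in> hcar n"
  using T_bar_aux by blast

lemma T_bar_step:
  "w \<in> symgrp n \<Longrightarrow> Suc i < n \<Longrightarrow> \<not> ldesc w i \<Longrightarrow> T_bar n (simple_refl i \<circ> w) = T_inv n i (T_bar n w)"
  using T_bar_aux by blast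

lemma T_bar_id: "T_bar n id = hecke_T id"
  using T_bar_aux[OF symgrp_id, of n] hmult_one_left[OF T_bar_car[OF symgrp_id], of n]
  by (simp only: inv_id)

text \<open>Triangularity with respect to length, with leading coefficient \<open>q^(-l(w))\<close>.
  This coarse form, without the Bruhat order, carries the uniqueness argument.\<close>

lemma T_bar_support:
  assumes "w \<in> symgrp n"
  shows "(\<forall>y\<in>symgrp n. T_bar n w y \<noteq> 0 \<longrightarrow> y = w \<or> perm_length n y < perm_length n w) \<and>
     T_bar n w w = v_pow (- 2 * int (perm_length n w))"
  using assms
proof (induction rule: symgrp_left_induct)
  case id
  have "T_bar n id id = v_pow (- 2 * int (perm_length n id))"
    unfolding T_bar_id perm_length_id by (simp add: hecke_T_def)
  moreover have "y = id" if "T_bar n id y \<noteq> 0" for y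
    using that unfolding T_bar_id hecke_T_def by meson
  ultimately show ?case by blast
next
  case (step i w)
  let ?s = "simple_refl i"
  have sw: "?s \<circ> w \<in> symgrp n" using step by simp
  have l: "perm_length n (?s \<circ> w) = Suc (perm_length n w)" using step perm_length_left_up by blast
  have app: "T_bar n (?s \<circ> w) y = (if ldesc y i then v_pow (- 2) * T_bar n w (?s \<circ> y)
     else T_bar n w (?s \<circ> y) + (v_pow (- 2) - 1) * T_bar n w y)" if "y \<in> symgrp n" for y
    using that step(2) by (simp only: T_bar_step[OF step(1-3)] T_inv_apply)
  have "T_bar n (?s \<circ> w) (?s \<circ> w) = v_pow (- 2 * int (perm_length n (?s \<circ> w)))"
  proof -
    have "ldesc (?s \<circ> w) i" using step by (simp only: ldesc_left) simp
    then have "T_bar n (?s \<circ> w) (?s \<circ> w) = v_pow (- 2) * T_bar n w w"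
      using app[OF sw] by (simp only: if_True simple_refl_comp_self)
    also have "\<dots> = v_pow (- 2 * int (perm_length n (?s \<circ> w)))"
      using step unfolding l by (simp add: v_pow_mult)
    finally show ?thesis .
  qed
  moreover have "y = ?s \<circ> w \<or> perm_length n y < perm_length n (?s \<circ> w)"
    if y: "y \<in> symgrp n" and nz: "T_bar n (?s \<circ> w) y \<noteq> 0" for y
  proof -
    have "T_bar n w (?s \<circ> y) \<noteq> 0 \<or> T_bar n w y \<noteq> 0"
      using nz unfolding app[OF y] by (auto split: if_splits)
    then show ?thesis
    proof
      assume "T_bar n w (?s \<circ> y) \<noteq> 0"
      then consider "?s \<circ> y = w" | "perm_length n (?s \<circ> y) < perm_length n w"
        using step y by (meson symgrp_simple_left)
      then show ?thesis
      proof cases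
        case 1
        then have "y = ?s \<circ> w" by (metis simple_refl_comp_self(1))
        then show ?thesis ..
      next
        case 2
        then show ?thesis using l perm_length_left_up[OF y step(2)] perm_length_left_down[OF y step(2)]
          by (cases "ldesc y i") auto
      qed
    next
      assume "T_bar n w y \<noteq> 0"
      then have "perm_length n y \<le> perm_length n w" using step y by auto
      then show ?thesis using l by simp
    qed
  qed
  ultimately show ?case by blast
qed

text \<open>Groups the elements into cosets \<open>{w, s w}\<close>, on which left multiplication by
  the generator of \<open>s\<close> closes up.\<close>

lemma sum_pairs:
  assumes i: "Suc i < n"
  shows "(\<Sum>w\<in>symgrp n. f w) = (\<Sum>w | w \<in> symgrp n \<and> \<not> ldesc w i. f w + f (simple_refl i \<circ> w) :: 'a :: comm_monoid_add)"
proof -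
  let ?A = "{w \<in> symgrp n. \<not> ldesc w i}" and ?B = "{w \<in> symgrp n. ldesc w i}"
  have "(\<Sum>w\<in>symgrp n. f w) = sum f ?A + sum f ?B"
    by (subst sum.union_disjoint [symmetric]) (auto intro!: sum.cong)
  also have "sum f ?B = (\<Sum>w\<in>?A. f (simple_refl i \<circ> w))"
    by (rule sum.reindex_bij_witness[where i = "\<lambda>w. simple_refl i \<circ> w" and j = "\<lambda>w. simple_refl i \<circ> w"])
      (use i in \<open>auto simp: ldesc_left\<close>)
  finally show ?thesis by (simp add: sum.distrib)
qed

text \<open>The bar map is multiplicative for a generator on the left, which it sends to
  \<open>T_s^(-1)\<close>. On each coset \<open>{w, s w}\<close> the claim amounts to the quadratic
  relation of the inverse generator.\<close>

lemma hecke_bar_T_simple_mult: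
  assumes h: "h \<in> hcar n" and i: "Suc i < n"
  shows "hecke_bar n (T_simple_mult n i h) = T_inv n i (hecke_bar n h)"
proof (rule ext)
  fix x
  let ?s = "simple_refl i" and ?A = "{w \<in> symgrp n. \<not> ldesc w i}"
  \<comment> \<open>The quadratic relation with \<open>q\<close> replaced by
    \<open>q^(-1)\<close>.\<close>
  have T2: "T_inv n i (T_inv n i g) x = (v_pow (- 2) - 1) * T_inv n i g x + v_pow (- 2) * g x"
    if "g \<in> hcar n" for g
  proof (cases "x \<in> symgrp n")
    case True
    then show ?thesis using i by (auto simp: T_inv_apply ldesc_left algebra_simps)
  next
    case False
    then show ?thesis using i that T_inv_car[OF i that] T_inv_car[OF i T_inv_car[OF i that]]
      by (metis (no_types) add_0 hcarD mult_zero_right)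
  qed
  have "hecke_bar n (T_simple_mult n i h) x =
     (\<Sum>w\<in>?A. laurent_bar (T_simple_mult n i h w) * T_bar n w x +
        laurent_bar (T_simple_mult n i h (?s \<circ> w)) * T_bar n (?s \<circ> w) x)"
    unfolding hecke_bar_eq by (rule sum_pairs[OF i])
  also have "\<dots> = (\<Sum>w\<in>?A. laurent_bar (h w) * T_inv n i (T_bar n w) x +
        laurent_bar (h (?s \<circ> w)) * T_inv n i (T_bar n (?s \<circ> w)) x)"
  proof (rule sum.cong [OF refl])
    fix w assume "w \<in> ?A"
    then have w: "w \<in> symgrp n" "\<not> ldesc w i" by auto
    then have sw: "?s \<circ> w \<in> symgrp n" "ldesc (?s \<circ> w) i" using i by (auto simp: ldesc_left)
    have q: "laurent_bar ((v_pow 2 - 1) * a) = (v_pow (- 2) - 1) * laurent_bar a" for a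
      by (simp add: left_diff_distrib laurent_bar_diff laurent_bar_v_pow_mult)
    show "laurent_bar (T_simple_mult n i h w) * T_bar n w x +
        laurent_bar (T_simple_mult n i h (?s \<circ> w)) * T_bar n (?s \<circ> w) x =
      laurent_bar (h w) * T_inv n i (T_bar n w) x +
        laurent_bar (h (?s \<circ> w)) * T_inv n i (T_bar n (?s \<circ> w)) x"
      unfolding T_simple_mult_apply[OF w(1) i] T_simple_mult_apply[OF sw(1) i] T_bar_step[OF w(1) i w(2)]
        T2[OF T_bar_car[OF w(1)]] hecke_q_def
      by (simp only: w sw if_True if_False simple_refl_comp_self laurent_bar_add laurent_bar_v_pow_mult q)
        (simp add: algebra_simps)
  qed
  also have "\<dots> = (\<Sum>w\<in>symgrp n. laurent_bar (h w) * T_inv n i (T_bar n w) x)"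
    by (rule sum_pairs[OF i, symmetric])
  also have "\<dots> = T_inv n i (hecke_bar n h) x"
    unfolding hecke_bar_eq hlinD[OF hlin_T_inv] ..
  finally show "hecke_bar n (T_simple_mult n i h) x = T_inv n i (hecke_bar n h) x" .
qed

section \<open>Bruhat order\<close>

definition bruhat_step :: "nat \<Rightarrow> perm \<Rightarrow> perm \<Rightarrow> bool" where
  "bruhat_step n u u' \<longleftrightarrow> (\<exists>a b. a < b \<and> b < n \<and> u' = u \<circ> transpose a b
        \<and> perm_length n u < perm_length n u')"

lemma bruhat_le_eq: "bruhat_le n x w \<longleftrightarrow> x \<in> symgrp n \<and> (bruhat_step n)\<^sup>*\<^sup>* x w"
  by (simp add: bruhat_le_def bruhat_step_def [abs_def])

lemma symgrp_transpose:
  "u \<in> symgrp n \<Longrightarrow> a < n \<Longrightarrow> b < n \<Longrightarrow> u \<circ> transpose a b \<in> symgrp n"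
  by (rule symgrp_comp) (auto simp: symgrp_def intro!: permutes_swap_id)

text \<open>With \<open>c = a + 1\<close>, the transposition \<open>(a b)\<close> is the product
  \<open>(a c)(c b)(a c)\<close>, whose middle factor raises the length by induction. Since
  \<open>u a < u b\<close>, the two outer factors cannot both lower it.\<close>

lemma length_transpose_up:
  assumes "u \<in> symgrp n" "a < b" "b < n" "u a < u b"
  shows "perm_length n u < perm_length n (u \<circ> transpose a b)"
  using assms
proof (induction "b - a" arbitrary: u a b rule: less_induct)
  case less
  show ?case
  proof (cases "b = Suc a")
    case True
    then show ?thesis using perm_length_right_up[of u n a] less.prems by (simp add: simple_refl_def)
  next
    case False
    let ?c = "Suc a" and ?s = "simple_refl a"
    define u1 where "u1 = u \<circ> ?s"
    define u2 where "u2 = u1 \<circ> transpose ?c b"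
    have c: "?c < b" using False less.prems by simp
    have u3: "u \<circ> transpose a b = u2 \<circ> ?s"
      unfolding u1_def u2_def simple_refl_def using c
      by (auto simp: fun_eq_iff transpose_def)
    have u1: "u1 \<in> symgrp n" "u1 ?c = u a" "u1 b = u b" "u1 a = u ?c"
      using less.prems c by (auto simp: u1_def simple_refl_apply)
    have u2: "u2 \<in> symgrp n" "u2 a = u ?c" "u2 ?c = u b"
      using u1 c less.prems by (auto simp: u2_def intro!: symgrp_transpose)
    have "perm_length n u1 < perm_length n u2"
      unfolding u2_def by (rule less.hyps) (use u1 c less.prems in auto)
    moreover have "u ?c < u b \<Longrightarrow> perm_length n (u2 \<circ> ?s) = Suc (perm_length n u2)"
      "u b < u ?c \<Longrightarrow> Suc (perm_length n (u2 \<circ> ?s)) = perm_length n u2"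
      using perm_length_right_up[OF u2(1), of a] perm_length_right_down[OF u2(1), of a] u2 c less.prems
      by auto
    moreover have "u a < u ?c \<Longrightarrow> perm_length n u1 = Suc (perm_length n u)"
      "u ?c < u a \<Longrightarrow> Suc (perm_length n u1) = perm_length n u"
      using perm_length_right_up[OF less.prems(1), of a] perm_length_right_down[OF less.prems(1), of a]
        c less.prems by (auto simp: u1_def)
    moreover have "u ?c \<noteq> u b" "u ?c \<noteq> u a"
      using symgrp_inj[OF less.prems(1)] c by auto
    ultimately show ?thesis unfolding u3 using less.prems(4) by linarith
  qed
qed

lemma length_transpose_less_iff:
  assumes u: "u \<in> symgrp n" and ab: "a < b" "b < n"
  shows "perm_length n u < perm_length n (u \<circ> transpose a b) \<longleftrightarrow> u a < u b"
proof
  assume lt: "perm_length n u < perm_length n (u \<circ> transpose a b)"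
  show "u a < u b"
  proof (rule ccontr)
    assume "\<not> u a < u b"
    then have "u b < u a" using symgrp_inj[OF u, of a b] ab by auto
    then have "perm_length n (u \<circ> transpose a b) < perm_length n ((u \<circ> transpose a b) \<circ> transpose a b)"
      using u ab by (intro length_transpose_up) (auto intro!: symgrp_transpose)
    moreover have "(u \<circ> transpose a b) \<circ> transpose a b = u" by (simp add: fun_eq_iff)
    ultimately show False using lt by (metis less_asym)
  qed
qed (use length_transpose_up[OF u ab] in simp)

lemma bruhat_le_symgrp: "bruhat_le n x w \<Longrightarrow> x \<in> symgrp n \<and> w \<in> symgrp n"
  unfolding bruhat_le_eq
proof (elim conjE)
  assume x: "x \<in> symgrp n" and "(bruhat_step n)\<^sup>*\<^sup>* x w"
  from this(2) have "w \<in> symgrp n"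
    by (induction rule: rtranclp_induct) (use x in \<open>auto simp: bruhat_step_def intro!: symgrp_transpose\<close>)
  then show "x \<in> symgrp n \<and> w \<in> symgrp n" using x by simp
qed

lemma bruhat_le_refl: "x \<in> symgrp n \<Longrightarrow> bruhat_le n x x"
  by (simp add: bruhat_le_eq)

lemma bruhat_le_trans: "bruhat_le n x y \<Longrightarrow> bruhat_le n y z \<Longrightarrow> bruhat_le n x z"
  by (auto simp: bruhat_le_eq)

lemma bruhat_le_length: "bruhat_le n x w \<Longrightarrow> x = w \<or> perm_length n x < perm_length n w"
  unfolding bruhat_le_eq
proof (elim conjE)
  assume "(bruhat_step n)\<^sup>*\<^sup>* x w"
  then show "x = w \<or> perm_length n x < perm_length n w"
    by (induction rule: rtranclp_induct) (auto simp: bruhat_step_def)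
qed

lemma bruhat_leI:
  assumes "u \<in> symgrp n" "a < b" "b < n" "u a < u b"
  shows "bruhat_le n u (u \<circ> transpose a b)"
proof -
  have "bruhat_step n u (u \<circ> transpose a b)"
    using length_transpose_up[OF assms] assms by (auto simp: bruhat_step_def)
  then show ?thesis using assms by (auto simp: bruhat_le_eq)
qed

text \<open>Exchanging two values means exchanging the positions that hold them. This links left
  multiplication to the Bruhat order, which is defined by transpositions on the right.\<close>

lemma simple_left_transpose:
  assumes "u \<in> symgrp n" "u a = i" "u b = Suc i"
  shows "simple_refl i \<circ> u = u \<circ> transpose a b"
proof (rule ext)
  fix x
  show "(simple_refl i \<circ> u) x = (u \<circ> transpose a b) x"
    using assms symgrp_inj[OF assms(1), of x a] symgrp_inj[OF assms(1), of x b]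
    by (auto simp: simple_refl_apply transpose_def)
qed

lemma bruhat_le_simple_left:
  assumes u: "u \<in> symgrp n" and i: "Suc i < n" and nd: "\<not> ldesc u i"
  shows "bruhat_le n u (simple_refl i \<circ> u)"
proof -
  have "pinv u i \<noteq> pinv u (Suc i)" using symgrp_inj[OF symgrp_inv[OF u]] by simp
  then have "pinv u i < pinv u (Suc i)" "pinv u (Suc i) < n"
    using nd u i symgrp_less[OF symgrp_inv[OF u]] by (auto simp: ldesc_def)
  then have "bruhat_le n u (u \<circ> transpose (pinv u i) (pinv u (Suc i)))"
    using u by (intro bruhat_leI) auto
  then show ?thesis using simple_left_transpose[OF u, of "pinv u i" i "pinv u (Suc i)"] u by simp
qed

text \<open>The lifting property, by induction down a chain from \<open>u\<close> to
  \<open>y\<close>. For a link from \<open>y\<close> to \<open>z\<close>, either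
  \<open>s y = z\<close>, or left multiplication by \<open>s\<close> keeps the order of the two
  exchanged entries, so that \<open>s y\<close> and \<open>s z\<close> again form a link.\<close>

lemma bruhat_lift:
  assumes yu: "bruhat_le n y u" and i: "Suc i < n" and nd: "\<not> ldesc u i"
  shows "bruhat_le n y (simple_refl i \<circ> u) \<and> bruhat_le n (simple_refl i \<circ> y) (simple_refl i \<circ> u)"
proof -
  let ?s = "simple_refl i"
  have u: "u \<in> symgrp n" using yu bruhat_le_symgrp by blast
  have "y \<in> symgrp n \<longrightarrow> bruhat_le n y (?s \<circ> u) \<and> bruhat_le n (?s \<circ> y) (?s \<circ> u)"
    using yu unfolding bruhat_le_eq[of n y u]
  proof (elim conjE)
    assume "(bruhat_step n)\<^sup>*\<^sup>* y u"
    then show ?thesis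
    proof (induction rule: converse_rtranclp_induct)
      case base
      show ?case using bruhat_le_simple_left[OF u i nd] bruhat_le_refl bruhat_le_symgrp by blast
    next
      case (step y z)
      show ?case
      proof
        assume y: "y \<in> symgrp n"
        obtain a b where ab: "a < b" "b < n" "z = y \<circ> transpose a b" "perm_length n y < perm_length n z"
          using step(1) by (auto simp: bruhat_step_def)
        have z: "z \<in> symgrp n" unfolding ab(3) using ab y by (intro symgrp_transpose) auto
        have lt: "y a < y b" using ab length_transpose_less_iff[OF y ab(1,2)] by metis
        have yz: "bruhat_le n y z" unfolding ab(3) by (rule bruhat_leI[OF y ab(1,2) lt])
        have IH: "bruhat_le n z (?s \<circ> u)" "bruhat_le n (?s \<circ> z) (?s \<circ> u)" using step(3) z by blast+
        have "bruhat_le n (?s \<circ> y) (?s \<circ> u)"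
        proof (cases "y a = i \<and> y b = Suc i")
          case True
          then have "?s \<circ> y = z" unfolding ab(3) using simple_left_transpose[OF y] by blast
          then show ?thesis using IH(1) by metis
        next
          case False
          then have "(?s \<circ> y) a < (?s \<circ> y) b" using lt by (auto simp: simple_refl_less_iff)
          then have "bruhat_le n (?s \<circ> y) ((?s \<circ> y) \<circ> transpose a b)"
            using y i ab by (intro bruhat_leI) auto
          moreover have "(?s \<circ> y) \<circ> transpose a b = ?s \<circ> z" unfolding ab(3) by (rule comp_assoc)
          ultimately show ?thesis using IH bruhat_le_trans by metis
        qed
        then show "bruhat_le n y (?s \<circ> u) \<and> bruhat_le n (?s \<circ> y) (?s \<circ> u)"
          using bruhat_le_trans[OF yz IH(1)] by blast
      qed
    qed
  qed
  then show ?thesis using yu bruhat_le_symgrp by blast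
qed

text \<open>The inverse of \<open>x (a b)\<close> is the inverse of \<open>x\<close> times the
  transposition of \<open>x a\<close> and \<open>x b\<close>, so a chain is inverted link by
  link.\<close>

lemma bruhat_le_inv:
  assumes "bruhat_le n x w" shows "bruhat_le n (pinv x) (pinv w)"
proof -
  have "x \<in> symgrp n" "(bruhat_step n)\<^sup>*\<^sup>* x w" using assms by (auto simp: bruhat_le_eq)
  from this(2,1) have "x \<in> symgrp n \<and> bruhat_le n (pinv x) (pinv w)"
  proof (induction rule: converse_rtranclp_induct)
    case base
    then show ?case by (simp add: bruhat_le_refl symgrp_inv)
  next
    case (step x z)
    then obtain a b where ab: "a < b" "b < n" "z = x \<circ> transpose a b" "perm_length n x < perm_length n z"
      by (auto simp: bruhat_step_def)
    have x: "x \<in> symgrp n" by fact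
    have z: "z \<in> symgrp n" unfolding ab(3) using ab x by (intro symgrp_transpose) auto
    have lt: "x a < x b" using ab length_transpose_less_iff[OF x ab(1,2)] by metis
    have "x b < n" using x ab symgrp_less by blast
    then have "bruhat_le n (pinv x) (pinv x \<circ> transpose (x a) (x b))"
      using lt ab x by (intro bruhat_leI symgrp_inv) auto
    also have "pinv x \<circ> transpose (x a) (x b) = pinv z"
    proof -
      have "pinv z = transpose a b \<circ> pinv x"
        unfolding ab(3) by (subst o_inv_distrib) (auto simp: symgrp_bij[OF x])
      also have "\<dots> = pinv x \<circ> transpose (x a) (x b)"
      proof (rule ext)
        fix k
        have "pinv x k = a \<longleftrightarrow> k = x a" "pinv x k = b \<longleftrightarrow> k = x b" using x by auto
        then show "(transpose a b \<circ> pinv x) k = (pinv x \<circ> transpose (x a) (x b)) k"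
          using x by (auto simp: transpose_def)
      qed
      finally show ?thesis ..
    qed
    finally show ?case using step.IH z x bruhat_le_trans by blast
  qed
  then show ?thesis by blast
qed

section \<open>Laurent polynomials from polynomials\<close>

lemma laurent_of_poly_pCons:
  "laurent_of_poly (pCons a p) = lmon 0 a + hecke_q * laurent_of_poly p"
  using single_of_int[of a, where 'b = int, where 'a = int]
  by (simp add: laurent_of_poly_def map_poly_pCons)

lemma lk_laurent_of_poly:
  "lk (laurent_of_poly p) k = (if 0 \<le> k \<and> even k then coeff p (nat (k div 2)) else 0)"
proof (induction p arbitrary: k)
  case 0
  show ?case by (simp add: laurent_of_poly_def)
next
  case (pCons a p)
  have "lk (laurent_of_poly (pCons a p)) k = (if k = 0 then a else 0) + lk (laurent_of_poly p) (k - 2)"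
    unfolding laurent_of_poly_pCons hecke_q_def lookup_add lk_v_pow_mult
    by (auto simp: lookup_single when_def)
  also have "\<dots> = (if 0 \<le> k \<and> even k then coeff (pCons a p) (nat (k div 2)) else 0)"
  proof (cases "2 \<le> k \<and> even k")
    case True
    then have "nat (k div 2) = Suc (nat ((k - 2) div 2))" by auto
    then show ?thesis using True unfolding pCons.IH by simp
  next
    case False
    then have "k = 0 \<or> \<not> (0 \<le> k \<and> even k)" by presburger
    then show ?thesis using False unfolding pCons.IH by auto
  qed
  finally show ?case .
qed

lemma laurent_of_poly_0 [simp]: "laurent_of_poly 0 = 0"
  by (simp add: laurent_of_poly_def)

lemma laurent_of_poly_1 [simp]: "laurent_of_poly 1 = 1"
  by (simp add: laurent_of_poly_def)

lemma laurent_of_poly_add: "laurent_of_poly (p + q) = laurent_of_poly p + laurent_of_poly q"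
  by (rule poly_mapping_eqI) (simp add: lookup_add lk_laurent_of_poly)

lemma laurent_of_poly_diff: "laurent_of_poly (p - q) = laurent_of_poly p - laurent_of_poly q"
  by (rule poly_mapping_eqI) (simp add: lookup_minus lk_laurent_of_poly)

lemma laurent_of_poly_sum: "finite A \<Longrightarrow> laurent_of_poly (\<Sum>a\<in>A. f a) = (\<Sum>a\<in>A. laurent_of_poly (f a))"
  by (induction A rule: finite_induct) (auto simp: laurent_of_poly_add)

lemma laurent_of_poly_monom_mult:
  "laurent_of_poly (monom c k * p) = lmon (2 * int k) c * laurent_of_poly p"
proof (rule poly_mapping_eqI)
  fix j
  have "nat (j div 2) - k = nat ((j - 2 * int k) div 2)" if "2 * int k \<le> j" "even j"
    using that by (auto elim!: evenE)
  moreover have "k \<le> nat (j div 2) \<longleftrightarrow> 2 * int k \<le> j" if "0 \<le> j" "even j"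
    using that by (auto elim!: evenE)
  ultimately show "lk (laurent_of_poly (monom c k * p)) j = lk (lmon (2 * int k) c * laurent_of_poly p) j"
    by (auto simp: lk_laurent_of_poly lk_lmon_mult coeff_monom_mult)
qed

section \<open>Uniqueness of Kazhdan--Lusztig families\<close>

lemma hecke_bar_diff: "hecke_bar n (\<lambda>x. g x - h x) = (\<lambda>x. hecke_bar n g x - hecke_bar n h x)"
  by (simp add: hecke_bar_eq laurent_bar_diff left_diff_distrib sum_subtractf)

lemma hecke_bar_add: "hecke_bar n (\<lambda>x. g x + h x) = (\<lambda>x. hecke_bar n g x + hecke_bar n h x)"
  by (simp add: hecke_bar_eq laurent_bar_add distrib_right sum.distrib)

lemma hecke_bar_lmon: "hecke_bar n (\<lambda>x. lmon k c * h x) = (\<lambda>x. lmon (- k) c * hecke_bar n h x)"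
  by (simp add: hecke_bar_eq laurent_bar_lmon_mult sum_distrib_left mult.assoc)

lemma hecke_bar_zero: "hecke_bar n (\<lambda>x. 0) = (\<lambda>x. 0)"
  by (simp add: hecke_bar_eq)

lemma hecke_bar_sum:
  "finite A \<Longrightarrow> hecke_bar n (\<lambda>x. \<Sum>a\<in>A. F a x) = (\<lambda>x. \<Sum>a\<in>A. hecke_bar n (F a) x)"
  by (induction A rule: finite_induct) (simp_all add: hecke_bar_zero hecke_bar_add)

text \<open>Elements longer than \<open>x\<close> have coefficient 0, and by triangularity an
  element other than \<open>x\<close> that is not longer contributes nothing at
  \<open>x\<close>.\<close>

lemma hecke_bar_top:
  assumes x: "x \<in> symgrp n" and top: "\<And>w. w \<in> symgrp n \<Longrightarrow> perm_length n x < perm_length n w \<Longrightarrow> h w = 0"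
  shows "hecke_bar n h x = laurent_bar (h x) * v_pow (- 2 * int (perm_length n x))"
proof -
  have "laurent_bar (h w) * T_bar n w x = (if w = x then laurent_bar (h x) * v_pow (- 2 * int (perm_length n x)) else 0)"
    if "w \<in> symgrp n" for w
    using T_bar_support[OF that] x top[OF that] by (cases "w = x") auto
  then show ?thesis using x by (simp add: hecke_bar_eq cong: sum.cong)
qed

text \<open>The degree bound as vanishing of coefficients, with an added \<open>2 * k\<close> in
  place of a truncated subtraction.\<close>

lemma is_kl_family_coeff:
  assumes "is_kl_family n w p" "y \<noteq> w" "perm_length n w \<le> perm_length n y + 2 * k"
  shows "coeff (p y) k = 0"
proof (cases "bruhat_le n y w")
  case True
  then have "2 * degree (p y) + 1 \<le> perm_length n w - perm_length n y"
    using assms by (auto simp: is_kl_family_def)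
  then have "degree (p y) < k" using assms(3) by linarith
  then show ?thesis by (rule coeff_eq_0)
qed (use assms in \<open>auto simp: is_kl_family_def\<close>)

text \<open>Let \<open>e\<close> be the difference of the two candidate basis elements and
  \<open>x\<close> a longest element of its support. Bar invariance makes the coefficients of
  \<open>e x\<close> symmetric about the exponent \<open>- l(x)\<close> of \<open>v\<close>, while
  the degree bound confines them strictly below it; so \<open>e x = 0\<close>.\<close>

lemma is_kl_family_unique:
  assumes p: "is_kl_family n w p" and p': "is_kl_family n w p'" and w: "w \<in> symgrp n"
  shows "p = p'"
proof (rule ccontr)
  assume "p \<noteq> p'"
  then obtain x0 where x0: "p x0 \<noteq> p' x0" by blast
  define e where "e = (\<lambda>x. kl_element n w p x - kl_element n w p' x)"
  have e_eq: "e x = v_pow (- int (perm_length n w)) * laurent_of_poly (p x - p' x)" for x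
    by (simp add: e_def kl_element_def laurent_of_poly_diff right_diff_distrib)
  have lk_e: "lk (e x) k = (let j = k + int (perm_length n w) in
      if 0 \<le> j \<and> even j then coeff (p x - p' x) (nat (j div 2)) else 0)" for x k
    by (simp add: e_eq lk_v_pow_mult lk_laurent_of_poly Let_def)
  have bar: "hecke_bar n e = e"
    using p p' by (simp add: e_def hecke_bar_diff is_kl_family_def)
  define B where "B = {x \<in> symgrp n. p x \<noteq> p' x}"
  have "x0 \<in> B"
    using x0 p p' bruhat_le_symgrp by (fastforce simp: B_def is_kl_family_def)
  moreover have "finite B" by (simp add: B_def)
  ultimately obtain x where x: "x \<in> B" "\<And>y. y \<in> B \<Longrightarrow> perm_length n y \<le> perm_length n x"
    using Max_ge[of "perm_length n ` B"] Max_in[of "perm_length n ` B"]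
    by (metis (no_types, lifting) empty_iff finite_imageI imageE image_eqI image_is_empty)
  have xs: "x \<in> symgrp n" "p x \<noteq> p' x" using x by (auto simp: B_def)
  have xw: "x \<noteq> w" using xs p p' by (auto simp: is_kl_family_def)
  have "e y = 0" if "y \<in> symgrp n" "perm_length n x < perm_length n y" for y
  proof -
    have "y \<notin> B" using x(2)[of y] that by auto
    then show ?thesis using that by (simp add: B_def e_eq)
  qed
  then have eq: "e x = v_pow (- 2 * int (perm_length n x)) * laurent_bar (e x)"
    using hecke_bar_top[OF xs(1), of e] bar by (simp add: mult.commute)
  have sym: "lk (e x) k = lk (e x) (- 2 * int (perm_length n x) - k)" for k
    by (subst eq) (simp only: lk_v_pow_mult lk_laurent_bar minus_diff_eq)
  have deg: "coeff (p x - p' x) k = 0" if "perm_length n w \<le> perm_length n x + 2 * k" for k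
    using is_kl_family_coeff[OF p xw that] is_kl_family_coeff[OF p' xw that] by simp
  have zero: "lk (e x) k = 0" if "- int (perm_length n x) \<le> k" for k
  proof -
    let ?j = "k + int (perm_length n w)"
    have "perm_length n w \<le> perm_length n x + 2 * nat (?j div 2)" if "0 \<le> ?j" "even ?j"
    proof -
      have "2 * (?j div 2) = ?j" using that by simp
      then have "int (2 * nat (?j div 2)) = ?j" using that by simp
      then show ?thesis using \<open>- int (perm_length n x) \<le> k\<close> by linarith
    qed
    then show ?thesis using deg by (auto simp: lk_e Let_def)
  qed
  have "coeff (p x - p' x) k = 0" for k
  proof -
    let ?k = "2 * int k - int (perm_length n w)"
    have "coeff (p x - p' x) k = lk (e x) ?k" by (simp add: lk_e)
    also have "\<dots> = 0"
    proof (cases "- int (perm_length n x) \<le> ?k")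
      case False
      then have "- int (perm_length n x) \<le> - 2 * int (perm_length n x) - ?k" by linarith
      then show ?thesis using sym zero by metis
    qed (rule zero)
    finally show ?thesis .
  qed
  then show False using xs(2) by (metis eq_iff_diff_eq_0 poly_eqI coeff_0)
qed

section \<open>Existence of Kazhdan--Lusztig families\<close>

text \<open>By uniqueness any exhibited family identifies the definite description, so
  \<open>kl_poly\<close> becomes usable for \<open>w\<close> as soon as a family for
  \<open>w\<close> is constructed.\<close>

lemma kl_poly_eqI:
  assumes "is_kl_family n w p" "w \<in> symgrp n"
  shows "kl_poly n x w = p x" "is_kl_family n w (\<lambda>x. kl_poly n x w)"
proof -
  have "(THE p. is_kl_family n w p) = p"
    using assms is_kl_family_unique by (blast intro: the_equality)
  then show "kl_poly n x w = p x" "is_kl_family n w (\<lambda>x. kl_poly n x w)"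
    using assms by (simp_all add: kl_poly_def)
qed

text \<open>The coefficient at \<open>y\<close> of \<open>T_s + 1\<close> times the basis element of
  \<open>u\<close>, up to a power of \<open>v\<close>.\<close>

definition kl_step :: "nat \<Rightarrow> (perm \<Rightarrow> int poly) \<Rightarrow> perm \<Rightarrow> int poly" where
  "kl_step i p y = (if ldesc y i then p (simple_refl i \<circ> y) + monom 1 1 * p y
     else monom 1 1 * p (simple_refl i \<circ> y) + p y)"

text \<open>The elements whose basis elements are subtracted from the product to restore the degree
  bound.\<close>

definition kl_corr :: "nat \<Rightarrow> nat \<Rightarrow> perm \<Rightarrow> perm set" where
  "kl_corr n i u = {z \<in> symgrp n. ldesc z i \<and> kl_mu n z u \<noteq> 0}"

definition kl_rec :: "nat \<Rightarrow> nat \<Rightarrow> perm \<Rightarrow> perm \<Rightarrow> int poly" where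
  "kl_rec n i u y = kl_step i (\<lambda>x. kl_poly n x u) y -
     (\<Sum>z\<in>kl_corr n i u. monom (kl_mu n z u) ((Suc (perm_length n u) - perm_length n z) div 2) * kl_poly n y z)"

lemma finite_kl_corr [simp]: "finite (kl_corr n i u)"
  by (simp add: kl_corr_def)

lemma kl_corr_length:
  assumes "z \<in> kl_corr n i u"
  shows "perm_length n z < perm_length n u"
    "2 * ((Suc (perm_length n u) - perm_length n z) div 2) = Suc (perm_length n u) - perm_length n z"
  using assms by (auto simp: kl_corr_def kl_mu_def split: if_splits)

lemma kl_element_car:
  assumes "is_kl_family n w p" shows "kl_element n w p \<in> hcar n"
proof -
  have "p x = 0" if "x \<notin> symgrp n" for x
    using assms that bruhat_le_symgrp unfolding is_kl_family_def by blast
  then show ?thesis by (simp add: kl_element_def hcar_def)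
qed

lemma kl_element_step:
  assumes u: "u \<in> symgrp n" and i: "Suc i < n" and nd: "\<not> ldesc u i" and p: "is_kl_family n u p"
  shows "kl_element n (simple_refl i \<circ> u) (kl_step i p) =
    (\<lambda>x. lmon (- 1) 1 * (T_simple_mult n i (kl_element n u p) x + kl_element n u p x))"
proof (rule ext)
  fix x
  let ?h = "kl_element n u p" and ?s = "simple_refl i"
  have h: "?h \<in> hcar n" by (rule kl_element_car[OF p])
  have l: "perm_length n (?s \<circ> u) = Suc (perm_length n u)" by (rule perm_length_left_up[OF u i nd])
  have X: "laurent_of_poly (monom 1 1 * q) = hecke_q * laurent_of_poly q" for q
    by (simp add: laurent_of_poly_monom_mult hecke_q_def v_pow_def)
  have v: "v_pow (- int (perm_length n (?s \<circ> u))) * a = lmon (- 1) 1 * (v_pow (- int (perm_length n u)) * a)" for a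
    unfolding l v_pow_def mult.assoc[symmetric] mult_single by simp
  show "kl_element n (?s \<circ> u) (kl_step i p) x = lmon (- 1) 1 * (T_simple_mult n i ?h x + ?h x)"
  proof (cases "x \<in> symgrp n")
    case True
    have "T_simple_mult n i ?h x + ?h x =
        v_pow (- int (perm_length n u)) * laurent_of_poly (kl_step i p x)"
      unfolding T_simple_mult_apply[OF True i] kl_step_def kl_element_def
      by (cases "ldesc x i"; simp only: if_True if_False laurent_of_poly_add X) (simp_all add: algebra_simps)
    then show ?thesis unfolding kl_element_def[of n "?s \<circ> u"] v by simp
  next
    case False
    then have "p x = 0" "p (?s \<circ> x) = 0"
      using p i bruhat_le_symgrp unfolding is_kl_family_def by (metis symgrp_simple_left)+
    then have "kl_step i p x = 0" by (simp add: kl_step_def)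
    then show ?thesis using False T_simple_mult_out[OF False i h] hcarD[OF h False]
      by (simp add: kl_element_def)
  qed
qed

text \<open>The factor \<open>v^(-1) (T_s + 1)\<close> is bar invariant:
  \<open>v (T_s^(-1) + 1) = v^(-1) (T_s + 1)\<close> by the quadratic relation.\<close>

lemma bar_step:
  assumes h: "h \<in> hcar n" and i: "Suc i < n" and bar: "hecke_bar n h = h"
  defines "g \<equiv> \<lambda>x. lmon (- 1) 1 * (T_simple_mult n i h x + h x)"
  shows "hecke_bar n g = g"
proof -
  have *: "lmon 1 1 * (v_pow (- 2) * a) = lmon (- 1) 1 * a" for a
    unfolding v_pow_def mult.assoc[symmetric] mult_single by simp
  have "lmon 1 1 * (T_inv n i h x + h x) = lmon (- 1) 1 * (T_simple_mult n i h x + h x)" for x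
    unfolding T_inv_def distrib_left * by (simp add: hecke_q_def v_pow_def algebra_simps mult_single mult.assoc[symmetric])
  then show ?thesis
    unfolding g_def hecke_bar_lmon hecke_bar_add hecke_bar_T_simple_mult[OF h i] bar by simp
qed

lemma degree_le_by_coeff:
  assumes "l < (L :: nat)" "\<And>k. L \<le> l + 2 * k \<Longrightarrow> coeff p k = 0"
  shows "2 * degree p + 1 \<le> L - l"
proof (cases "p = 0")
  case False
  then have "\<not> L \<le> l + 2 * degree p" using assms(2)[of "degree p"] leading_coeff_0_iff by blast
  then show ?thesis by simp
qed (use assms(1) in simp)

text \<open>Bar invariance and support pass through the product and the subtraction. The degree
  bound can fail only at exponent \<open>(l(w) - l(y)) / 2\<close> for \<open>s y < y\<close>, where
  \<open>q P_{y,u}\<close> contributes exactly \<open>mu(y,u)\<close>; the term \<open>z = y\<close>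
  of the sum removes it.\<close>

lemma is_kl_family_rec:
  assumes u: "u \<in> symgrp n" and i: "Suc i < n" and nd: "\<not> ldesc u i"
    and fam: "\<And>z. z \<in> symgrp n \<Longrightarrow> perm_length n z \<le> perm_length n u \<Longrightarrow> is_kl_family n z (\<lambda>x. kl_poly n x z)"
  shows "is_kl_family n (simple_refl i \<circ> u) (kl_rec n i u)"
proof -
  let ?s = "simple_refl i" and ?l = "perm_length n" and ?P = "kl_poly n"
  let ?w = "?s \<circ> u"
  have l: "?l ?w = Suc (?l u)" by (rule perm_length_left_up[OF u i nd])
  have w: "?w \<in> symgrp n" "ldesc ?w i" using u i nd by (auto simp: ldesc_left)
  have famu: "is_kl_family n u (\<lambda>x. ?P x u)" by (rule fam[OF u]) simp
  have famz: "is_kl_family n z (\<lambda>x. ?P x z)" if "z \<in> kl_corr n i u" for z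
    using that kl_corr_length[OF that] by (intro fam) (auto simp: kl_corr_def)
  have supp: "bruhat_le n x z" if "is_kl_family n z (\<lambda>x. ?P x z)" "?P x z \<noteq> 0" for x z
    using that by (auto simp: is_kl_family_def)
  have corr_le: "bruhat_le n z u" if "z \<in> kl_corr n i u" for z
  proof -
    have "?P z u \<noteq> 0" using that by (auto simp: kl_corr_def kl_mu_def split: if_splits)
    then show ?thesis by (rule supp[OF famu])
  qed
  have uw: "bruhat_le n u ?w" by (rule bruhat_le_simple_left[OF u i nd])
  have one: "kl_rec n i u ?w = 1"
  proof -
    have "?P ?w u = 0" using supp[OF famu, of ?w] bruhat_le_length[of n ?w u] l by fastforce
    moreover have "?P ?w z = 0" if "z \<in> kl_corr n i u" for z
      using supp[OF famz[OF that], of ?w] bruhat_le_length[of n ?w z] l kl_corr_length[OF that] by fastforce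
    moreover have "?P u u = 1" using famu by (simp add: is_kl_family_def)
    ultimately show ?thesis using w(2) unfolding kl_rec_def kl_step_def by simp
  qed
  have out: "kl_rec n i u y = 0" if y: "\<not> bruhat_le n y ?w" for y
  proof -
    have "?P (?s \<circ> y) u = 0"
    proof (rule ccontr)
      assume "?P (?s \<circ> y) u \<noteq> 0"
      then have "bruhat_le n (?s \<circ> (?s \<circ> y)) ?w" using supp[OF famu] bruhat_lift[OF _ i nd] by blast
      then show False using y unfolding simple_refl_comp_self by blast
    qed
    moreover have "?P y u = 0" using supp[OF famu] bruhat_lift[OF _ i nd] y by blast
    moreover have "?P y z = 0" if "z \<in> kl_corr n i u" for z
      using supp[OF famz[OF that]] corr_le[OF that] uw y bruhat_le_trans by metis
    ultimately show ?thesis unfolding kl_rec_def kl_step_def by simp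
  qed
  have coeff: "coeff (kl_rec n i u y) k = 0"
    if yw: "bruhat_le n y ?w" "y \<noteq> ?w" and k: "?l ?w \<le> ?l y + 2 * k" for y k
  proof -
    have ys: "y \<in> symgrp n" using yw bruhat_le_symgrp by blast
    have ly: "?l y < ?l ?w" using bruhat_le_length[OF yw(1)] yw(2) by blast
    have k1: "1 \<le> k" using k ly by linarith
    have cX: "coeff (monom 1 1 * q) k = coeff q (k - 1)" for q :: "int poly"
      using k1 by (simp add: coeff_monom_mult)
    \<comment> \<open>At these exponents the degree bound for \<open>P_{y,z}\<close> kills every
      correction term except \<open>z = y\<close>, and that one contributes only at the critical
      exponent.\<close>
    have sz: "coeff (monom (kl_mu n z u) ((Suc (?l u) - ?l z) div 2) * ?P y z) k =
        (if z = y \<and> Suc (?l u) = ?l y + 2 * k then kl_mu n y u else 0)" if z: "z \<in> kl_corr n i u" for z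
    proof -
      let ?e = "(Suc (?l u) - ?l z) div 2"
      note e = kl_corr_length[OF z]
      show ?thesis
      proof (cases "z = y")
        case True
        then have "?P y z = 1" using famz[OF z] by (simp add: is_kl_family_def)
        moreover have "k = ?e \<longleftrightarrow> Suc (?l u) = ?l y + 2 * k" using e unfolding True by presburger
        ultimately show ?thesis using True by (auto simp: coeff_monom_mult)
      next
        case False
        have "coeff (?P y z) (k - ?e) = 0" if "?e \<le> k"
          by (rule is_kl_family_coeff[OF famz[OF z]]) (use False e that k l in \<open>auto simp: algebra_simps\<close>)
        then show ?thesis using False by (auto simp: coeff_monom_mult)
      qed
    qed
    have sum: "(\<Sum>z\<in>kl_corr n i u. coeff (monom (kl_mu n z u) ((Suc (?l u) - ?l z) div 2) * ?P y z) k) =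
       (if ldesc y i \<and> Suc (?l u) = ?l y + 2 * k then kl_mu n y u else 0)"
    proof -
      have "(\<Sum>z\<in>kl_corr n i u. coeff (monom (kl_mu n z u) ((Suc (?l u) - ?l z) div 2) * ?P y z) k) =
         (\<Sum>z\<in>kl_corr n i u. if z = y then (if Suc (?l u) = ?l y + 2 * k then kl_mu n y u else 0) else 0)"
        by (rule sum.cong) (auto simp: sz)
      also have "\<dots> = (if y \<in> kl_corr n i u then (if Suc (?l u) = ?l y + 2 * k then kl_mu n y u else 0) else 0)"
        by (simp add: sum.delta')
      finally show ?thesis using ys by (auto simp: kl_corr_def)
    qed
    have rec: "coeff (kl_rec n i u y) k = coeff (kl_step i (\<lambda>x. ?P x u) y) k -
       (if ldesc y i \<and> Suc (?l u) = ?l y + 2 * k then kl_mu n y u else 0)"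
      unfolding kl_rec_def coeff_diff coeff_sum sum ..
    show ?thesis
    proof (cases "ldesc y i")
      case True
      have st: "coeff (kl_step i (\<lambda>x. ?P x u) y) k = coeff (?P (?s \<circ> y) u) k + coeff (?P y u) (k - 1)"
        using True by (simp only: kl_step_def if_True coeff_add cX)
      have "?s \<circ> y \<noteq> u" using yw(2) by (metis simple_refl_comp_self(1))
      then have "coeff (?P (?s \<circ> y) u) k = 0"
        using is_kl_family_coeff[OF famu, of "?s \<circ> y" k] perm_length_left_down[OF ys i True] k l by simp
      moreover have "coeff (?P y u) (k - 1) = (if Suc (?l u) = ?l y + 2 * k then kl_mu n y u else 0)"
      proof (cases "Suc (?l u) = ?l y + 2 * k")
        case eq: True
        then have "?l u - ?l y = 2 * (k - 1) + 1" "?l y < ?l u" using k1 by linarith+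
        then show ?thesis using eq by (simp add: kl_mu_def)
      next
        case False
        have "y \<noteq> u" using True nd by blast
        then have "coeff (?P y u) (k - 1) = 0"
          using False k l k1 by (intro is_kl_family_coeff[OF famu]) auto
        then show ?thesis using False by simp
      qed
      ultimately show ?thesis using True unfolding rec st by simp
    next
      case False
      have st: "coeff (kl_step i (\<lambda>x. ?P x u) y) k = coeff (?P (?s \<circ> y) u) (k - 1) + coeff (?P y u) k"
        using False by (simp only: kl_step_def if_False coeff_add cX)
      have "?s \<circ> y \<noteq> u" using False nd ldesc_left[OF ys, of i] by blast
      then have "coeff (?P (?s \<circ> y) u) (k - 1) = 0"
        using is_kl_family_coeff[OF famu, of "?s \<circ> y" "k - 1"] perm_length_left_up[OF ys i False] k l k1 by simp
      moreover have "coeff (?P y u) k = 0"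
      proof (cases "y = u")
        case True
        then have "?P y u = 1" using famu by (simp add: is_kl_family_def)
        then show ?thesis using k1 by simp
      next
        case False
        then show ?thesis using k l by (intro is_kl_family_coeff[OF famu]) auto
      qed
      ultimately show ?thesis using False unfolding rec st by simp
    qed
  qed
  have bar: "hecke_bar n (kl_element n ?w (kl_rec n i u)) = kl_element n ?w (kl_rec n i u)"
  proof -
    let ?A = "kl_element n ?w (kl_step i (\<lambda>x. ?P x u))"
    have A: "hecke_bar n ?A = ?A"
      unfolding kl_element_step[OF u i nd famu]
      by (rule bar_step[OF kl_element_car[OF famu] i]) (use famu in \<open>simp add: is_kl_family_def\<close>)
    have eq: "kl_element n ?w (kl_rec n i u) =
       (\<lambda>x. ?A x - (\<Sum>z\<in>kl_corr n i u. lmon 0 (kl_mu n z u) * kl_element n z (\<lambda>x. ?P x z) x))"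
    proof (rule ext)
      fix x
      have "v_pow (- int (?l ?w)) * laurent_of_poly (monom (kl_mu n z u) ((Suc (?l u) - ?l z) div 2) * ?P x z) =
          lmon 0 (kl_mu n z u) * kl_element n z (\<lambda>x. ?P x z) x" if "z \<in> kl_corr n i u" for z
      proof -
        have "int (2 * ((Suc (?l u) - ?l z) div 2)) = int (?l ?w) - int (?l z)"
          unfolding kl_corr_length(2)[OF that] l using kl_corr_length(1)[OF that] by simp
        then show ?thesis
          by (simp add: laurent_of_poly_monom_mult kl_element_def v_pow_def mult.assoc[symmetric] mult_single)
      qed
      then show "kl_element n ?w (kl_rec n i u) x =
         ?A x - (\<Sum>z\<in>kl_corr n i u. lmon 0 (kl_mu n z u) * kl_element n z (\<lambda>x. ?P x z) x)"
        by (simp add: kl_element_def[of n ?w] kl_rec_def laurent_of_poly_diff laurent_of_poly_sum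
            right_diff_distrib sum_distrib_left)
    qed
    have "hecke_bar n (kl_element n z (\<lambda>x. ?P x z)) = kl_element n z (\<lambda>x. ?P x z)"
      if "z \<in> kl_corr n i u" for z
      using famz[OF that] by (simp add: is_kl_family_def)
    then show ?thesis
      unfolding eq hecke_bar_diff A hecke_bar_sum[OF finite_kl_corr] hecke_bar_lmon by simp
  qed
  show ?thesis
    unfolding is_kl_family_def
    using one out bar coeff bruhat_le_length by (blast intro: degree_le_by_coeff)
qed

lemma is_kl_family_id: "is_kl_family n id (\<lambda>x. if x = id then 1 else 0)"
proof -
  have "bruhat_le n x id \<longleftrightarrow> x = id" for x
    using bruhat_le_length[of n x id] bruhat_le_refl[of id n] by auto
  moreover have "kl_element n id (\<lambda>x. if x = id then 1 else 0) = hecke_T id"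
    by (rule ext) (simp add: kl_element_def hecke_T_def)
  moreover have "hecke_bar n (hecke_T id) = hecke_T id"
  proof (rule ext)
    fix x
    have "hecke_bar n (hecke_T id) x = (\<Sum>w\<in>symgrp n. if w = id then T_bar n w x else 0)"
      unfolding hecke_bar_eq by (rule sum.cong) (auto simp: hecke_T_def)
    then show "hecke_bar n (hecke_T id) x = hecke_T id x" using T_bar_id by simp
  qed
  ultimately show ?thesis by (simp add: is_kl_family_def)
qed

text \<open>The recursion refers to \<open>kl_poly\<close> at shorter elements, where the induction
  hypothesis already makes the description meaningful.\<close>

theorem is_kl_family_kl_poly: "w \<in> symgrp n \<Longrightarrow> is_kl_family n w (\<lambda>x. kl_poly n x w)"
proof (induction "perm_length n w" arbitrary: w rule: less_induct)
  case less
  show ?case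
  proof (cases "w = id")
    case True
    show ?thesis unfolding True by (rule kl_poly_eqI(2)[OF is_kl_family_id symgrp_id])
  next
    case False
    then obtain i where i: "Suc i < n" "ldesc w i" using exists_ldesc less.prems by blast
    let ?u = "simple_refl i \<circ> w"
    have u: "?u \<in> symgrp n" "\<not> ldesc ?u i" using i less.prems by (auto simp: ldesc_left)
    have "perm_length n ?u < perm_length n w" using i less.prems by (simp add: length_left_less_iff)
    then have "is_kl_family n (simple_refl i \<circ> ?u) (kl_rec n i ?u)"
      using less.hyps by (intro is_kl_family_rec[OF u(1) i(1) u(2)]) auto
    then show ?thesis unfolding simple_refl_comp_self using kl_poly_eqI(2) less.prems by blast
  qed
qed

theorem kl_poly_rec:
  assumes "u \<in> symgrp n" "Suc i < n" "\<not> ldesc u i"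
  shows "kl_poly n y (simple_refl i \<circ> u) = kl_rec n i u y"
  by (rule kl_poly_eqI(1)[OF is_kl_family_rec[OF assms is_kl_family_kl_poly]])
    (use assms in simp_all)

lemma kl_poly_self: "w \<in> symgrp n \<Longrightarrow> kl_poly n w w = 1"
  using is_kl_family_kl_poly by (auto simp: is_kl_family_def)

lemma kl_poly_support: "w \<in> symgrp n \<Longrightarrow> kl_poly n x w \<noteq> 0 \<Longrightarrow> bruhat_le n x w"
  using is_kl_family_kl_poly by (auto simp: is_kl_family_def)

lemma kl_poly_coeff_eq_0:
  "w \<in> symgrp n \<Longrightarrow> y \<noteq> w \<Longrightarrow> perm_length n w \<le> perm_length n y + 2 * k \<Longrightarrow> coeff (kl_poly n y w) k = 0"
  by (rule is_kl_family_coeff[OF is_kl_family_kl_poly])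

text \<open>The recursive expression is symmetric in \<open>y\<close> and \<open>s y\<close>:
  \<open>kl_step\<close> is, and every correction term belongs to a shorter \<open>z\<close> that
  also has the descent \<open>s\<close>.\<close>

lemma kl_poly_left_desc:
  assumes "w \<in> symgrp n" "y \<in> symgrp n" "Suc i < n" "ldesc w i"
  shows "kl_poly n (simple_refl i \<circ> y) w = kl_poly n y w"
  using assms(1,4)
proof (induction "perm_length n w" arbitrary: w rule: less_induct)
  case less
  let ?s = "simple_refl i"
  let ?u = "?s \<circ> w"
  have u: "?u \<in> symgrp n" "\<not> ldesc ?u i" using less.prems assms by (auto simp: ldesc_left)
  have l: "perm_length n ?u < perm_length n w" using less.prems assms by (simp add: length_left_less_iff)
  have z: "kl_poly n (?s \<circ> y) z = kl_poly n y z" if "z \<in> kl_corr n i ?u" for z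
    using that kl_corr_length[OF that] l by (intro less.hyps) (auto simp: kl_corr_def)
  have "kl_step i p (?s \<circ> y) = kl_step i p y" for p
    using ldesc_left[OF assms(2), of i] unfolding kl_step_def simple_refl_comp_self by auto
  then have "kl_rec n i ?u (?s \<circ> y) = kl_rec n i ?u y"
    using z unfolding kl_rec_def by simp
  then show ?case
    using kl_poly_rec[OF u(1) assms(3) u(2)] unfolding simple_refl_comp_self by simp
qed

section \<open>Inversion symmetry\<close>

text \<open>The anti-automorphism that sends the basis element of \<open>w\<close> to that of
  \<open>w^(-1)\<close>; it exchanges left and right.\<close>

definition h_inv :: "nat \<Rightarrow> hecke \<Rightarrow> hecke" where
  "h_inv n h = (\<lambda>x. if x \<in> symgrp n then h (pinv x) else 0)"

lemma h_inv_car [simp]: "h_inv n h \<in> hcar n"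
  by (simp add: hcar_def h_inv_def)

lemma h_inv_T: "w \<in> symgrp n \<Longrightarrow> h_inv n (hecke_T w) = hecke_T (pinv w)"
proof (rule hcar_eqI[of _ n])
  fix x assume "w \<in> symgrp n" "x \<in> symgrp n"
  then have "pinv x = w \<longleftrightarrow> x = pinv w" by (metis symgrp_inv_inv)
  then show "h_inv n (hecke_T w) x = hecke_T (pinv w) x"
    using \<open>x \<in> symgrp n\<close> by (simp add: h_inv_def hecke_T_def)
qed (auto intro: hcar_T symgrp_inv)

lemma hlin_h_inv: "hlin n (h_inv n)"
  by (auto simp: hlin_def h_inv_def)

lemma h_inv_T_simple_mult:
  assumes h: "h \<in> hcar n" and i: "Suc i < n"
  shows "h_inv n (T_simple_mult n i h) = T_right n i (h_inv n h)"
proof (rule hcar_eqI[of _ n])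
  fix x assume x: "x \<in> symgrp n"
  have xi: "pinv x \<in> symgrp n" by (rule symgrp_inv[OF x])
  have "ldesc (pinv x) i \<longleftrightarrow> x (Suc i) < x i" by (simp add: ldesc_def symgrp_inv_inv[OF x])
  moreover have "pinv (x \<circ> simple_refl i) = simple_refl i \<circ> pinv x" by (rule inv_simple_right[OF x])
  ultimately show "h_inv n (T_simple_mult n i h) x = T_right n i (h_inv n h) x"
    using x i by (simp add: h_inv_def T_right_def T_simple_mult_apply[OF xi i])
qed (use i in simp_all)

text \<open>Building \<open>g\<close> up from the left, each generator moves out of the product, and
  inversion turns \<open>T_simple_mult\<close> into \<open>T_right\<close>, which moves out on the
  other side.\<close>

lemma h_inv_hmult:
  assumes g: "g \<in> hcar n" and h: "h \<in> hcar n"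
  shows "h_inv n (hmult n g h) = hmult n (h_inv n h) (h_inv n g)"
proof -
  have T: "h_inv n (hmult n (hecke_T w) h) = hmult n (h_inv n h) (h_inv n (hecke_T w))"
    if "w \<in> symgrp n" for w
    using that
  proof (induction rule: symgrp_left_induct)
    case id
    have "h_inv n (hecke_T id) = hecke_T id" using h_inv_T[OF symgrp_id, of n] by (simp only: inv_id)
    then show ?case using hmult_one_left[OF h] hmult_one_right[OF h_inv_car, of n h] by metis
  next
    case (step i w)
    have T: "hecke_T (simple_refl i \<circ> w) = T_simple_mult n i (hecke_T w)"
      by (rule T_simple_mult_T [symmetric]) (rule step)+
    have Tw: "hecke_T w \<in> hcar n" by (rule hcar_T) (rule step)
    show ?case
      unfolding T h_inv_T_simple_mult[OF Tw step(2)] hmult_T_left[OF Tw h step(2)]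
        h_inv_T_simple_mult[OF hmult_car[OF h] step(2)] step(4)
      by (rule hmult_T_right[OF h_inv_car step(2), symmetric])
  qed
  show ?thesis
    by (rule hlin_eq[OF hlin_comp[OF hlin_h_inv hlin_hmult_left] hlin_comp[OF hlin_hmult_right hlin_h_inv] g])
       (use T in auto)
qed

lemma T_bar_inv:
  assumes w: "w \<in> symgrp n" shows "T_bar n (pinv w) = h_inv n (T_bar n w)"
proof -
  have D: "hmult n (hecke_T (pinv w)) (T_bar n w) = hecke_T id" "hmult n (T_bar n w) (hecke_T (pinv w)) = hecke_T id"
    using T_bar_aux[OF w] by auto
  have Tid: "h_inv n (hecke_T id) = hecke_T id" using h_inv_T[OF symgrp_id, of n] by (simp only: inv_id)
  have Tw: "h_inv n (hecke_T (pinv w)) = hecke_T w"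
    using h_inv_T[OF symgrp_inv[OF w]] by (simp only: symgrp_inv_inv[OF w])
  have car: "T_bar n w \<in> hcar n" "hecke_T (pinv w) \<in> hcar n" using w by (auto intro: hcar_T symgrp_inv)
  show ?thesis
  proof (rule T_bar_eqI[OF h_inv_car symgrp_inv[OF w]])
    show "hmult n (hecke_T (pinv (pinv w))) (h_inv n (T_bar n w)) = hecke_T id"
      using h_inv_hmult[OF car] D Tid Tw symgrp_inv_inv[OF w] by metis
    show "hmult n (h_inv n (T_bar n w)) (hecke_T (pinv (pinv w))) = hecke_T id"
      using h_inv_hmult[OF car(2,1)] D Tid Tw symgrp_inv_inv[OF w] by metis
  qed
qed

lemma hecke_bar_h_inv: "hecke_bar n (h_inv n h) = h_inv n (hecke_bar n h)"
proof (rule ext)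
  fix x
  have "hecke_bar n (h_inv n h) x = (\<Sum>w\<in>symgrp n. laurent_bar (h w) * T_bar n (pinv w) x)"
    unfolding hecke_bar_eq
    by (rule sum.reindex_bij_witness[where i = pinv and j = pinv])
      (auto simp: h_inv_def symgrp_inv symgrp_inv_inv)
  also have "\<dots> = (\<Sum>w\<in>symgrp n. laurent_bar (h w) * h_inv n (T_bar n w) x)"
    by (simp add: T_bar_inv cong: sum.cong)
  also have "\<dots> = h_inv n (hecke_bar n h) x"
    unfolding hecke_bar_eq hlinD[OF hlin_h_inv] ..
  finally show "hecke_bar n (h_inv n h) x = h_inv n (hecke_bar n h) x" .
qed

text \<open>Lengths, Bruhat order and bar map are all compatible with inversion, so the polynomials
  of \<open>w\<close>, reindexed by inverses, form a family for the inverse of \<open>w\<close>;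
  uniqueness does the rest.\<close>

lemma kl_poly_inv:
  assumes w: "w \<in> symgrp n" and y: "y \<in> symgrp n"
  shows "kl_poly n (pinv y) (pinv w) = kl_poly n y w"
proof -
  define p where "p x = (if x \<in> symgrp n then kl_poly n (pinv x) w else 0)" for x
  have fam: "is_kl_family n w (\<lambda>x. kl_poly n x w)" by (rule is_kl_family_kl_poly[OF w])
  have le: "bruhat_le n x (pinv w) \<longleftrightarrow> bruhat_le n (pinv x) w" if "x \<in> symgrp n" for x
    using bruhat_le_inv that w symgrp_inv_inv by metis
  have el: "kl_element n (pinv w) p = h_inv n (kl_element n w (\<lambda>x. kl_poly n x w))"
    by (rule ext) (simp add: kl_element_def h_inv_def p_def perm_length_inv[OF w])
  have "is_kl_family n (pinv w) p"
    unfolding is_kl_family_def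
  proof (intro conjI allI impI)
    show "p (pinv w) = 1" using symgrp_inv[OF w] symgrp_inv_inv[OF w] kl_poly_self[OF w] by (simp add: p_def)
    show "p x = 0" if "\<not> bruhat_le n x (pinv w)" for x
      using that le kl_poly_support[OF w] by (auto simp: p_def)
    show "2 * degree (p x) + 1 \<le> perm_length n (pinv w) - perm_length n x"
      if "bruhat_le n x (pinv w) \<and> x \<noteq> pinv w" for x
    proof -
      have x: "x \<in> symgrp n" using that bruhat_le_symgrp by blast
      have "bruhat_le n (pinv x) w" "pinv x \<noteq> w" using that le[OF x] symgrp_inv_inv[OF x] by auto
      then have "2 * degree (kl_poly n (pinv x) w) + 1 \<le> perm_length n w - perm_length n (pinv x)"
        using fam unfolding is_kl_family_def by blast
      then show ?thesis using x by (simp only: p_def perm_length_inv if_True w)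
    qed
    show "hecke_bar n (kl_element n (pinv w) p) = kl_element n (pinv w) p"
      unfolding el hecke_bar_h_inv using fam by (simp add: is_kl_family_def)
  qed
  then have "kl_poly n (pinv y) (pinv w) = p (pinv y)"
    by (rule kl_poly_eqI(1)) (rule symgrp_inv[OF w])
  then show ?thesis using y symgrp_inv[OF y] symgrp_inv_inv[OF y] by (simp add: p_def)
qed

section \<open>Normalised coefficients\<close>

text \<open>The existential excludes wrong parity and negative exponents, which subtraction and
  division of natural numbers would hide.\<close>

definition kl_coeff :: "nat \<Rightarrow> perm \<Rightarrow> perm \<Rightarrow> nat \<Rightarrow> int" where
  "kl_coeff n y w m = (if \<exists>k. perm_length n w = perm_length n y + m + 2 * k
     then coeff (kl_poly n y w) ((perm_length n w - perm_length n y - m) div 2) else 0)"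

lemma kl_mu_eq_kl_coeff: "kl_mu n x w = kl_coeff n x w 1"
proof -
  have "a < b \<and> odd (b - a) \<longleftrightarrow> (\<exists>k. b = a + 1 + 2 * k)" for a b :: nat
    by presburger
  then show ?thesis by (simp only: kl_mu_def kl_coeff_def)
qed

lemma kl_coeff_even:
  assumes "perm_length n w = perm_length n y + m + 2 * k"
  shows "kl_coeff n y w m = coeff (kl_poly n y w) k"
  using assms by (simp add: kl_coeff_def)

lemma kl_coeff_cases [case_names even zero]:
  obtains k where "perm_length n w = perm_length n y + m + 2 * k" "kl_coeff n y w m = coeff (kl_poly n y w) k"
  | "\<nexists>k. perm_length n w = perm_length n y + m + 2 * k" "kl_coeff n y w m = 0"
proof (cases "\<exists>k. perm_length n w = perm_length n y + m + 2 * k")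
  case True
  then show ?thesis using that(1) kl_coeff_even by blast
next
  case False
  then show ?thesis using that(2) by (auto simp: kl_coeff_def)
qed

text \<open>Exponent \<open>(l(w) - l(y)) / 2\<close> lies just beyond the degree bound, so only
  \<open>y = w\<close> survives.\<close>

lemma kl_coeff_zero_index:
  assumes "w \<in> symgrp n" shows "kl_coeff n y w 0 = (if y = w then 1 else 0)"
proof (cases "y = w")
  case True
  then show ?thesis using kl_coeff_even[of n w w 0 0] kl_poly_self[OF assms] by simp
next
  case False
  show ?thesis
    by (cases rule: kl_coeff_cases[of n w y 0]) (use False kl_poly_coeff_eq_0[OF assms] in auto)
qed

lemma kl_coeff_support:
  assumes "w \<in> symgrp n" "kl_coeff n y w m \<noteq> 0" shows "bruhat_le n y w"
proof -
  have "kl_poly n y w \<noteq> 0" using assms(2) by (auto simp: kl_coeff_def split: if_splits)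
  then show ?thesis by (rule kl_poly_support[OF assms(1)])
qed

lemma kl_coeff_raise:
  assumes w: "w \<in> symgrp n" and y: "y \<in> symgrp n" and i: "Suc i < n" and d: "ldesc w i" "\<not> ldesc y i"
  shows "kl_coeff n y w (Suc m) = kl_coeff n (simple_refl i \<circ> y) w m"
  using perm_length_left_up[OF y i d(2)] kl_poly_left_desc[OF w y i d(1)]
  by (simp add: kl_coeff_def)

lemma kl_coeff_inv:
  "w \<in> symgrp n \<Longrightarrow> y \<in> symgrp n \<Longrightarrow> kl_coeff n (pinv y) (pinv w) m = kl_coeff n y w m"
  by (simp add: kl_coeff_def kl_poly_inv perm_length_inv)

text \<open>Multiplication by \<open>q^e\<close> makes up for the length difference
  \<open>2 e\<close>, so a correction term is read at the same index \<open>m\<close>. For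
  \<open>k < e\<close> the guard in \<open>kl_coeff\<close> returns 0, in accordance with the
  shifted polynomial.\<close>

lemma kl_coeff_monom:
  assumes z: "perm_length n z = perm_length n w + 2 * e" and k: "perm_length n z = perm_length n y + m + 2 * k"
  shows "kl_coeff n y w m = coeff (monom 1 e * kl_poly n y w) k"
proof (cases "e \<le> k")
  case True
  then have "kl_coeff n y w m = coeff (kl_poly n y w) (k - e)"
    using assms by (intro kl_coeff_even) auto
  then show ?thesis using True by (simp add: coeff_monom_mult)
next
  case False
  then have "kl_coeff n y w m = 0" using assms by (auto simp: kl_coeff_def)
  then show ?thesis using False by (simp add: coeff_monom_mult)
qed

text \<open>The second term has index \<open>Suc m\<close> because its factor \<open>q\<close>
  accounts for two units of length, while \<open>l(u)\<close> is one less than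
  \<open>l(w)\<close>.\<close>

theorem kl_coeff_rec:
  assumes w: "w \<in> symgrp n" and y: "y \<in> symgrp n" and i: "Suc i < n" and d: "ldesc w i" "ldesc y i"
  defines "u \<equiv> simple_refl i \<circ> w"
  shows "kl_coeff n y w m = kl_coeff n (simple_refl i \<circ> y) u m + kl_coeff n y u (Suc m) -
     (\<Sum>z\<in>kl_corr n i u. kl_coeff n z u 1 * kl_coeff n y z m)"
proof -
  let ?l = "perm_length n"
  have u: "u \<in> symgrp n" "\<not> ldesc u i" using w i d by (auto simp: u_def ldesc_left)
  have lw: "?l w = Suc (?l u)" using perm_length_left_down[OF w i d(1)] by (simp add: u_def)
  have ly: "?l y = Suc (?l (simple_refl i \<circ> y))" using perm_length_left_down[OF y i d(2)] by simp
  have rec: "kl_poly n y w = kl_rec n i u y"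
    using kl_poly_rec[OF u(1) i u(2), of y] unfolding u_def simple_refl_comp_self .
  have lz: "?l w = ?l z + 2 * ((Suc (?l u) - ?l z) div 2)" if "z \<in> kl_corr n i u" for z
    using kl_corr_length[OF that] lw by linarith
  show ?thesis
  proof (cases rule: kl_coeff_cases[of n w y m])
    case (even k)
    have 1: "kl_coeff n (simple_refl i \<circ> y) u m = coeff (kl_poly n (simple_refl i \<circ> y) u) k"
      using even lw ly by (intro kl_coeff_even) linarith
    have 2: "kl_coeff n y u (Suc m) = coeff (monom 1 1 * kl_poly n y u) k"
    proof (cases k)
      case 0
      then show ?thesis using even lw by (simp add: kl_coeff_def coeff_monom_mult)
    next
      case (Suc j)
      then have "kl_coeff n y u (Suc m) = coeff (kl_poly n y u) j"
        using even lw by (intro kl_coeff_even) linarith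
      then show ?thesis using Suc by (simp add: coeff_monom_mult)
    qed
    have 3: "coeff (monom (kl_mu n z u) ((Suc (?l u) - ?l z) div 2) * kl_poly n y z) k =
        kl_coeff n z u 1 * kl_coeff n y z m" if "z \<in> kl_corr n i u" for z
      using kl_coeff_monom[OF lz[OF that] even(1)] by (simp add: kl_mu_eq_kl_coeff coeff_monom_mult)
    have 4: "kl_step i (\<lambda>x. kl_poly n x u) y = kl_poly n (simple_refl i \<circ> y) u + monom 1 1 * kl_poly n y u"
      using d(2) by (simp only: kl_step_def if_True)
    show ?thesis
      unfolding even(2) rec kl_rec_def 4 coeff_diff coeff_add coeff_sum 1 2
      using 3 by simp
  next
    \<comment> \<open>If parity or sign is wrong for the pair \<open>y\<close>, \<open>w\<close>, it
      is wrong for every pair on the right as well.\<close>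
    case zero
    have "kl_coeff n (simple_refl i \<circ> y) u m = 0"
      by (cases rule: kl_coeff_cases[of n u "simple_refl i \<circ> y" m]) (use zero lw ly in auto)
    moreover have "kl_coeff n y u (Suc m) = 0"
    proof (cases rule: kl_coeff_cases[of n u y "Suc m"])
      case (even k)
      then have "?l w = ?l y + m + 2 * Suc k" using lw by simp
      then show ?thesis using zero by blast
    qed
    moreover have "kl_coeff n y z m = 0" if "z \<in> kl_corr n i u" for z
    proof (cases rule: kl_coeff_cases[of n z y m])
      case (even k)
      have "\<exists>e. ?l w = ?l z + 2 * e" using lz[OF that] by blast
      then obtain e where "?l w = ?l z + 2 * e" ..
      then have "?l w = ?l y + m + 2 * (k + e)" using even by simp
      then show ?thesis using zero by blast
    qed
    ultimately show ?thesis using zero by simp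
  qed
qed

section \<open>Rank conditions\<close>

text \<open>The rank matrix of the combinatorial criterion for the Bruhat order. Its necessity,
  \<open>rank_mono\<close>, is what a refutation and an exhaustive search require.\<close>

definition rank :: "nat \<Rightarrow> nat \<Rightarrow> perm \<Rightarrow> nat" where
  "rank r p w = card {j. j < p \<and> r \<le> w j}"

lemma rank_0 [simp]: "rank r 0 w = 0"
  by (simp add: rank_def)

lemma rank_Suc: "rank r (Suc p) w = rank r p w + of_bool (r \<le> w p)"
proof -
  have "{j. j < Suc p \<and> r \<le> w j} = (if r \<le> w p then insert p {j. j < p \<and> r \<le> w j} else {j. j < p \<and> r \<le> w j})"
    by (auto simp: less_Suc_eq)
  then show ?thesis by (simp add: rank_def)
qed

text \<open>If \<open>b < p\<close>, the transposition permutes the positions below \<open>p\<close>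
  and matches the counted ones; otherwise at most position \<open>a\<close> changes, to a larger
  value, and the identity is an injection.\<close>

lemma rank_transpose_mono:
  assumes "a < b" "u a < u b"
  shows "rank r p u \<le> rank r p (u \<circ> transpose a b)"
  unfolding rank_def
proof (rule card_inj_on_le)
  let ?f = "if b < p then transpose a b else id"
  show "inj_on ?f {j. j < p \<and> r \<le> u j}" by (auto intro!: inj_onI split: if_splits)
  show "?f ` {j. j < p \<and> r \<le> u j} \<subseteq> {j. j < p \<and> r \<le> (u \<circ> transpose a b) j}"
    using assms by (auto simp: transpose_def split: if_splits)
qed simp

lemma rank_mono: "bruhat_le n x w \<Longrightarrow> rank r p x \<le> rank r p w"
  unfolding bruhat_le_eq
proof (elim conjE)
  assume x: "x \<in> symgrp n" and "(bruhat_step n)\<^sup>*\<^sup>* x w"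
  from this(2) have "w \<in> symgrp n \<and> rank r p x \<le> rank r p w"
  proof (induction rule: rtranclp_induct)
    case (step u w)
    then obtain a b where ab: "a < b" "b < n" "w = u \<circ> transpose a b" "perm_length n u < perm_length n w"
      by (auto simp: bruhat_step_def)
    have u: "u \<in> symgrp n" using step by blast
    have "w \<in> symgrp n" unfolding ab(3) using ab u by (intro symgrp_transpose) auto
    moreover have "u a < u b" using ab length_transpose_less_iff[OF u ab(1,2)] by metis
    then have "rank r p u \<le> rank r p w" unfolding ab(3) by (rule rank_transpose_mono[OF ab(1)])
    ultimately show ?case using step by linarith
  qed (use x in simp)
  then show ?thesis ..
qed

lemma kl_coeff_rank:
  "w \<in> symgrp n \<Longrightarrow> kl_coeff n y w m \<noteq> 0 \<Longrightarrow> rank r p y \<le> rank r p w"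
  using kl_coeff_support rank_mono by blast

section \<open>Permutations as lists\<close>

text \<open>Keeping the inverse alongside makes left and right descents comparisons of neighbouring
  list entries. The length is an integer so that it can be lowered without truncation.\<close>

definition perm_rep :: "nat \<Rightarrow> nat list \<Rightarrow> nat list \<Rightarrow> int \<Rightarrow> perm \<Rightarrow> bool" where
  "perm_rep n xs xi l w \<longleftrightarrow> w \<in> symgrp n \<and> xs = map w [0..<n] \<and> xi = map (pinv w) [0..<n]
     \<and> l = int (perm_length n w)"

lemma perm_rep_inv: "perm_rep n xs xi l w \<Longrightarrow> perm_rep n xi xs l (pinv w)"
  by (auto simp: perm_rep_def symgrp_inv symgrp_inv_inv perm_length_inv)

lemma perm_rep_symgrp: "perm_rep n xs xi l w \<Longrightarrow> w \<in> symgrp n"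
  by (simp add: perm_rep_def)

lemma perm_rep_nth:
  "perm_rep n xs xi l w \<Longrightarrow> i < n \<Longrightarrow> xs ! i = w i \<and> xi ! i = pinv w i"
  by (simp add: perm_rep_def)

lemma perm_rep_length: "perm_rep n xs xi l w \<Longrightarrow> length xs = n \<and> length xi = n"
  by (simp add: perm_rep_def)

lemma perm_rep_eq_iff:
  assumes "perm_rep n xs xi l w" "perm_rep n ys yi l' y"
  shows "xs = ys \<longleftrightarrow> w = y"
proof
  assume "xs = ys"
  then have "\<forall>i<n. w i = y i" using assms by (auto simp: perm_rep_def)
  moreover have "\<forall>i\<ge>n. w i = y i" using assms symgrp_fix[of w n] symgrp_fix[of y n] by (auto simp: perm_rep_def)
  ultimately show "w = y" by (metis ext not_le)
qed (use assms in \<open>auto simp: perm_rep_def\<close>)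

fun swap_vals :: "nat \<Rightarrow> nat \<Rightarrow> nat list \<Rightarrow> nat list" where
  "swap_vals i j [] = []"
| "swap_vals i j (x # xs) = (if x = i then j else if x = j then i else x) # swap_vals i j xs"

lemma swap_vals_eq: "swap_vals i j xs = map (transpose i j) xs"
  by (induction xs) (auto simp: transpose_def)

text \<open>Exchanging two positions of a list without repetitions is the same as exchanging the two
  values found there, so \<open>swap_vals\<close> serves both the one-line notation and its
  inverse.\<close>

lemma pinv_simple_left:
  assumes "w \<in> symgrp n"
  shows "pinv (simple_refl i \<circ> w) x = transpose (pinv w i) (pinv w (Suc i)) (pinv w x)"
proof -
  have "pinv w x = pinv w i \<longleftrightarrow> x = i" "pinv w x = pinv w (Suc i) \<longleftrightarrow> x = Suc i"
    using symgrp_inj[OF symgrp_inv[OF assms]] by auto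
  then show ?thesis unfolding inv_simple_left[OF assms]
    by (auto simp: transpose_def simple_refl_apply)
qed

lemma perm_rep_left:
  assumes "perm_rep n xs xi l w" "Suc i < n"
  shows "perm_rep n (swap_vals i (i + 1) xs) (swap_vals (xi ! i) (xi ! Suc i) xi)
     (if ldesc w i then l - 1 else l + 1) (simple_refl i \<circ> w)"
proof -
  have w: "w \<in> symgrp n" using assms by (simp add: perm_rep_def)
  have "int (perm_length n (simple_refl i \<circ> w)) = (if ldesc w i then l - 1 else l + 1)"
    using perm_length_left_up[OF w assms(2)] perm_length_left_down[OF w assms(2)] assms(1)
    by (auto simp: perm_rep_def)
  moreover have "map (pinv (simple_refl i \<circ> w)) [0..<n] = swap_vals (xi ! i) (xi ! Suc i) xi"
    using assms by (simp add: swap_vals_eq perm_rep_def pinv_simple_left[OF w])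
  moreover have "map (simple_refl i \<circ> w) [0..<n] = swap_vals i (i + 1) xs"
    using assms by (simp add: swap_vals_eq perm_rep_def simple_refl_def)
  moreover have "simple_refl i \<circ> w \<in> symgrp n" using w assms by simp
  ultimately show ?thesis unfolding perm_rep_def by metis
qed

lemma ldesc_inv: "w \<in> symgrp n \<Longrightarrow> ldesc (pinv w) i \<longleftrightarrow> w (Suc i) < w i"
  by (simp add: ldesc_def symgrp_inv_inv)

lemma perm_rep_right:
  assumes "perm_rep n xs xi l w" "Suc i < n"
  shows "perm_rep n (swap_vals (xs ! i) (xs ! Suc i) xs) (swap_vals i (i + 1) xi)
     (if w (Suc i) < w i then l - 1 else l + 1) (w \<circ> simple_refl i)"
proof -
  have w: "w \<in> symgrp n" using assms by (simp add: perm_rep_def)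
  have "pinv (simple_refl i \<circ> pinv w) = w \<circ> simple_refl i"
    using inv_simple_left[OF symgrp_inv[OF w]] symgrp_inv_inv[OF w] by metis
  then show ?thesis
    using perm_rep_inv[OF perm_rep_left[OF perm_rep_inv[OF assms(1)] assms(2)]] ldesc_inv[OF w] by metis
qed

section \<open>Descent flags and raising\<close>

fun descents :: "nat list \<Rightarrow> bool list" where
  "descents [] = []"
| "descents [a] = []"
| "descents (a # b # xs) = (b < a) # descents (b # xs)"

lemma length_descents [simp]: "length (descents xs) = length xs - 1"
  by (induction xs rule: descents.induct) auto

lemma nth_descents: "Suc i < length xs \<Longrightarrow> descents xs ! i \<longleftrightarrow> xs ! Suc i < xs ! i"
proof (induction xs arbitrary: i rule: descents.induct)
  case (3 a b xs)
  then show ?case by (cases i) auto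
qed auto

text \<open>Containment instead of equality, so that one pair of flag lists describes all unknown
  candidates \<open>z\<close> at once.\<close>

definition has_descents :: "nat \<Rightarrow> bool list \<Rightarrow> bool list \<Rightarrow> perm \<Rightarrow> bool" where
  "has_descents n A B w \<longleftrightarrow> w \<in> symgrp n \<and>
     (\<forall>i. Suc i < n \<longrightarrow> i < length A \<longrightarrow> A ! i \<longrightarrow> ldesc w i) \<and>
     (\<forall>i. Suc i < n \<longrightarrow> i < length B \<longrightarrow> B ! i \<longrightarrow> w (Suc i) < w i)"

lemma has_descents_self:
  "perm_rep n xs xi l w \<Longrightarrow> has_descents n (descents xi) (descents xs) w"
  by (auto simp: has_descents_def perm_rep_def nth_descents ldesc_def)

text \<open>The entries at the ascent are returned with its index, because they are the values that
  \<open>swap_vals\<close> has to exchange in the tested list.\<close>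

fun find_ascent :: "bool list \<Rightarrow> nat list \<Rightarrow> nat \<Rightarrow> (nat \<times> nat \<times> nat) option" where
  "find_ascent (True # ds) (a # b # xs) i = (if a < b then Some (i, a, b) else find_ascent ds (b # xs) (i + 1))"
| "find_ascent (False # ds) (a # xs) i = find_ascent ds xs (i + 1)"
| "find_ascent ds xs i = None"

lemma find_ascent_Some:
  "find_ascent ds xs k = Some (i, a, b) \<Longrightarrow>
    \<exists>j. i = k + j \<and> j < length ds \<and> ds ! j \<and> Suc j < length xs \<and> a = xs ! j \<and> b = xs ! Suc j \<and> a < b"
proof (induction ds xs k rule: find_ascent.induct)
  case (1 ds a' b' xs k)
  show ?case
  proof (cases "a' < b'")
    case True
    then show ?thesis using 1 by (intro exI[of _ 0]) auto
  next
    case False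
    then obtain j where "i = k + 1 + j" "j < length ds" "ds ! j" "Suc j < length (b' # xs)"
      "a = (b' # xs) ! j" "b = (b' # xs) ! Suc j" "a < b"
      using 1 by auto
    then show ?thesis by (intro exI[of _ "Suc j"]) auto
  qed
next
  case (2 ds a' xs k)
  then obtain j where "i = k + 1 + j" "j < length ds" "ds ! j" "Suc j < length xs"
      "a = xs ! j" "b = xs ! Suc j" "a < b"
    by auto
  then show ?case by (intro exI[of _ "Suc j"]) auto
qed auto

lemma find_ascent_None:
  "find_ascent ds xs k = None \<Longrightarrow> j < length ds \<Longrightarrow> ds ! j \<Longrightarrow> Suc j < length xs \<Longrightarrow> \<not> xs ! j < xs ! Suc j"
proof (induction ds xs k arbitrary: j rule: find_ascent.induct)
  case (1 ds a b xs i)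
  then show ?case by (cases j) (auto split: if_splits)
next
  case (2 ds a xs i)
  then show ?case by (cases j) auto
qed auto

lemma kl_coeff_raise_right:
  assumes w: "w \<in> symgrp n" and y: "y \<in> symgrp n" and i: "Suc i < n" and d: "w (Suc i) < w i" "\<not> y (Suc i) < y i"
  shows "kl_coeff n y w (Suc m) = kl_coeff n (y \<circ> simple_refl i) w m"
proof -
  have "kl_coeff n y w (Suc m) = kl_coeff n (pinv y) (pinv w) (Suc m)"
    using w y by (simp add: kl_coeff_inv)
  also have "\<dots> = kl_coeff n (simple_refl i \<circ> pinv y) (pinv w) m"
    using w y i d by (intro kl_coeff_raise) (auto simp: symgrp_inv ldesc_inv)
  also have "simple_refl i \<circ> pinv y = pinv (y \<circ> simple_refl i)" using inv_simple_right[OF y] by simp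
  also have "kl_coeff n (pinv (y \<circ> simple_refl i)) (pinv w) m = kl_coeff n (y \<circ> simple_refl i) w m"
    using w y i by (intro kl_coeff_inv) auto
  finally show ?thesis .
qed

text \<open>Replace \<open>y\<close> by larger elements as long as it lacks one of the prescribed left descents \<open>A\<close>
  or right descents \<open>B\<close>; every step uses up one unit of the index \<open>m\<close>.\<close>

fun raise :: "bool list \<Rightarrow> bool list \<Rightarrow> nat \<Rightarrow> nat list \<Rightarrow> nat list \<Rightarrow> int \<Rightarrow> nat list \<times> nat list \<times> int \<times> nat" where
  "raise A B 0 ys yi l = (ys, yi, l, 0)"
| "raise A B (Suc m) ys yi l = (case find_ascent A yi 0 of
       Some (i, a, b) \<Rightarrow> raise A B m (swap_vals i (i + 1) ys) (swap_vals a b yi) (l + 1)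
     | None \<Rightarrow> (case find_ascent B ys 0 of
         Some (i, a, b) \<Rightarrow> raise A B m (swap_vals a b ys) (swap_vals i (i + 1) yi) (l + 1)
       | None \<Rightarrow> (ys, yi, l, Suc m)))"

text \<open>The raised \<open>y'\<close> depends on the flags but not on \<open>w\<close>, so it can
  be computed once for all elements with the prescribed descents, before these are known. A positive
  final index records that raising stopped because \<open>y'\<close> has all of them.\<close>

lemma raise_sound:
  assumes "perm_rep n ys yi l y" "raise A B m ys yi l = (ys', yi', l', m')"
    "length A = n - 1" "length B = n - 1"
  shows "\<exists>y'. perm_rep n ys' yi' l' y' \<and>
    (\<forall>w. has_descents n A B w \<longrightarrow> kl_coeff n y w m = kl_coeff n y' w m') \<and>
    (0 < m' \<longrightarrow> has_descents n A B y')"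
  using assms(1,2)
proof (induction m arbitrary: ys yi l y)
  case 0
  then show ?case by auto
next
  case (Suc m)
  have y: "y \<in> symgrp n" using Suc.prems by (simp add: perm_rep_def)
  have len: "length ys = n" "length yi = n" using Suc.prems perm_rep_length by blast+
  show ?case
  proof (cases "find_ascent A yi 0")
    case (Some t)
    obtain i a b where t: "t = (i, a, b)" by (cases t)
    have i: "i < length A" "A ! i" "Suc i < n" "a = yi ! i" "b = yi ! Suc i" "a < b"
      using find_ascent_Some[of A yi 0 i a b] Some t len by auto
    have nd: "\<not> ldesc y i" using i perm_rep_nth[OF Suc.prems(1)] by (simp add: ldesc_def)
    have rep: "perm_rep n (swap_vals i (i + 1) ys) (swap_vals a b yi) (l + 1) (simple_refl i \<circ> y)"
      using perm_rep_left[OF Suc.prems(1) i(3)] nd i by simp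
    have "raise A B m (swap_vals i (i + 1) ys) (swap_vals a b yi) (l + 1) = (ys', yi', l', m')"
      using Suc.prems(2) Some t by simp
    from Suc.IH[OF rep this] obtain y' where y': "perm_rep n ys' yi' l' y'"
      "\<forall>w. has_descents n A B w \<longrightarrow> kl_coeff n (simple_refl i \<circ> y) w m = kl_coeff n y' w m'"
      "0 < m' \<longrightarrow> has_descents n A B y'" by blast
    have "kl_coeff n y w (Suc m) = kl_coeff n (simple_refl i \<circ> y) w m" if "has_descents n A B w" for w
      using that i nd y by (intro kl_coeff_raise) (auto simp: has_descents_def)
    then show ?thesis using y' by metis
  next
    case None
    show ?thesis
    proof (cases "find_ascent B ys 0")
      case (Some t)
      obtain i a b where t: "t = (i, a, b)" by (cases t)
      have i: "i < length B" "B ! i" "Suc i < n" "a = ys ! i" "b = ys ! Suc i" "a < b"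
        using find_ascent_Some[of B ys 0 i a b] Some t len by auto
      have nd: "\<not> y (Suc i) < y i" using i perm_rep_nth[OF Suc.prems(1)] by simp
      have rep: "perm_rep n (swap_vals a b ys) (swap_vals i (i + 1) yi) (l + 1) (y \<circ> simple_refl i)"
        using perm_rep_right[OF Suc.prems(1) i(3)] nd i by simp
      have "raise A B m (swap_vals a b ys) (swap_vals i (i + 1) yi) (l + 1) = (ys', yi', l', m')"
        using Suc.prems(2) Some None t by simp
      from Suc.IH[OF rep this] obtain y' where y': "perm_rep n ys' yi' l' y'"
        "\<forall>w. has_descents n A B w \<longrightarrow> kl_coeff n (y \<circ> simple_refl i) w m = kl_coeff n y' w m'"
        "0 < m' \<longrightarrow> has_descents n A B y'" by blast
      have "kl_coeff n y w (Suc m) = kl_coeff n (y \<circ> simple_refl i) w m" if "has_descents n A B w" for w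
        using that i nd y by (intro kl_coeff_raise_right) (auto simp: has_descents_def)
      then show ?thesis using y' by metis
    next
      case None2: None
      have eq: "ys' = ys" "yi' = yi" "l' = l" "m' = Suc m" using Suc.prems(2) None None2 by auto
      have "has_descents n A B y"
        unfolding has_descents_def
      proof (intro conjI allI impI y)
        fix i assume i: "Suc i < n" "i < length A" "A ! i"
        then have "\<not> yi ! i < yi ! Suc i" using find_ascent_None[OF None] len by simp
        then show "ldesc y i" using i perm_rep_nth[OF Suc.prems(1)] symgrp_inj[OF symgrp_inv[OF y], of i "Suc i"]
          by (auto simp: ldesc_def)
      next
        fix i assume i: "Suc i < n" "i < length B" "B ! i"
        then have "\<not> ys ! i < ys ! Suc i" using find_ascent_None[OF None2] len by simp
        then show "y (Suc i) < y i" using i perm_rep_nth[OF Suc.prems(1)] symgrp_inj[OF y, of i "Suc i"]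
          by auto
      qed
      then show ?thesis using Suc.prems(1) unfolding eq by blast
    qed
  qed
qed

section \<open>Enumerating a Bruhat interval\<close>

text \<open>The lists run over the thresholds \<open>r\<close>; a bit tells whether the entry just
  placed reaches \<open>r\<close>, and the slack is the larger rank minus the smaller. A step is
  refused when a slack of 0 would have to decrease.\<close>

fun step_ok :: "bool list \<Rightarrow> bool list \<Rightarrow> nat list \<Rightarrow> bool" where
  "step_ok (True # xs) (y # ys) (d # ds) = step_ok xs ys ds"
| "step_ok (False # xs) (False # ys) (d # ds) = step_ok xs ys ds"
| "step_ok (False # xs) (True # ys) (Suc d # ds) = step_ok xs ys ds"
| "step_ok (False # xs) (True # ys) (0 # ds) = False"
| "step_ok xs ys ds = True"

text \<open>The slack after the step; the 0 in the refused case is a default value that a successful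
  \<open>step_ok\<close> rules out.\<close>

fun step_next :: "bool list \<Rightarrow> bool list \<Rightarrow> nat list \<Rightarrow> nat list" where
  "step_next (True # xs) (True # ys) (d # ds) = d # step_next xs ys ds"
| "step_next (True # xs) (False # ys) (d # ds) = Suc d # step_next xs ys ds"
| "step_next (False # xs) (False # ys) (d # ds) = d # step_next xs ys ds"
| "step_next (False # xs) (True # ys) (Suc d # ds) = d # step_next xs ys ds"
| "step_next (False # xs) (True # ys) (0 # ds) = 0 # step_next xs ys ds"
| "step_next xs ys ds = []"

text \<open>Since the ranks compare correctly before and after the step, the truncated differences
  are true differences and change by the difference of the bits.\<close>

lemma step_diff:
  assumes "\<And>r. r \<in> set rs \<Longrightarrow> (f r :: nat) \<le> g r \<and> f r + of_bool (Q r) \<le> g r + of_bool (P r)"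
  shows "step_ok (map P rs) (map Q rs) (map (\<lambda>r. g r - f r) rs) \<and>
    step_next (map P rs) (map Q rs) (map (\<lambda>r. g r - f r) rs) =
      map (\<lambda>r. (g r + of_bool (P r)) - (f r + of_bool (Q r))) rs"
  using assms
proof (induction rs)
  case (Cons r rs)
  have IH: "step_ok (map P rs) (map Q rs) (map (\<lambda>r. g r - f r) rs) \<and>
    step_next (map P rs) (map Q rs) (map (\<lambda>r. g r - f r) rs) =
      map (\<lambda>r. (g r + of_bool (P r)) - (f r + of_bool (Q r))) rs"
    using Cons by simp
  have r: "f r \<le> g r" "f r + of_bool (Q r) \<le> g r + of_bool (P r)" using Cons.prems by auto
  show ?case
  proof (cases "P r"; cases "Q r")
    assume "\<not> P r" "Q r"
    moreover from this r have "g r - f r = Suc (g r - Suc (f r))" by auto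
    ultimately show ?thesis using IH by simp
  qed (use IH r in auto)
qed simp

type_synonym entry = "nat \<times> bool list"

text \<open>Nested conditionals, unlike conjunctions, stop at the first failing test when evaluated
  by rewriting.\<close>

definition entry_ok :: "bool \<Rightarrow> nat \<Rightarrow> nat \<Rightarrow> bool list \<Rightarrow> bool list \<Rightarrow> bool list \<Rightarrow> nat list \<Rightarrow> nat list \<Rightarrow> bool" where
  "entry_ok b v prev vv yv uv d1 d2 =
     (if (if b then v < prev else True) then if step_ok vv yv d1 then step_ok uv vv d2 else False else False)"

fun rev_append :: "'a list \<Rightarrow> 'a list \<Rightarrow> 'a list" where
  "rev_append [] ys = ys"
| "rev_append (x # xs) ys = rev_append xs (x # ys)"

lemma rev_append_eq: "rev_append xs ys = rev xs @ ys"
  by (induction xs arbitrary: ys) auto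

text \<open>Depth-first search over the one-line notations of the permutations \<open>z\<close> with
  \<open>y \<le> z \<le> u\<close> in the rank order. A block lists values that have to appear in this order;
  \<open>d1\<close> and \<open>d2\<close> hold the slack of the rank conditions against \<open>y\<close> and \<open>u\<close>.\<close>

function dfs :: "(bool \<times> bool list \<times> bool list) list \<Rightarrow> nat \<Rightarrow> entry list list \<Rightarrow> nat list \<Rightarrow> nat list \<Rightarrow>
    nat list \<Rightarrow> nat list list \<Rightarrow> nat list list"
  and dfs_blocks :: "(bool \<times> bool list \<times> bool list) list \<Rightarrow> bool \<Rightarrow> bool list \<Rightarrow> bool list \<Rightarrow> nat \<Rightarrow>
    entry list list \<Rightarrow> entry list list \<Rightarrow> nat list \<Rightarrow> nat list \<Rightarrow> nat list \<Rightarrow> nat list list \<Rightarrow> nat list list"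
  and dfs_entry :: "bool \<Rightarrow> (bool \<times> bool list \<times> bool list) list \<Rightarrow> bool \<Rightarrow> bool list \<Rightarrow> bool list \<Rightarrow> nat \<Rightarrow>
    entry list list \<Rightarrow> nat \<Rightarrow> bool list \<Rightarrow> entry list \<Rightarrow> entry list list \<Rightarrow> nat list \<Rightarrow> nat list \<Rightarrow> nat list \<Rightarrow>
    nat list list \<Rightarrow> nat list list"
  where
  "dfs [] prev bl d1 d2 acc res = rev_append acc [] # res"
| "dfs ((b, yv, uv) # rows) prev bl d1 d2 acc res = dfs_blocks rows b yv uv prev [] bl d1 d2 acc res"
| "dfs_blocks rows b yv uv prev pre [] d1 d2 acc res = res"
| "dfs_blocks rows b yv uv prev pre ([] # bs) d1 d2 acc res = dfs_blocks rows b yv uv prev pre bs d1 d2 acc res"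
| "dfs_blocks rows b yv uv prev pre (((v, vv) # c) # bs) d1 d2 acc res =
     dfs_entry (entry_ok b v prev vv yv uv d1 d2) rows b yv uv prev pre v vv c bs d1 d2 acc res"
| "dfs_entry False rows b yv uv prev pre v vv c bs d1 d2 acc res =
     dfs_blocks rows b yv uv prev (((v, vv) # c) # pre) bs d1 d2 acc res"
| "dfs_entry True rows b yv uv prev pre v vv c bs d1 d2 acc res =
     dfs_blocks rows b yv uv prev (((v, vv) # c) # pre) bs d1 d2 acc
       (dfs rows v (c # rev_append pre bs) (step_next vv yv d1) (step_next uv vv d2) (v # acc) res)"
  by pat_completeness auto
termination
  by (relation "measures [\<lambda>x. case x of Inl (rows, _) \<Rightarrow> length rows
      | Inr (Inl (rows, _)) \<Rightarrow> length rows
      | Inr (Inr (_, rows, _)) \<Rightarrow> length rows,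
     \<lambda>x. case x of Inl _ \<Rightarrow> 0
      | Inr (Inl (rows, b, yv, uv, prev, pre, bs, _)) \<Rightarrow> 2 * length bs + 1
      | Inr (Inr (_, rows, b, yv, uv, prev, pre, v, vv, c, bs, _)) \<Rightarrow> 2 * length bs + 2]") auto

text \<open>The results are threaded through as an accumulator: whatever one branch finds survives
  all later ones.\<close>

lemma dfs_mono:
  "set res \<subseteq> set (dfs rows prev bl d1 d2 acc res)"
  "set res \<subseteq> set (dfs_blocks rows b yv uv prev pre bs d1 d2 acc res)"
  "set res \<subseteq> set (dfs_entry ok rows b yv uv prev pre v vv c bs d1 d2 acc res)"
  by (induction rows prev bl d1 d2 acc res and rows b yv uv prev pre bs d1 d2 acc res and
      ok rows b yv uv prev pre v vv c bs d1 d2 acc res rule: dfs_dfs_blocks_dfs_entry.induct) auto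

text \<open>Follows the single branch in which \<open>v\<close>, the head of one block, is placed
  next. Blocks already passed over come back in a different order, so the new state is described by
  multisets and sets.\<close>

lemma dfs_blocks_split:
  assumes "entry_ok b v prev vv yv uv d1 d2"
  shows "\<exists>bl' res'. mset (concat bl') = mset (concat pre) + mset (concat bs1) + mset c + mset (concat bs2) \<and>
     set bl' \<subseteq> set pre \<union> set bs1 \<union> {c} \<union> set bs2 \<and>
     set (dfs rows v bl' (step_next vv yv d1) (step_next uv vv d2) (v # acc) res') \<subseteq>
       set (dfs_blocks rows b yv uv prev pre (bs1 @ ((v, vv) # c) # bs2) d1 d2 acc res)"
proof (induction bs1 arbitrary: pre res)
  case Nil
  have "mset (concat (rev pre)) = mset (concat pre)" by (induction pre) (auto simp: ac_simps)
  then show ?case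
    by (intro exI[of _ "c # rev_append pre bs2"] exI[of _ res])
       (use assms dfs_mono(2) in \<open>auto simp: rev_append_eq ac_simps\<close>)
next
  case (Cons e bs1)
  show ?case
  proof (cases e)
    case Nil
    obtain bl' res' where "mset (concat bl') = mset (concat pre) + mset (concat bs1) + mset c + mset (concat bs2)"
      "set bl' \<subseteq> set pre \<union> set bs1 \<union> {c} \<union> set bs2"
      "set (dfs rows v bl' (step_next vv yv d1) (step_next uv vv d2) (v # acc) res') \<subseteq>
       set (dfs_blocks rows b yv uv prev pre (bs1 @ ((v, vv) # c) # bs2) d1 d2 acc res)"
      using Cons.IH[of pre res] by blast
    then show ?thesis unfolding Nil
      by (intro exI[of _ bl'] exI[of _ res']) auto
  next
    case e: (Cons h t)
    obtain v' vv' where h: "h = (v', vv')" by (cases h)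
    let ?ok = "entry_ok b v' prev vv' yv uv d1 d2"
    let ?res = "if ?ok then dfs rows v' (t # rev_append pre (bs1 @ ((v, vv) # c) # bs2)) (step_next vv' yv d1)
       (step_next uv vv' d2) (v' # acc) res else res"
    have eq: "dfs_blocks rows b yv uv prev pre ((e # bs1) @ ((v, vv) # c) # bs2) d1 d2 acc res =
       dfs_blocks rows b yv uv prev (e # pre) (bs1 @ ((v, vv) # c) # bs2) d1 d2 acc ?res"
      unfolding e h by (cases ?ok) auto
    obtain bl' res' where "mset (concat bl') = mset (concat (e # pre)) + mset (concat bs1) + mset c + mset (concat bs2)"
      "set bl' \<subseteq> set (e # pre) \<union> set bs1 \<union> {c} \<union> set bs2"
      "set (dfs rows v bl' (step_next vv yv d1) (step_next uv vv d2) (v # acc) res') \<subseteq>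
       set (dfs_blocks rows b yv uv prev (e # pre) (bs1 @ ((v, vv) # c) # bs2) d1 d2 acc ?res)"
      using Cons.IH[of "e # pre" ?res] by blast
    then show ?thesis unfolding eq
      by (intro exI[of _ bl'] exI[of _ res']) (auto simp: ac_simps)
  qed
qed

definition vec :: "nat \<Rightarrow> nat \<Rightarrow> bool list" where
  "vec n v = map (\<lambda>r. r \<le> v) [0..<n]"

text \<open>The flag of row \<open>j\<close> prescribes a descent between positions
  \<open>j - 1\<close> and \<open>j\<close>, hence the shift and the default \<open>False\<close> in
  the first row.\<close>

definition dfs_rows :: "nat \<Rightarrow> bool list \<Rightarrow> perm \<Rightarrow> perm \<Rightarrow> nat \<Rightarrow> (bool \<times> bool list \<times> bool list) list" where
  "dfs_rows n B y u p = map (\<lambda>j. (case j of 0 \<Rightarrow> False | Suc i \<Rightarrow> B ! i, vec n (y j), vec n (u j))) [p..<n]"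

text \<open>Completeness of the search: the branch that spells out \<open>z\<close> is never cut
  off. The blocks hold exactly the values not yet placed, each block in the order in which
  \<open>z\<close> takes them.\<close>

lemma dfs_sound:
  assumes z: "z \<in> symgrp n"
    and yz: "\<And>r p. rank r p y \<le> rank r p z" and zu: "\<And>r p. rank r p z \<le> rank r p u"
    and B: "\<And>i. Suc i < n \<Longrightarrow> B ! i \<Longrightarrow> z (Suc i) < z i"
  shows "p \<le> n \<Longrightarrow> mset (map fst (concat bl)) = mset (map z [p..<n]) \<Longrightarrow>
    (\<forall>e\<in>set (concat bl). snd e = vec n (fst e)) \<Longrightarrow>
    (\<forall>b\<in>set bl. sorted_wrt (\<lambda>a b. pinv z (fst a) < pinv z (fst b)) b) \<Longrightarrow>
    (0 < p \<Longrightarrow> prev = z (p - 1)) \<Longrightarrow>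
    rev acc @ map z [p..<n] \<in> set (dfs (dfs_rows n B y u p) prev bl
      (map (\<lambda>r. rank r p z - rank r p y) [0..<n]) (map (\<lambda>r. rank r p u - rank r p z) [0..<n]) acc res)"
proof (induction "n - p" arbitrary: p bl prev acc res)
  case 0
  then show ?case by (simp add: dfs_rows_def rev_append_eq)
next
  case (Suc k)
  have p: "p < n" using Suc by simp
  have upt: "[p..<n] = p # [Suc p..<n]" using p by (simp add: upt_conv_Cons)
  have "z p \<in> set (map fst (concat bl))"
    using arg_cong[OF Suc.prems(2), of set_mset] upt by simp
  then obtain blk e where blk: "blk \<in> set bl" "e \<in> set blk" "fst e = z p" by auto
  obtain h c where hc: "blk = h # c" using blk(2) by (cases blk) auto
  \<comment> \<open>Were \<open>z p\<close> further down its block, the head would come earlier in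
    \<open>z\<close> and would already have been placed.\<close>
  have h: "fst h = z p"
  proof (rule ccontr)
    assume ne: "fst h \<noteq> z p"
    then have "e \<in> set c" using blk hc by auto
    moreover have "sorted_wrt (\<lambda>a b. pinv z (fst a) < pinv z (fst b)) (h # c)"
      using bspec[OF Suc.prems(4) blk(1)] unfolding hc .
    ultimately have "pinv z (fst h) < pinv z (fst e)" by simp
    then have "pinv z (fst h) < p" using blk(3) z by simp
    moreover have "fst h \<in> set_mset (mset (map fst (concat bl)))" using blk hc by force
    then obtain j where "j \<in> {p..<n}" "fst h = z j" unfolding Suc.prems(2) by auto
    ultimately show False using z by simp
  qed
  obtain bs1 bs2 where bl: "bl = bs1 @ blk # bs2" using blk(1) by (meson split_list)
  obtain v vv where vv: "h = (v, vv)" by (cases h)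
  have v: "v = z p" "vv = vec n (z p)" using h vv Suc.prems(3) blk(1) hc by force+
  let ?d1 = "\<lambda>p. map (\<lambda>r. rank r p z - rank r p y) [0..<n]" and ?d2 = "\<lambda>p. map (\<lambda>r. rank r p u - rank r p z) [0..<n]"
  define b where "b = (case p of 0 \<Rightarrow> False | Suc i \<Rightarrow> B ! i)"
  have rows: "dfs_rows n B y u p = (b, vec n (y p), vec n (u p)) # dfs_rows n B y u (Suc p)"
    unfolding dfs_rows_def upt by (simp add: b_def)
  have s1: "step_ok (vec n (z p)) (vec n (y p)) (?d1 p) \<and> step_next (vec n (z p)) (vec n (y p)) (?d1 p) = ?d1 (Suc p)"
    using step_diff[of "[0..<n]" "\<lambda>r. rank r p y" "\<lambda>r. rank r p z" "\<lambda>r. r \<le> y p" "\<lambda>r. r \<le> z p"]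
      yz[of _ p] yz[of _ "Suc p"] by (simp add: vec_def rank_Suc)
  have s2: "step_ok (vec n (u p)) (vec n (z p)) (?d2 p) \<and> step_next (vec n (u p)) (vec n (z p)) (?d2 p) = ?d2 (Suc p)"
    using step_diff[of "[0..<n]" "\<lambda>r. rank r p z" "\<lambda>r. rank r p u" "\<lambda>r. r \<le> z p" "\<lambda>r. r \<le> u p"]
      zu[of _ p] zu[of _ "Suc p"] by (simp add: vec_def rank_Suc)
  have ok: "entry_ok b v prev vv (vec n (y p)) (vec n (u p)) (?d1 p) (?d2 p)"
    unfolding entry_ok_def v using s1 s2 Suc.prems(5) B p by (auto simp: b_def split: nat.splits)
  obtain bl' res' where bl':
    "mset (concat bl') = mset (concat []) + mset (concat bs1) + mset c + mset (concat bs2)"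
    "set bl' \<subseteq> set [] \<union> set bs1 \<union> {c} \<union> set bs2"
    "set (dfs (dfs_rows n B y u (Suc p)) v bl' (step_next vv (vec n (y p)) (?d1 p))
        (step_next (vec n (u p)) vv (?d2 p)) (v # acc) res') \<subseteq>
       set (dfs_blocks (dfs_rows n B y u (Suc p)) b (vec n (y p)) (vec n (u p)) prev [] (bs1 @ ((v, vv) # c) # bs2)
         (?d1 p) (?d2 p) acc res)"
    using dfs_blocks_split[OF ok, of "[]" bs1 c bs2] by blast
  have m: "mset (map fst (concat bl')) = mset (map z [Suc p..<n])"
  proof -
    have "mset (map fst (concat bl)) = add_mset (z p) (mset (map fst (concat bl')))"
      using bl'(1) bl hc vv v by simp
    then show ?thesis unfolding Suc.prems(2) upt by simp
  qed
  have "rev (v # acc) @ map z [Suc p..<n] \<in> set (dfs (dfs_rows n B y u (Suc p)) v bl' (?d1 (Suc p)) (?d2 (Suc p)) (v # acc) res')"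
  proof (rule Suc.hyps(1)[OF _ _ m])
    show "\<forall>e\<in>set (concat bl'). snd e = vec n (fst e)"
      using Suc.prems(3) bl'(2) bl hc by fastforce
    show "\<forall>b\<in>set bl'. sorted_wrt (\<lambda>a b. pinv z (fst a) < pinv z (fst b)) b"
      using Suc.prems(4) bl'(2) bl hc by (auto dest!: subsetD)
  qed (use Suc.hyps(2) p v in auto)
  then have "rev acc @ map z [p..<n] \<in> set (dfs (dfs_rows n B y u (Suc p)) v bl' (?d1 (Suc p)) (?d2 (Suc p)) (v # acc) res')"
    using v unfolding upt by simp
  then have "rev acc @ map z [p..<n] \<in> set (dfs (dfs_rows n B y u (Suc p)) v bl'
      (step_next vv (vec n (y p)) (?d1 p)) (step_next (vec n (u p)) vv (?d2 p)) (v # acc) res')"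
    unfolding v conjunct2[OF s1] conjunct2[OF s2] .
  from subsetD[OF bl'(3) this] show ?case unfolding rows dfs.simps bl hc vv .
qed

text \<open>Index lists are produced by walking along a given list, so that evaluation needs neither
  \<open>[0..<n]\<close> nor a length.\<close>

fun count_list_up :: "nat \<Rightarrow> nat list \<Rightarrow> nat list" where
  "count_list_up k [] = []"
| "count_list_up k (x # xs) = k # count_list_up (k + 1) xs"

fun vec_of :: "nat list \<Rightarrow> nat \<Rightarrow> bool list" where
  "vec_of [] v = []"
| "vec_of (r # rs) v = (r \<le> v) # vec_of rs v"

fun zeros :: "nat list \<Rightarrow> nat list" where
  "zeros [] = []"
| "zeros (x # xs) = 0 # zeros xs"

fun mk_rows :: "nat list \<Rightarrow> bool \<Rightarrow> bool list \<Rightarrow> nat list \<Rightarrow> nat list \<Rightarrow> (bool \<times> bool list \<times> bool list) list" where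
  "mk_rows rs b (b' # B) (y # ys) (u # us) = (b, vec_of rs y, vec_of rs u) # mk_rows rs b' B ys us"
| "mk_rows rs b [] (y # ys) (u # us) = (b, vec_of rs y, vec_of rs u) # mk_rows rs False [] ys us"
| "mk_rows rs b B ys us = []"

text \<open>A prescribed left descent between \<open>r - 1\<close> and \<open>r\<close> means that
  \<open>r\<close> comes first, so a run of such descents is gathered in one block with its largest
  value at the head.\<close>

fun mk_blocks :: "nat list \<Rightarrow> nat list \<Rightarrow> bool list \<Rightarrow> entry list \<Rightarrow> entry list list \<Rightarrow> entry list list" where
  "mk_blocks rs (r # rs') (True # A) cur done = mk_blocks rs rs' A ((r, vec_of rs r) # cur) done"
| "mk_blocks rs (r # rs') (False # A) cur done = mk_blocks rs rs' A [(r, vec_of rs r)] (cur # done)"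
| "mk_blocks rs rs' A cur done = cur # done"

definition interval_list :: "bool list \<Rightarrow> bool list \<Rightarrow> nat list \<Rightarrow> nat list \<Rightarrow> nat list list" where
  "interval_list A B ys us = (case count_list_up 0 ys of [] \<Rightarrow> [[]] | (r # rs) \<Rightarrow>
     dfs (mk_rows (r # rs) False B ys us) 0 (mk_blocks (r # rs) rs A [(r, vec_of (r # rs) r)] [])
       (zeros ys) (zeros ys) [] [])"

lemma count_list_up_eq: "count_list_up k xs = [k..<k + length xs]"
  by (induction xs arbitrary: k) (auto simp: upt_rec)

lemma vec_of_eq: "vec_of [0..<n] v = vec n v"
proof -
  have "vec_of rs v = map (\<lambda>r. r \<le> v) rs" for rs by (induction rs) auto
  then show ?thesis by (simp add: vec_def)
qed

lemma zeros_eq: "zeros xs = map (\<lambda>r. 0) [0..<length xs]"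
proof -
  have "zeros xs = replicate (length xs) 0" by (induction xs) auto
  then show ?thesis by (simp add: map_replicate_const)
qed

lemma mk_rows_eq:
  assumes "length B = n - 1" "p < n"
  shows "mk_rows [0..<n] (case p of 0 \<Rightarrow> False | Suc i \<Rightarrow> B ! i) (drop p B) (map y [p..<n]) (map u [p..<n]) = dfs_rows n B y u p"
  using assms(2)
proof (induction "n - p" arbitrary: p)
  case (Suc k)
  have upt: "[p..<n] = p # [Suc p..<n]" using Suc by (simp add: upt_conv_Cons)
  show ?case
  proof (cases "Suc p < n")
    case True
    then have "drop p B = B ! p # drop (Suc p) B" using assms(1) by (simp add: Cons_nth_drop_Suc)
    then show ?thesis
      using Suc.hyps(1)[of "Suc p"] Suc.hyps(2) True
      unfolding dfs_rows_def upt by (simp add: vec_of_eq)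
  next
    case False
    then have "Suc p = n" using Suc by simp
    moreover from this have "drop p B = []" using assms(1) by auto
    ultimately show ?thesis unfolding dfs_rows_def upt by (simp add: vec_of_eq)
  qed
qed simp

lemma mk_blocks_spec:
  assumes z: "\<And>i. Suc i < n \<Longrightarrow> A ! i \<Longrightarrow> pinv z (Suc i) < pinv z i" and len: "length A = n - 1"
  shows "0 < k \<Longrightarrow> k \<le> n \<Longrightarrow> cur \<noteq> [] \<Longrightarrow> fst (hd cur) = k - 1 \<Longrightarrow>
    (\<forall>b\<in>set (cur # done). sorted_wrt (\<lambda>a b. pinv z (fst a) < pinv z (fst b)) b) \<Longrightarrow>
    (\<forall>e\<in>set (concat (cur # done)). snd e = vec n (fst e)) \<Longrightarrow>
    mset (map fst (concat (cur # done))) = mset [0..<k] \<Longrightarrow>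
    mset (map fst (concat (mk_blocks [0..<n] [k..<n] (drop (k - 1) A) cur done))) = mset [0..<n] \<and>
    (\<forall>b\<in>set (mk_blocks [0..<n] [k..<n] (drop (k - 1) A) cur done).
       sorted_wrt (\<lambda>a b. pinv z (fst a) < pinv z (fst b)) b) \<and>
    (\<forall>e\<in>set (concat (mk_blocks [0..<n] [k..<n] (drop (k - 1) A) cur done)). snd e = vec n (fst e))"
proof (induction "n - k" arbitrary: k cur "done")
  case 0
  then show ?case by simp
next
  case (Suc m)
  have k: "k < n" using Suc by simp
  have upt: "[k..<n] = k # [Suc k..<n]" "[0..<Suc k] = [0..<k] @ [k]" using k by (simp_all add: upt_conv_Cons)
  have dr: "drop (k - 1) A = A ! (k - 1) # drop k A"
    using len k Suc.prems(1) Cons_nth_drop_Suc[of "k - 1" A] by simp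
  show ?case
  proof (cases "A ! (k - 1)")
    case True
    obtain e es where cur: "cur = e # es" using Suc.prems(3) by (cases cur) auto
    have lt: "pinv z k < pinv z (k - 1)" using z[of "k - 1"] True k Suc.prems(1) by simp
    have sorted: "sorted_wrt (\<lambda>a b. pinv z (fst a) < pinv z (fst b)) ((k, vec n k) # cur)"
    proof -
      have e: "fst e = k - 1" using Suc.prems(4) by (simp add: cur)
      have s: "sorted_wrt (\<lambda>a b. pinv z (fst a) < pinv z (fst b)) (e # es)" using Suc.prems(5) by (simp add: cur)
      have "pinv z k < pinv z (fst b)" if "b \<in> set es" for b
      proof -
        have "pinv z (k - 1) < pinv z (fst b)" using s that e by simp
        then show ?thesis using lt by linarith
      qed
      then show ?thesis using lt e s by (auto simp: cur)
    qed
    have eq: "mk_blocks [0..<n] [k..<n] (drop (k - 1) A) cur done =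
        mk_blocks [0..<n] [Suc k..<n] (drop (Suc k - 1) A) ((k, vec n k) # cur) done"
    proof -
      have "drop (k - 1) A = True # drop (Suc k - 1) A" using dr True by simp
      then show ?thesis using upt(1) mk_blocks.simps(1) vec_of_eq by metis
    qed
    show ?thesis
      unfolding eq
    proof (rule Suc.hyps(1))
      show "m = n - Suc k" using Suc.hyps(2) by linarith
      show "mset (map fst (concat (((k, vec n k) # cur) # done))) = mset [0..<Suc k]"
        using Suc.prems(7) unfolding upt(2) by simp
      show "\<forall>b\<in>set (((k, vec n k) # cur) # done). sorted_wrt (\<lambda>a b. pinv z (fst a) < pinv z (fst b)) b"
        using Suc.prems(5) sorted by (metis list.set_intros(2) set_ConsD)
      show "\<forall>e\<in>set (concat (((k, vec n k) # cur) # done)). snd e = vec n (fst e)"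
        using Suc.prems(6) by auto
    qed (use k in simp_all)
  next
    case False
    have eq: "mk_blocks [0..<n] [k..<n] (drop (k - 1) A) cur done =
        mk_blocks [0..<n] [Suc k..<n] (drop (Suc k - 1) A) [(k, vec n k)] (cur # done)"
    proof -
      have "drop (k - 1) A = False # drop (Suc k - 1) A" using dr False by simp
      then show ?thesis using upt(1) mk_blocks.simps(2) vec_of_eq by metis
    qed
    show ?thesis
      unfolding eq
    proof (rule Suc.hyps(1))
      show "m = n - Suc k" using Suc.hyps(2) by linarith
      show "mset (map fst (concat ([(k, vec n k)] # cur # done))) = mset [0..<Suc k]"
        using Suc.prems(7) unfolding upt(2) by simp
      show "\<forall>b\<in>set ([(k, vec n k)] # cur # done). sorted_wrt (\<lambda>a b. pinv z (fst a) < pinv z (fst b)) b"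
        using Suc.prems(5) by simp
      show "\<forall>e\<in>set (concat ([(k, vec n k)] # cur # done)). snd e = vec n (fst e)"
        using Suc.prems(6) by auto
    qed (use k in simp_all)
  qed
qed

lemma symgrp_mset: "z \<in> symgrp n \<Longrightarrow> mset (map z [0..<n]) = mset [0..<n]"
proof -
  assume z: "z \<in> symgrp n"
  then have "image_mset z (mset_set {0..<n}) = mset_set {0..<n}"
    using permutes_image[of z "{..<n}"] symgrp_inj[OF z]
    by (subst image_mset_mset_set) (auto simp: symgrp_def inj_on_def lessThan_atLeast0)
  then show ?thesis by (simp add: mset_upt [symmetric] del: mset_upt)
qed

lemma interval_list_sound:
  assumes z: "has_descents n A B z" and len: "length A = n - 1" "length B = n - 1"
    and yz: "\<And>r p. rank r p y \<le> rank r p z" and zu: "\<And>r p. rank r p z \<le> rank r p u"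
  shows "map z [0..<n] \<in> set (interval_list A B (map y [0..<n]) (map u [0..<n]))"
proof (cases "n = 0")
  case False
  have zs: "z \<in> symgrp n" using z by (simp add: has_descents_def)
  have upt: "[0..<n] = 0 # [1..<n]" using False by (simp add: upt_conv_Cons)
  let ?bl = "mk_blocks [0..<n] [1..<n] A [(0, vec n 0)] []"
  have bl: "mset (map fst (concat ?bl)) = mset [0..<n] \<and>
    (\<forall>b\<in>set ?bl. sorted_wrt (\<lambda>a b. pinv z (fst a) < pinv z (fst b)) b) \<and>
    (\<forall>e\<in>set (concat ?bl). snd e = vec n (fst e))"
    using mk_blocks_spec[of n A z 1 "[(0, vec n 0)]" "[]"] z len False
    by (auto simp: has_descents_def ldesc_def)
  have "rev [] @ map z [0..<n] \<in> set (dfs (dfs_rows n B y u 0) 0 ?bl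
      (map (\<lambda>r. rank r 0 z - rank r 0 y) [0..<n]) (map (\<lambda>r. rank r 0 u - rank r 0 z) [0..<n]) [] [])"
    by (rule dfs_sound[OF zs yz zu]) (use bl z len symgrp_mset[OF zs] in \<open>auto simp: has_descents_def\<close>)
  moreover have "mk_rows [0..<n] False B (map y [0..<n]) (map u [0..<n]) = dfs_rows n B y u 0"
    using mk_rows_eq[OF len(2), of 0 y u] False by simp
  \<comment> \<open>All ranks at position 0 vanish, which is why both slack lists start with
    zeros.\<close>
  moreover have "zeros (map y [0..<n]) = map (\<lambda>r. 0) [0..<n]" by (simp add: zeros_eq)
  moreover have "count_list_up 0 (map y [0..<n]) = [0..<n]" by (simp add: count_list_up_eq)
  then have c: "count_list_up 0 (map y [0..<n]) = 0 # [1..<n]" using upt by metis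
  ultimately show ?thesis
    unfolding interval_list_def c list.case unfolding upt [symmetric] vec_of_eq by simp
qed (simp add: interval_list_def)

section \<open>The evaluator\<close>

text \<open>
  A permutation is stored as the triple of its one-line notation, the one-line notation of its
  inverse and its length. Rewriting evaluates arguments first, so a recursive call that must only
  happen in one branch sits in an auxiliary function taking the branching condition as an
  argument (\<open>ev2\<close>, \<open>dfs_entry\<close>). All these functions are total with junk or \<open>None\<close> on
  ill-formed input.
\<close>

type_synonym prep = "nat list \<times> nat list \<times> int"

definition prep :: "nat \<Rightarrow> prep \<Rightarrow> perm \<Rightarrow> bool" where
  "prep n p w = (case p of (xs, xi, l) \<Rightarrow> perm_rep n xs xi l w)"

lemma prep_simp [simp]: "prep n (xs, xi, l) w = perm_rep n xs xi l w"
  by (simp add: prep_def)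

fun flip :: "prep \<Rightarrow> prep" where
  "flip (xs, xi, l) = (xi, xs, l)"

fun list_eq :: "nat list \<Rightarrow> nat list \<Rightarrow> bool" where
  "list_eq [] [] = True"
| "list_eq (x # xs) (y # ys) = (if x = y then list_eq xs ys else False)"
| "list_eq [] (y # ys) = False"
| "list_eq (x # xs) [] = False"

lemma list_eq_iff: "list_eq xs ys \<longleftrightarrow> xs = ys"
  by (induction xs ys rule: list_eq.induct) auto

fun same_length :: "nat list \<Rightarrow> nat list \<Rightarrow> bool" where
  "same_length [] [] = True"
| "same_length (x # xs) (y # ys) = same_length xs ys"
| "same_length [] (y # ys) = False"
| "same_length (x # xs) [] = False"

lemma same_length_iff: "same_length xs ys \<longleftrightarrow> length xs = length ys"
  by (induction xs ys rule: same_length.induct) auto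

fun cons_opt :: "'a option \<Rightarrow> 'a list option \<Rightarrow> 'a list option" where
  "cons_opt (Some x) (Some xs) = Some (x # xs)"
| "cons_opt None xs = None"
| "cons_opt (Some x) None = None"

lemma cons_opt_Some: "cons_opt a b = Some l \<longleftrightarrow> (\<exists>x xs. a = Some x \<and> b = Some xs \<and> l = x # xs)"
  by (cases a; cases b) auto

section \<open>Building triples from one-line notation\<close>

fun index_of :: "nat \<Rightarrow> nat list \<Rightarrow> nat \<Rightarrow> nat option" where
  "index_of v [] i = None"
| "index_of v (x # xs) i = (if x = v then Some i else index_of v xs (i + 1))"

lemma index_of_Some: "index_of v xs k = Some i \<Longrightarrow> \<exists>j<length xs. i = k + j \<and> xs ! j = v"
proof (induction v xs k rule: index_of.induct)
  case (2 v x xs k)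
  then show ?case by (cases "x = v") (force simp: less_Suc_eq_0_disj)+
qed simp

fun indices_of :: "nat list \<Rightarrow> nat list \<Rightarrow> nat list option" where
  "indices_of [] xs = Some []"
| "indices_of (v # vs) xs = cons_opt (index_of v xs 0) (indices_of vs xs)"

lemma indices_of_Some:
  "indices_of vs xs = Some is \<Longrightarrow>
    length is = length vs \<and> (\<forall>j<length vs. is ! j < length xs \<and> xs ! (is ! j) = vs ! j)"
proof (induction vs arbitrary: "is")
  case (Cons v vs)
  then obtain i js where i: "index_of v xs 0 = Some i" "indices_of vs xs = Some js" "is = i # js"
    by (auto simp: cons_opt_Some)
  then show ?case using Cons.IH[OF i(2)] index_of_Some[OF i(1)] by (auto simp: less_Suc_eq_0_disj)
qed simp

fun count_less :: "nat \<Rightarrow> nat list \<Rightarrow> int \<Rightarrow> int" where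
  "count_less a [] k = k"
| "count_less a (b # bs) k = (if b < a then count_less a bs (k + 1) else count_less a bs k)"

fun inv_count :: "nat list \<Rightarrow> int \<Rightarrow> int" where
  "inv_count [] k = k"
| "inv_count (a # as) k = inv_count as (count_less a as k)"

lemma count_less_eq: "count_less a bs k = k + int (card {j. j < length bs \<and> bs ! j < a})"
proof (induction bs arbitrary: k)
  case (Cons b bs)
  have eq: "{j. j < length (b # bs) \<and> (b # bs) ! j < a} =
      (if b < a then {0} else {}) \<union> Suc ` {j. j < length bs \<and> bs ! j < a}"
    by (auto simp: less_Suc_eq_0_disj image_iff)
  have "card {j. j < length (b # bs) \<and> (b # bs) ! j < a} = of_bool (b < a) + card {j. j < length bs \<and> bs ! j < a}"
    unfolding eq by (auto simp: card_image card_insert_if)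
  then show ?case using Cons by simp
qed simp

lemma inv_count_eq:
  "inv_count xs k = k + int (card {(i, j). i < j \<and> j < length xs \<and> xs ! j < xs ! i})"
proof (induction xs arbitrary: k)
  case (Cons a xs)
  let ?S = "{(i, j). i < j \<and> j < length xs \<and> xs ! j < xs ! i}"
  have fin: "finite ?S" by (rule finite_subset[of _ "{..<length xs} \<times> {..<length xs}"]) auto
  have "{(i, j). i < j \<and> j < length (a # xs) \<and> (a # xs) ! j < (a # xs) ! i} =
      (\<lambda>j. (0, Suc j)) ` {j. j < length xs \<and> xs ! j < a} \<union> (\<lambda>(i, j). (Suc i, Suc j)) ` ?S" (is "?L = ?R")
  proof
    show "?L \<subseteq> ?R"
    proof
      fix p assume p: "p \<in> ?L"
      obtain i j where ij: "p = (i, j)" by (cases p)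
      obtain j' where j: "j = Suc j'" using p ij by (cases j) auto
      show "p \<in> ?R"
      proof (cases i)
        case 0
        then show ?thesis using p ij j by auto
      next
        case (Suc i')
        then have "(i', j') \<in> ?S" "p = (\<lambda>(i, j). (Suc i, Suc j)) (i', j')" using p ij j by auto
        then show ?thesis by blast
      qed
    qed
  qed auto
  moreover have "card (\<dots>) = card {j. j < length xs \<and> xs ! j < a} + card ?S"
    using fin by (subst card_Un_disjoint) (auto simp: card_image inj_on_def)
  ultimately show ?case using Cons by (simp add: count_less_eq)
qed simp

fun mk_prep1 :: "bool \<Rightarrow> nat list option \<Rightarrow> nat list \<Rightarrow> prep option" where
  "mk_prep1 True (Some xi) xs = Some (xs, xi, inv_count xs 0)"
| "mk_prep1 True None xs = None"
| "mk_prep1 False xi xs = None"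

text \<open>Locating every value below \<open>n\<close> yields the inverse and at the same time
  shows that the list is onto; \<open>us\<close> supplies the expected size.\<close>

fun mk_prep :: "nat list \<Rightarrow> nat list \<Rightarrow> prep option" where
  "mk_prep us xs = mk_prep1 (same_length us xs) (indices_of (count_list_up 0 xs) xs) xs"

lemma mk_prep_sound:
  assumes "mk_prep us xs = Some p"
  shows "prep (length us) p (one_line xs)" "fst p = xs"
proof -
  let ?n = "length us"
  have len: "length xs = ?n"
    using assms by (cases "same_length us xs") (auto simp: same_length_iff)
  obtain xi where xi: "indices_of (count_list_up 0 xs) xs = Some xi" "p = (xs, xi, inv_count xs 0)"
    using assms by (cases "same_length us xs"; cases "indices_of (count_list_up 0 xs) xs") auto
  then show "fst p = xs" by simp
  have i: "length xi = ?n" "\<And>j. j < ?n \<Longrightarrow> xi ! j < ?n \<and> xs ! (xi ! j) = j"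
    using indices_of_Some[OF xi(1)] len by (auto simp: count_list_up_eq)
  have sub: "{..<?n} \<subseteq> set xs"
  proof
    fix j assume "j \<in> {..<?n}"
    then show "j \<in> set xs" using i(2)[of j] len nth_mem[of "xi ! j" xs] by auto
  qed
  \<comment> \<open>A list of length \<open>n\<close> that contains all \<open>n\<close> values has
    no room for other values or for repetitions.\<close>
  have "card (set xs) \<le> ?n" using card_length[of xs] len by simp
  then have set: "set xs = {..<?n}" using sub by (metis List.finite_set card_lessThan card_seteq)
  then have dist: "distinct xs" using len by (simp add: card_distinct)
  have "bij_betw (one_line xs) {..<?n} {..<?n}"
  proof -
    have "bij_betw ((!) xs) {..<?n} {..<?n}" by (rule bij_betw_nth[OF dist]) (simp_all add: len set)
    moreover have "one_line xs i = xs ! i" if "i \<in> {..<?n}" for i using that len by (simp add: one_line_def)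
    ultimately show ?thesis by (metis bij_betw_cong)
  qed
  then have w: "one_line xs \<in> symgrp ?n"
    unfolding symgrp_def mem_Collect_eq by (rule bij_imp_permutes) (simp add: one_line_def len)
  have "pinv (one_line xs) j = xi ! j" if "j < ?n" for j
  proof (rule inv_f_eq)
    show "inj (one_line xs)" using w by (auto simp: symgrp_def permutes_inj)
    show "one_line xs (xi ! j) = j" using i(2)[OF that] len by (simp add: one_line_def)
  qed
  then have xi': "xi = map (pinv (one_line xs)) [0..<?n]" using i(1) by (intro nth_equalityI) auto
  have xs: "xs = map (one_line xs) [0..<?n]" using len by (intro nth_equalityI) (auto simp: one_line_def)
  have "{(i, j). i < j \<and> j < length xs \<and> xs ! j < xs ! i} =
      {(i, j). i < j \<and> j < ?n \<and> one_line xs j < one_line xs i}"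
    using len by (auto simp: one_line_def)
  then have l: "inv_count xs 0 = int (perm_length ?n (one_line xs))"
    by (simp add: inv_count_eq perm_length_def)
  show "prep ?n p (one_line xs)"
    unfolding xi(2) prep_simp perm_rep_def by (intro conjI w xs xi' l)
qed

lemma one_line_map: "z \<in> symgrp n \<Longrightarrow> one_line (map z [0..<n]) = z"
  by (rule ext) (auto simp: one_line_def symgrp_fix)

fun at_pair :: "nat \<Rightarrow> nat \<Rightarrow> nat list \<Rightarrow> (nat \<times> nat) option" where
  "at_pair s i (a # b # xs) = (if i = s then Some (a, b) else at_pair s (i + 1) (b # xs))"
| "at_pair s i [a] = None"
| "at_pair s i [] = None"

lemma at_pair_Some:
  "at_pair s k xs = Some (a, b) \<Longrightarrow> \<exists>j. s = k + j \<and> Suc j < length xs \<and> a = xs ! j \<and> b = xs ! Suc j"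
proof (induction s k xs rule: at_pair.induct)
  case (1 s i a' b' xs)
  show ?case
  proof (cases "i = s")
    case True
    then show ?thesis using 1 by (intro exI[of _ 0]) auto
  next
    case False
    then obtain j where "s = i + 1 + j" "Suc j < length (b' # xs)" "a = (b' # xs) ! j" "b = (b' # xs) ! Suc j"
      using 1 by auto
    then show ?thesis by (intro exI[of _ "Suc j"]) auto
  qed
qed auto

lemma at_pair_0:
  assumes "at_pair s 0 xs = Some (a, b)"
  shows "Suc s < length xs" "a = xs ! s" "b = xs ! Suc s"
  using at_pair_Some[OF assms] by auto

lemma at_pair_nth: "Suc j < length xs \<Longrightarrow> at_pair (k + j) k xs = Some (xs ! j, xs ! Suc j)"
proof (induction j arbitrary: k xs)
  case 0
  then obtain a b ys where "xs = a # b # ys" by (cases xs rule: descents.cases) auto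
  then show ?case by simp
next
  case (Suc j)
  then obtain a b ys where xs: "xs = a # b # ys" by (cases xs rule: descents.cases) auto
  have "at_pair (k + 1 + j) (k + 1) (b # ys) = Some ((b # ys) ! j, (b # ys) ! Suc j)"
    by (rule Suc.IH) (use Suc.prems xs in simp)
  then show ?case by (simp add: xs)
qed

fun set_flag :: "nat \<Rightarrow> nat \<Rightarrow> bool list \<Rightarrow> bool list" where
  "set_flag s i [] = []"
| "set_flag s i (d # ds) = (if i = s then True # ds else d # set_flag s (i + 1) ds)"

lemma length_set_flag [simp]: "length (set_flag s k ds) = length ds"
  by (induction s k ds rule: set_flag.induct) auto

lemma nth_set_flag: "j < length ds \<Longrightarrow> set_flag s k ds ! j \<longleftrightarrow> s = k + j \<or> ds ! j"
proof (induction s k ds arbitrary: j rule: set_flag.induct)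
  case (2 s i d ds)
  then show ?case by (cases j) auto
qed simp

section \<open>Listing the correction terms\<close>

fun adjacent :: "nat \<Rightarrow> nat \<Rightarrow> bool" where
  "adjacent s i = (if i = s + 1 then True else i + 1 = s)"

text \<open>The exceptional candidates \<open>t u < u\<close> with \<open>t\<close> adjacent to
  \<open>s\<close>.\<close>

fun left_cands :: "nat \<Rightarrow> nat \<Rightarrow> nat list \<Rightarrow> nat list \<Rightarrow> nat list \<Rightarrow> int \<Rightarrow> prep list \<Rightarrow> prep list" where
  "left_cands s i (a # b # xs) us ui ul acc = left_cands s (i + 1) (b # xs) us ui ul
     (if b < a then if adjacent s i then (swap_vals i (i + 1) us, swap_vals a b ui, ul - 1) # acc else acc else acc)"
| "left_cands s i [a] us ui ul acc = acc"
| "left_cands s i [] us ui ul acc = acc"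

fun mk_preps :: "nat list \<Rightarrow> nat list list \<Rightarrow> prep list option" where
  "mk_preps us [] = Some []"
| "mk_preps us (xs # xss) = cons_opt (mk_prep us xs) (mk_preps us xss)"

fun singleton_if :: "(nat \<times> nat \<times> nat) option \<Rightarrow> (nat \<times> nat \<times> nat) option \<Rightarrow> prep \<Rightarrow> prep list option" where
  "singleton_if None None p = Some [p]"
| "singleton_if (Some i) b p = Some []"
| "singleton_if None (Some i) p = Some []"

text \<open>If raising uses up the index, the coefficient of \<open>P_{y,z}\<close> is nonzero only
  for \<open>z\<close> equal to the raised \<open>y\<close>, which is then the sole candidate
  provided it has the prescribed descents. Otherwise the interval from the raised \<open>y\<close>
  to \<open>u\<close> is searched.\<close>

fun desc_cands1 :: "bool list \<Rightarrow> bool list \<Rightarrow> nat list \<Rightarrow> nat list \<times> nat list \<times> int \<times> nat \<Rightarrow> prep list option" where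
  "desc_cands1 A B us (ys, yi, yl, 0) = singleton_if (find_ascent A yi 0) (find_ascent B ys 0) (ys, yi, yl)"
| "desc_cands1 A B us (ys, yi, yl, Suc m) = mk_preps us (interval_list A B ys us)"

fun desc_cands :: "bool list \<Rightarrow> bool list \<Rightarrow> nat list \<Rightarrow> nat \<Rightarrow> prep \<Rightarrow> prep list option" where
  "desc_cands A B us m (ys, yi, yl) = desc_cands1 A B us (raise A B m ys yi yl)"

fun is_desc :: "(nat \<times> nat) option \<Rightarrow> bool" where
  "is_desc None = False"
| "is_desc (Some (a, b)) = (b < a)"

fun keep1 :: "nat list \<Rightarrow> nat list \<times> nat list \<times> int \<times> nat \<Rightarrow> bool" where
  "keep1 xs (ys, yi, yl, 0) = list_eq ys xs"
| "keep1 xs (ys, yi, yl, Suc m) = True"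

text \<open>Discards candidates whose term vanishes for cheap reasons: wrong parity, or raising
  \<open>y\<close> by the descents of \<open>z\<close> ends at index 0 away from \<open>z\<close>.
  The test for the descent \<open>s\<close> ensures that no element outside the range of summation
  is subtracted with a nonzero value.\<close>

fun keep :: "nat \<Rightarrow> nat \<Rightarrow> prep \<Rightarrow> int \<Rightarrow> prep \<Rightarrow> bool" where
  "keep s m (ys, yi, yl) ul (xs, xi, xl) =
     (if even (ul + xl) then False else if is_desc (at_pair s 0 xi)
      then keep1 xs (raise (descents xi) (descents xs) m ys yi yl) else False)"

fun cons_if :: "bool \<Rightarrow> 'a \<Rightarrow> 'a list \<Rightarrow> 'a list" where
  "cons_if True x xs = x # xs"
| "cons_if False x xs = xs"

fun keep_all :: "nat \<Rightarrow> nat \<Rightarrow> prep \<Rightarrow> int \<Rightarrow> prep list \<Rightarrow> prep list" where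
  "keep_all s m y ul [] = []"
| "keep_all s m y ul (x # xs) = cons_if (keep s m y ul x) x (keep_all s m y ul xs)"

fun node3 :: "nat \<Rightarrow> nat \<Rightarrow> prep \<Rightarrow> prep \<Rightarrow> prep \<Rightarrow> prep list \<Rightarrow> prep list option \<Rightarrow> (prep \<times> prep \<times> prep list) option" where
  "node3 s m sy y (us, ui, ul) ts (Some ds) = Some (sy, (us, ui, ul), keep_all s m y ul (rev_append ts ds))"
| "node3 s m sy y u ts None = None"

text \<open>The flag for \<open>s\<close> is added to the left descents of \<open>u\<close>, since
  only \<open>z\<close> with \<open>s z < z\<close> enter the sum.\<close>

fun node2 :: "nat \<Rightarrow> nat \<Rightarrow> prep \<Rightarrow> prep \<Rightarrow> prep \<Rightarrow> (prep \<times> prep \<times> prep list) option" where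
  "node2 s m sy y (us, ui, ul) = node3 s m sy y (us, ui, ul) (left_cands s 0 ui us ui ul [])
     (desc_cands (set_flag s 0 (descents ui)) (descents us) us m y)"

fun node1 :: "(nat \<times> nat) option \<Rightarrow> (nat \<times> nat) option \<Rightarrow> nat \<Rightarrow> nat \<Rightarrow> prep \<Rightarrow> prep \<Rightarrow> (prep \<times> prep \<times> prep list) option" where
  "node1 (Some (a, b)) (Some (c, d)) s m (ys, yi, yl) (ws, wi, wl) =
     (if b < a then if d < c then
        node2 s m (swap_vals s (s + 1) ys, swap_vals a b yi, yl - 1) (ys, yi, yl)
          (swap_vals s (s + 1) ws, swap_vals c d wi, wl - 1)
      else None else None)"
| "node1 None p s m y w = None"
| "node1 (Some p) None s m y w = None"

fun node :: "nat \<Rightarrow> nat \<Rightarrow> prep \<Rightarrow> prep \<Rightarrow> (prep \<times> prep \<times> prep list) option" where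
  "node s m (ys, yi, yl) (ws, wi, wl) = node1 (at_pair s 0 yi) (at_pair s 0 wi) s m (ys, yi, yl) (ws, wi, wl)"

section \<open>Tests at the leaves and assembly of values\<close>

fun skip :: "nat \<Rightarrow> int \<Rightarrow> int \<Rightarrow> bool" where
  "skip 0 yl wl = (if wl < yl then True else odd (wl + yl))"
| "skip (Suc m) yl wl = skip m (yl + 1) wl"

text \<open>The counter \<open>d\<close> is the surplus of \<open>w\<close> over \<open>y\<close>
  among the entries read so far that reach \<open>r\<close>; the condition fails once
  \<open>y\<close> overtakes.\<close>

fun rank_fails :: "nat \<Rightarrow> nat list \<Rightarrow> nat list \<Rightarrow> nat \<Rightarrow> bool"
  and rank_fails1 :: "bool \<Rightarrow> bool \<Rightarrow> nat \<Rightarrow> nat list \<Rightarrow> nat list \<Rightarrow> nat \<Rightarrow> bool" where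
  "rank_fails r (y # ys) (w # ws) d = rank_fails1 (r \<le> y) (r \<le> w) r ys ws d"
| "rank_fails r [] ws d = False"
| "rank_fails r (y # ys) [] d = False"
| "rank_fails1 True True r ys ws d = rank_fails r ys ws d"
| "rank_fails1 False False r ys ws d = rank_fails r ys ws d"
| "rank_fails1 False True r ys ws d = rank_fails r ys ws (Suc d)"
| "rank_fails1 True False r ys ws (Suc d) = rank_fails r ys ws d"
| "rank_fails1 True False r ys ws 0 = True"

fun rank_zero :: "nat \<Rightarrow> prep \<Rightarrow> prep \<Rightarrow> int option" where
  "rank_zero r (ys, yi, yl) (ws, wi, wl) = (if rank_fails r ys ws 0 then Some 0 else None)"

fun delta :: "bool \<Rightarrow> int option" where
  "delta True = Some 1"
| "delta False = Some 0"

fun require_zero :: "int option \<Rightarrow> (nat list \<times> int) list option \<Rightarrow> (nat list \<times> int) list option" where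
  "require_zero (Some v) l = (if v = 0 then l else None)"
| "require_zero None l = None"

fun cons_prod :: "prep \<Rightarrow> int option \<Rightarrow> int option \<Rightarrow> (nat list \<times> int) list option \<Rightarrow> (nat list \<times> int) list option" where
  "cons_prod (xs, xi, xl) (Some a) (Some b) (Some l) = Some ((xs, a * b) # l)"
| "cons_prod x None b l = None"
| "cons_prod x (Some a) None l = None"
| "cons_prod x (Some a) (Some b) None = None"

fun fresh :: "nat list \<Rightarrow> (nat list \<times> int) list \<Rightarrow> bool" where
  "fresh xs [] = True"
| "fresh xs ((ys, b) # l) = (if list_eq xs ys then False else fresh xs l)"

text \<open>A candidate listed twice would be subtracted twice, so \<open>combine\<close> refuses
  repeated one-line notations.\<close>

fun all_fresh :: "(nat list \<times> int) list \<Rightarrow> bool" where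
  "all_fresh [] = True"
| "all_fresh ((xs, a) # l) = (if fresh xs l then all_fresh l else False)"

fun sub_all :: "int \<Rightarrow> (nat list \<times> int) list \<Rightarrow> int" where
  "sub_all v [] = v"
| "sub_all v ((xs, a) # l) = sub_all (v - a) l"

fun combine :: "int option \<Rightarrow> int option \<Rightarrow> (nat list \<times> int) list option \<Rightarrow> int option" where
  "combine (Some a) (Some b) (Some l) = (if all_fresh l then Some (sub_all (a + b) l) else None)"
| "combine None b l = None"
| "combine (Some a) None l = None"
| "combine (Some a) (Some b) None = None"

text \<open>
  \<open>CN s c1 c2 zs\<close> applies the recursion for the simple reflection \<open>s\<close>; \<open>c1\<close> and \<open>c2\<close> certify the two main
  terms and \<open>zs\<close> has one entry for every correction candidate \<open>z\<close>, in the order of enumeration: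
  \<open>ZM\<close> shows \<open>\<mu>(z,u) = 0\<close>, \<open>ZH\<close> shows that the coefficient of \<open>P\<^bsub>y,z\<^esub>\<close> vanishes, and \<open>ZB\<close> computes both.
  \<open>CI\<close> passes to inverses, \<open>CR r\<close> refutes \<open>y \<le> w\<close> by the rank condition for the threshold \<open>r\<close>, and \<open>CZ\<close>
  is a leaf at which raising \<open>y\<close>, the length or the parity decides.
\<close>

datatype cert = CZ | CR nat | CI cert | CN nat cert cert "zcert list"
  and zcert = ZM cert | ZH cert | ZB cert cert

function ev :: "cert \<Rightarrow> nat \<Rightarrow> prep \<Rightarrow> prep \<Rightarrow> int option"
  and ev1 :: "cert \<Rightarrow> prep \<Rightarrow> nat list \<times> nat list \<times> int \<times> nat \<Rightarrow> int option"
  and ev2 :: "bool \<Rightarrow> cert \<Rightarrow> nat \<Rightarrow> prep \<Rightarrow> prep \<Rightarrow> int option"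
  and ev3 :: "(prep \<times> prep \<times> prep list) option \<Rightarrow> nat \<Rightarrow> prep \<Rightarrow> cert \<Rightarrow> cert \<Rightarrow> zcert list \<Rightarrow> int option"
  and evz :: "zcert list \<Rightarrow> prep list \<Rightarrow> nat \<Rightarrow> prep \<Rightarrow> prep \<Rightarrow> (nat list \<times> int) list option"
  where
  "ev c m (ys, yi, yl) (ws, wi, wl) = ev1 c (ws, wi, wl) (raise (descents wi) (descents ws) m ys yi yl)"
| "ev1 c (ws, wi, wl) (ys, yi, yl, 0) = delta (list_eq ys ws)"
| "ev1 c (ws, wi, wl) (ys, yi, yl, Suc m) = ev2 (skip (Suc m) yl wl) c (Suc m) (ys, yi, yl) (ws, wi, wl)"
| "ev2 True c m y w = Some 0"
| "ev2 False CZ m y w = None"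
| "ev2 False (CR r) m y w = rank_zero r y w"
| "ev2 False (CI c) m y w = ev c m (flip y) (flip w)"
| "ev2 False (CN s c1 c2 zs) m y w = ev3 (node s m y w) m y c1 c2 zs"
| "ev3 None m y c1 c2 zs = None"
| "ev3 (Some (sy, u, xs)) m y c1 c2 zs = combine (ev c1 m sy u) (ev c2 (Suc m) y u) (evz zs xs m y u)"
| "evz [] [] m y u = Some []"
| "evz [] (x # xs) m y u = None"
| "evz (z # zs) [] m y u = None"
| "evz (ZM c # zs) (x # xs) m y u = require_zero (ev c (Suc 0) x u) (evz zs xs m y u)"
| "evz (ZH c # zs) (x # xs) m y u = require_zero (ev c m y x) (evz zs xs m y u)"
| "evz (ZB c d # zs) (x # xs) m y u = cons_prod x (ev c (Suc 0) x u) (ev d m y x) (evz zs xs m y u)"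
  by pat_completeness auto
termination
  \<comment> \<open>Passing from \<open>ev3\<close> to a component may keep the certificate size,
    since leaves have size 0; the second measure orders the functions within such a round.\<close>
  by (relation "measures [\<lambda>t. case t of Inl (Inl (c, _)) \<Rightarrow> size c
      | Inl (Inr (c, _)) \<Rightarrow> size c
      | Inr (Inl (_, c, _)) \<Rightarrow> size c
      | Inr (Inr (Inl (_, _, _, c1, c2, zs))) \<Rightarrow> size c1 + size c2 + size_list size zs
      | Inr (Inr (Inr (zs, _))) \<Rightarrow> size_list size zs,
     \<lambda>t. case t of Inl (Inl _) \<Rightarrow> 3 | Inl (Inr _) \<Rightarrow> 2 | Inr (Inl _) \<Rightarrow> 1 | Inr (Inr (Inl _)) \<Rightarrow> 4 | Inr (Inr (Inr _)) \<Rightarrow> 3]") auto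

section \<open>Soundness of the evaluator\<close>

lemma prep_unique: "prep n p w \<Longrightarrow> prep n p w' \<Longrightarrow> w = w'"
  by (cases p) (metis prep_simp perm_rep_eq_iff)

lemma length_filter_eq_rank: "p \<le> n \<Longrightarrow> length (filter ((\<le>) r) (take p (map w [0..<n]))) = rank r p w"
proof (induction p)
  case (Suc p)
  then have "take (Suc p) (map w [0..<n]) = take p (map w [0..<n]) @ [w p]"
    by (simp add: take_Suc_conv_app_nth)
  then show ?case using Suc by (simp add: rank_Suc)
qed simp

lemma rank_fails_sound:
  "rank_fails r ys ws d \<Longrightarrow> \<exists>p. p \<le> length ys \<and> p \<le> length ws \<and>
     length (filter ((\<le>) r) (take p ws)) + d < length (filter ((\<le>) r) (take p ys))"
  "rank_fails1 a b r ys ws d \<Longrightarrow> \<exists>p. p \<le> length ys \<and> p \<le> length ws \<and>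
     of_bool b + length (filter ((\<le>) r) (take p ws)) + d < of_bool a + length (filter ((\<le>) r) (take p ys))"
proof (induction r ys ws d and a b r ys ws d rule: rank_fails_rank_fails1.induct)
  case (1 r y ys w ws d)
  then obtain p where "p \<le> length ys" "p \<le> length ws"
     "of_bool (r \<le> w) + length (filter ((\<le>) r) (take p ws)) + d < of_bool (r \<le> y) + length (filter ((\<le>) r) (take p ys))"
    by auto
  then show ?case by (intro exI[of _ "Suc p"]) auto
qed auto

lemma rank_zero_sound:
  assumes "rank_zero r y w = Some v" "prep n y fy" "prep n w fw"
  shows "kl_coeff n fy fw m = v"
proof -
  obtain ys yi yl ws wi wl where yw: "y = (ys, yi, yl)" "w = (ws, wi, wl)" by (cases y; cases w)
  have rep: "perm_rep n ys yi yl fy" "perm_rep n ws wi wl fw" using assms(2,3) by (simp_all add: yw)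
  have v: "v = 0" and "rank_fails r ys ws 0" using assms(1) by (auto simp: yw split: if_splits)
  from rank_fails_sound(1)[OF this(2)] obtain p where p: "p \<le> length ys" 
    "length (filter ((\<le>) r) (take p ws)) < length (filter ((\<le>) r) (take p ys))" by auto
  have "p \<le> n" using p(1) perm_rep_length[OF rep(1)] by simp
  then have "rank r p fw < rank r p fy"
    using p(2) rep length_filter_eq_rank unfolding perm_rep_def by metis
  then show ?thesis
    using kl_coeff_rank[OF perm_rep_symgrp[OF rep(2)], of fy m r p] v by (meson not_le)
qed

lemma skip_iff: "skip m yl wl \<longleftrightarrow> wl < yl + int m \<or> odd (wl + yl + int m)"
  by (induction m arbitrary: yl) (auto simp: algebra_simps)

lemma skip_sound:
  assumes "skip m yl wl" "perm_rep n ys yi yl y" "perm_rep n ws wi wl w"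
  shows "kl_coeff n y w m = 0"
proof (cases rule: kl_coeff_cases[of n w y m])
  case (even k)
  then have "wl = yl + int m + 2 * int k" using assms(2,3) unfolding perm_rep_def by linarith
  then show ?thesis using assms(1) by (simp add: skip_iff)
qed

subsection \<open>Candidates for the correction terms\<close>

text \<open>Raising \<open>z\<close> by the descent \<open>t\<close> turns index 1 into index 0,
  which forces \<open>t z = u\<close>. If \<open>t\<close> were not adjacent to \<open>s\<close>,
  multiplying by \<open>t\<close> would leave the positions of the values \<open>s\<close> and
  \<open>s + 1\<close> alone, and \<open>u\<close> would share the descent \<open>s\<close> of
  \<open>z\<close>.\<close>

lemma mu_left_neighbour:
  assumes u: "u \<in> symgrp n" "\<not> ldesc u s" and z: "z \<in> symgrp n" "ldesc z s"
    and mu: "kl_coeff n z u 1 \<noteq> 0" and t: "Suc t < n" "ldesc u t" "\<not> ldesc z t"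
  shows "z = simple_refl t \<circ> u \<and> adjacent s t"
proof
  have "kl_coeff n (simple_refl t \<circ> z) u 0 \<noteq> 0"
    using kl_coeff_raise[OF u(1) z(1) t(1-3), of 0] mu by simp
  then have "simple_refl t \<circ> z = u" using kl_coeff_zero_index[OF u(1), of "simple_refl t \<circ> z"] by metis
  then show zu: "z = simple_refl t \<circ> u" using simple_refl_comp_self by metis
  show "adjacent s t"
  proof (rule ccontr)
    assume na: "\<not> adjacent s t"
    have "t \<noteq> s" using t u by auto
    then have "simple_refl t s = s" "simple_refl t (Suc s) = Suc s"
      using na by (auto simp: simple_refl_def transpose_def split: if_splits)
    moreover have "pinv z x = pinv u (simple_refl t x)" for x
      using inv_simple_left[OF u(1), of t] zu by (metis comp_apply)
    ultimately show False using z(2) u(2) by (simp add: ldesc_def)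
  qed
qed

text \<open>As on the left, a missing descent forces \<open>z = u s_i\<close>. Then \<open>s\<close>
  can be a descent of \<open>z\<close> but not of \<open>u\<close> only if the values
  \<open>s + 1\<close> and \<open>s\<close> occupy positions \<open>i\<close> and
  \<open>i + 1\<close> of \<open>z\<close>, which makes \<open>i\<close> a right descent of
  \<open>z\<close> after all. So the right side has no exceptional neighbours.\<close>

lemma mu_right_descents:
  assumes u: "u \<in> symgrp n" "\<not> ldesc u s" and z: "z \<in> symgrp n" "ldesc z s"
    and mu: "kl_coeff n z u 1 \<noteq> 0" and i: "Suc i < n" "u (Suc i) < u i"
  shows "z (Suc i) < z i"
proof (rule ccontr)
  assume nd: "\<not> z (Suc i) < z i"
  have "kl_coeff n (z \<circ> simple_refl i) u 0 \<noteq> 0"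
    using kl_coeff_raise_right[OF u(1) z(1) i nd, of 0] mu by simp
  then have zu: "z \<circ> simple_refl i = u" using kl_coeff_zero_index[OF u(1), of "z \<circ> simple_refl i"] by metis
  have "pinv u x = simple_refl i (pinv z x)" for x
    using inv_simple_right[OF z(1), of i] zu by (metis comp_apply)
  moreover define p where "p = pinv z s"
  moreover define q where "q = pinv z (Suc s)"
  moreover have "z p = s" "z q = Suc s" using z(1) by (simp_all add: p_def q_def)
  ultimately show False
    using z(2) u(2) nd unfolding ldesc_def
    by (auto simp: simple_refl_def transpose_def split: if_splits)
qed

lemma set_left_cands:
  "x \<in> set (left_cands s k xs us ui ul acc) \<longleftrightarrow> x \<in> set acc \<or>
     (\<exists>j. Suc j < length xs \<and> xs ! Suc j < xs ! j \<and> adjacent s (k + j) \<and>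
        x = (swap_vals (k + j) (k + j + 1) us, swap_vals (xs ! j) (xs ! Suc j) ui, ul - 1))"
proof (induction s k xs us ui ul acc rule: left_cands.induct)
  case (1 s k a b xs us ui ul acc)
  have ex: "(\<exists>j. P j) \<longleftrightarrow> P 0 \<or> (\<exists>j. P (Suc j))" for P :: "nat \<Rightarrow> bool" by (metis not0_implies_Suc)
  show ?case
    unfolding left_cands.simps 1 by (subst (2) ex) auto
qed auto

lemma mk_preps_sound:
  "mk_preps us xss = Some ps \<Longrightarrow> (\<forall>p\<in>set ps. \<exists>z. prep (length us) p z) \<and>
     (\<forall>xs\<in>set xss. \<exists>p\<in>set ps. prep (length us) p (one_line xs))"
proof (induction xss arbitrary: ps)
  case (Cons xs xss)
  then obtain p qs where "mk_prep us xs = Some p" "mk_preps us xss = Some qs" "ps = p # qs"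
    by (auto simp: cons_opt_Some)
  then show ?case using Cons.IH[of qs] mk_prep_sound(1)[of us xs p] by auto
qed auto

lemma find_ascent_has_descents:
  assumes "has_descents n A B z" "perm_rep n zs zi zl z"
  shows "find_ascent A zi 0 = None" "find_ascent B zs 0 = None"
proof -
  have len: "length zs = n" "length zi = n" using perm_rep_length[OF assms(2)] by auto
  show "find_ascent A zi 0 = None"
  proof (rule ccontr)
    assume "find_ascent A zi 0 \<noteq> None"
    then obtain i a b where "find_ascent A zi 0 = Some (i, a, b)" by auto
    from find_ascent_Some[OF this] have i: "i < length A" "A ! i" "Suc i < n" "zi ! i < zi ! Suc i"
      using len by auto
    then show False using assms perm_rep_nth[OF assms(2)] by (auto simp: has_descents_def ldesc_def)
  qed
  show "find_ascent B zs 0 = None"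
  proof (rule ccontr)
    assume "find_ascent B zs 0 \<noteq> None"
    then obtain i a b where "find_ascent B zs 0 = Some (i, a, b)" by auto
    from find_ascent_Some[OF this] have i: "i < length B" "B ! i" "Suc i < n" "zs ! i < zs ! Suc i"
      using len by auto
    then show False using assms perm_rep_nth[OF assms(2)] by (auto simp: has_descents_def)
  qed
qed

text \<open>For all \<open>z\<close> with the prescribed descents the coefficients at
  \<open>y\<close> and at the raised \<open>y'\<close> agree, so a relevant \<open>z\<close> must
  dominate \<open>y'\<close> itself. The search therefore starts from \<open>y'\<close>, which
  shrinks the interval.\<close>

lemma desc_cands_sound:
  assumes ds: "desc_cands A B us m y = Some ds" and y: "prep n y fy"
    and us: "us = map u [0..<n]" and len: "length A = n - 1" "length B = n - 1"
  shows "\<forall>x\<in>set ds. \<exists>z. prep n x z"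
    and "has_descents n A B z \<Longrightarrow> kl_coeff n fy z m \<noteq> 0 \<Longrightarrow> (\<And>r p. rank r p z \<le> rank r p u) \<Longrightarrow> \<exists>x\<in>set ds. prep n x z"
proof -
  obtain ys yi yl where yy: "y = (ys, yi, yl)" by (cases y)
  have rep: "perm_rep n ys yi yl fy" using y by (simp add: yy)
  obtain ys' yi' yl' m' where r: "raise A B m ys yi yl = (ys', yi', yl', m')" by (cases "raise A B m ys yi yl")
  obtain y' where y': "perm_rep n ys' yi' yl' y'"
      "\<forall>w. has_descents n A B w \<longrightarrow> kl_coeff n fy w m = kl_coeff n y' w m'"
    using raise_sound[OF rep r len] by blast
  have ds1: "desc_cands1 A B us (ys', yi', yl', m') = Some ds" using ds by (simp add: yy r)
  have lus: "length us = n" by (simp add: us)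
  show "\<forall>x\<in>set ds. \<exists>z. prep n x z"
  proof (cases m')
    case 0
    then show ?thesis using ds1 y'(1)
      by (cases "find_ascent A yi' 0"; cases "find_ascent B ys' 0") auto
  next
    case (Suc k)
    then show ?thesis using ds1 mk_preps_sound[of us _ ds] lus by simp
  qed
  show "\<exists>x\<in>set ds. prep n x z"
    if z: "has_descents n A B z" and k: "kl_coeff n fy z m \<noteq> 0" and rz: "\<And>r p. rank r p z \<le> rank r p u"
  proof -
    have zs: "z \<in> symgrp n" using z by (simp add: has_descents_def)
    have k': "kl_coeff n y' z m' \<noteq> 0" using y'(2) z k by simp
    show ?thesis
    proof (cases m')
      case 0
      then have "y' = z" using k' kl_coeff_zero_index[OF zs, of y'] by metis
      then have rz: "perm_rep n ys' yi' yl' z" using y'(1) by simp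
      then show ?thesis using ds1 find_ascent_has_descents[OF z rz] by (auto simp: 0)
    next
      case (Suc j)
      have "map z [0..<n] \<in> set (interval_list A B (map y' [0..<n]) (map u [0..<n]))"
        by (rule interval_list_sound[OF z len kl_coeff_rank[OF zs k'] rz])
      moreover have "ys' = map y' [0..<n]" using y'(1) by (simp add: perm_rep_def)
      ultimately have "map z [0..<n] \<in> set (interval_list A B ys' us)" by (simp only: us)
      moreover have "mk_preps us (interval_list A B ys' us) = Some ds" using ds1 by (simp add: Suc)
      ultimately obtain p where "p \<in> set ds" "prep (length us) p (one_line (map z [0..<n]))"
        using mk_preps_sound by blast
      then show ?thesis using lus one_line_map[OF zs] by metis
    qed
  qed
qed

lemma is_desc_at_pair:
  assumes "perm_rep n xs xi xl z"
  shows "is_desc (at_pair s 0 xi) \<longleftrightarrow> Suc s < n \<and> ldesc z s"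
proof
  assume a: "is_desc (at_pair s 0 xi)"
  then obtain a b where ab: "at_pair s 0 xi = Some (a, b)" by (cases "at_pair s 0 xi") auto
  then show "Suc s < n \<and> ldesc z s"
    using a at_pair_0[OF ab] perm_rep_length[OF assms] perm_rep_nth[OF assms] by (simp add: ldesc_def)
next
  assume a: "Suc s < n \<and> ldesc z s"
  then have "at_pair s 0 xi = Some (xi ! s, xi ! Suc s)"
    using at_pair_nth[of s xi 0] perm_rep_length[OF assms] by simp
  then show "is_desc (at_pair s 0 xi)" using a perm_rep_nth[OF assms] by (simp add: ldesc_def)
qed

lemma keep_ldesc: "keep s m y ul x \<Longrightarrow> prep n x z \<Longrightarrow> ldesc z s"
  by (cases x; cases y) (auto simp: is_desc_at_pair split: if_splits)

lemma keep_complete: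
  assumes y: "prep n y fy" and x: "prep n x z" and k: "kl_coeff n fy z m \<noteq> 0"
    and s: "Suc s < n" "ldesc z s" and odd: "odd (ul + int (perm_length n z))"
  shows "keep s m y ul x"
proof -
  obtain ys yi yl xs xi xl where yx: "y = (ys, yi, yl)" "x = (xs, xi, xl)" by (cases y; cases x)
  have ry: "perm_rep n ys yi yl fy" and rx: "perm_rep n xs xi xl z" using y x by (simp_all add: yx)
  let ?A = "descents xi" and ?B = "descents xs"
  obtain ys' yi' yl' m' where r: "raise ?A ?B m ys yi yl = (ys', yi', yl', m')" by (cases "raise ?A ?B m ys yi yl")
  have len: "length ?A = n - 1" "length ?B = n - 1" using perm_rep_length[OF rx] by auto
  obtain y' where y': "perm_rep n ys' yi' yl' y'" "kl_coeff n fy z m = kl_coeff n y' z m'"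
    using raise_sound[OF ry r len] has_descents_self[OF rx] by blast
  have "keep1 xs (ys', yi', yl', m')"
  proof (cases m')
    case 0
    then have "y' = z" using k y'(2) kl_coeff_zero_index[OF perm_rep_symgrp[OF rx], of y'] by metis
    then show ?thesis using perm_rep_eq_iff[OF y'(1) rx] 0 by (simp add: list_eq_iff)
  qed simp
  moreover have "xl = int (perm_length n z)" using rx by (simp add: perm_rep_def)
  ultimately show ?thesis using odd s is_desc_at_pair[OF rx] by (simp add: yx r)
qed

lemma set_keep_all: "set (keep_all s m y ul xs) = {x \<in> set xs. keep s m y ul x}"
proof (induction xs)
  case (Cons x xs)
  then show ?case by (cases "keep s m y ul x") auto
qed simp

lemma node_sound:
  assumes nd: "node s m y w = Some (sy, u, xs)" and y: "prep n y fy" and w: "prep n w fw"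
  shows "Suc s < n" "ldesc fw s" "ldesc fy s" "prep n sy (simple_refl s \<circ> fy)" "prep n u (simple_refl s \<circ> fw)"
    "\<forall>x\<in>set xs. \<exists>z. prep n x z \<and> ldesc z s"
    "\<forall>z\<in>kl_corr n s (simple_refl s \<circ> fw). kl_coeff n z (simple_refl s \<circ> fw) 1 * kl_coeff n fy z m \<noteq> 0 \<longrightarrow>
       (\<exists>x\<in>set xs. prep n x z)"
proof -
  obtain ys yi yl ws wi wl where yw: "y = (ys, yi, yl)" "w = (ws, wi, wl)" by (cases y; cases w)
  have ry: "perm_rep n ys yi yl fy" and rw: "perm_rep n ws wi wl fw" using y w by (simp_all add: yw)
  obtain a b where ab: "at_pair s 0 yi = Some (a, b)"
    using nd by (cases "at_pair s 0 yi") (auto simp: yw)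
  obtain c d where cd: "at_pair s 0 wi = Some (c, d)"
    using nd ab by (cases "at_pair s 0 wi") (auto simp: yw)
  have lt: "b < a" "d < c" using nd by (auto simp: yw ab cd split: if_splits)
  show s: "Suc s < n" using at_pair_0(1)[OF cd] perm_rep_length[OF rw] by simp
  have abcd: "a = yi ! s" "b = yi ! Suc s" "c = wi ! s" "d = wi ! Suc s"
    using at_pair_0[OF ab] at_pair_0[OF cd] by auto
  show dw: "ldesc fw s" and dy: "ldesc fy s"
    using lt s perm_rep_nth[OF rw] perm_rep_nth[OF ry] by (simp_all add: abcd ldesc_def)
  define fu where "fu = simple_refl s \<circ> fw"
  define us where "us = swap_vals s (s + 1) ws"
  define ui where "ui = swap_vals c d wi"
  define ul where "ul = wl - 1"
  let ?A = "set_flag s 0 (descents ui)" and ?B = "descents us"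
  have n2: "node2 s m (swap_vals s (s + 1) ys, swap_vals a b yi, yl - 1) y (us, ui, ul) = Some (sy, u, xs)"
    using nd lt by (simp only: yw node.simps ab cd node1.simps if_True us_def ui_def ul_def)
  obtain ds where ds: "desc_cands ?A ?B us m y = Some ds"
    using n2 by (cases "desc_cands ?A ?B us m y") (simp_all only: node2.simps node3.simps option.distinct)
  define ts where "ts = left_cands s 0 ui us ui ul []"
  have "Some ((swap_vals s (s + 1) ys, swap_vals a b yi, yl - 1), (us, ui, ul), keep_all s m y ul (rev_append ts ds))
     = Some (sy, u, xs)"
    using n2 by (simp only: node2.simps node3.simps ds ts_def)
  then have eqs: "sy = (swap_vals s (s + 1) ys, swap_vals a b yi, yl - 1)" "u = (us, ui, ul)"
      "xs = keep_all s m y ul (rev_append ts ds)"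
    by blast+
  show "prep n sy (simple_refl s \<circ> fy)"
    using perm_rep_left[OF ry s] dy by (simp only: eqs(1) abcd prep_simp if_True)
  have ru: "perm_rep n us ui ul fu"
    using perm_rep_left[OF rw s] dw by (simp only: us_def ui_def ul_def fu_def abcd if_True)
  then show "prep n u (simple_refl s \<circ> fw)" by (simp only: eqs(2) prep_simp fu_def)
  have us_map: "us = map fu [0..<n]" using ru by (simp add: perm_rep_def)
  have lui: "length ui = n" "length us = n" using perm_rep_length[OF ru] by auto
  have fus: "fu \<in> symgrp n" by (rule perm_rep_symgrp[OF ru])
  have lenA: "length ?A = n - 1" "length ?B = n - 1" using lui by auto
  have T: "\<exists>z. prep n x z" if "x \<in> set ts" for x
  proof -
    from that obtain j where j: "Suc j < n" "ui ! Suc j < ui ! j"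
      "x = (swap_vals j (j + 1) us, swap_vals (ui ! j) (ui ! Suc j) ui, ul - 1)"
      using lui by (auto simp: ts_def set_left_cands)
    have "ldesc fu j" using j perm_rep_nth[OF ru] by (simp add: ldesc_def)
    then have "prep n x (simple_refl j \<circ> fu)" using perm_rep_left[OF ru j(1)] by (simp only: j(3) prep_simp if_True)
    then show ?thesis by blast
  qed
  have sxs: "set xs = {x \<in> set ts \<union> set ds. keep s m y ul x}"
    by (simp add: eqs(3) set_keep_all rev_append_eq)
  show "\<forall>x\<in>set xs. \<exists>z. prep n x z \<and> ldesc z s"
    using T desc_cands_sound(1)[OF ds y us_map lenA] keep_ldesc unfolding sxs by blast
  show "\<forall>z\<in>kl_corr n s (simple_refl s \<circ> fw). kl_coeff n z (simple_refl s \<circ> fw) 1 * kl_coeff n fy z m \<noteq> 0 \<longrightarrow>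
       (\<exists>x\<in>set xs. prep n x z)"
    unfolding fu_def [symmetric]
  proof (intro ballI impI)
    fix z assume zc: "z \<in> kl_corr n s fu" and nz: "kl_coeff n z fu 1 * kl_coeff n fy z m \<noteq> 0"
    have z: "z \<in> symgrp n" "ldesc z s" and mu0: "kl_mu n z fu \<noteq> 0" using zc by (auto simp: kl_corr_def)
    have mu: "kl_coeff n z fu 1 \<noteq> 0" and h: "kl_coeff n fy z m \<noteq> 0" using nz by auto
    have odd: "odd (ul + int (perm_length n z))"
    proof -
      have "odd (perm_length n fu - perm_length n z)" "perm_length n z < perm_length n fu"
        using mu0 by (auto simp: kl_mu_def split: if_splits)
      then have "odd (perm_length n fu + perm_length n z)" by presburger
      moreover have "ul = int (perm_length n fu)" using ru by (simp add: perm_rep_def)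
      ultimately show ?thesis by presburger
    qed
    have nu: "\<not> ldesc fu s" using ldesc_left[OF perm_rep_symgrp[OF rw], of s] dw unfolding fu_def by blast
    \<comment> \<open>Either \<open>z\<close> lacks a left descent of \<open>u\<close> and is an
      exceptional neighbour, or it has all of them besides \<open>s\<close> and the right descents
      of \<open>u\<close>, and the search finds it.\<close>
    have "\<exists>x\<in>set ts \<union> set ds. prep n x z"
    proof (cases "\<exists>t. Suc t < n \<and> ldesc fu t \<and> \<not> ldesc z t")
      case True
      then obtain t where t: "Suc t < n" "ldesc fu t" "\<not> ldesc z t" by blast
      have zt: "z = simple_refl t \<circ> fu" "adjacent s t"
        using mu_left_neighbour[OF fus nu z mu t] by auto
      have "ui ! Suc t < ui ! t" using t perm_rep_nth[OF ru] by (simp add: ldesc_def)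
      then have "(swap_vals t (t + 1) us, swap_vals (ui ! t) (ui ! Suc t) ui, ul - 1) \<in> set ts"
        using t(1) zt(2) lui unfolding ts_def set_left_cands by (intro disjI2 exI[of _ t]) simp
      moreover have "prep n (swap_vals t (t + 1) us, swap_vals (ui ! t) (ui ! Suc t) ui, ul - 1) z"
        using perm_rep_left[OF ru t(1)] t(2) by (simp only: zt(1) prep_simp if_True)
      ultimately show ?thesis by blast
    next
      case False
      have "has_descents n ?A ?B z"
        unfolding has_descents_def
      proof (intro conjI allI impI z(1))
        fix i assume i: "Suc i < n" "i < length ?A" "?A ! i"
        then have "i = s \<or> ldesc fu i"
          using lui perm_rep_nth[OF ru] by (auto simp: nth_set_flag nth_descents ldesc_def)
        then show "ldesc z i" using z(2) False i(1) by blast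
      next
        fix i assume i: "Suc i < n" "i < length ?B" "?B ! i"
        then have "fu (Suc i) < fu i" using lui perm_rep_nth[OF ru] by (simp add: nth_descents)
        then show "z (Suc i) < z i" using mu_right_descents[OF fus nu z mu i(1)] by blast
      qed
      then show ?thesis
        using desc_cands_sound(2)[OF ds y us_map lenA _ h kl_coeff_rank[OF fus mu]] by blast
    qed
    then obtain x where x: "x \<in> set ts \<union> set ds" "prep n x z" by blast
    then have "keep s m y ul x" using keep_complete[OF y x(2) h s z(2) odd] by blast
    then show "\<exists>x\<in>set xs. prep n x z" using x unfolding sxs by blast
  qed
qed

subsection \<open>The main induction\<close>

text \<open>Entries are keyed by one-line notation. Vanishing terms may be absent or present, so one
  zero factor is enough to drop a candidate without computing the other.\<close>

definition terms_ok :: "nat \<Rightarrow> perm \<Rightarrow> perm \<Rightarrow> nat \<Rightarrow> prep list \<Rightarrow> (nat list \<times> int) list \<Rightarrow> bool" where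
  "terms_ok n y u m xs l \<longleftrightarrow>
     (\<forall>k a. (k, a) \<in> set l \<longrightarrow> (\<exists>x\<in>set xs. \<exists>z. prep n x z \<and> k = fst x \<and> a = kl_coeff n z u 1 * kl_coeff n y z m)) \<and>
     (\<forall>x\<in>set xs. \<forall>z. prep n x z \<longrightarrow> kl_coeff n z u 1 * kl_coeff n y z m \<noteq> 0 \<longrightarrow>
        (fst x, kl_coeff n z u 1 * kl_coeff n y z m) \<in> set l)"

lemma terms_okD:
  assumes "terms_ok n y u m xs l"
  shows "(k, a) \<in> set l \<Longrightarrow> \<exists>x\<in>set xs. \<exists>z. prep n x z \<and> k = fst x \<and> a = kl_coeff n z u 1 * kl_coeff n y z m"
    and "x \<in> set xs \<Longrightarrow> prep n x z \<Longrightarrow> kl_coeff n z u 1 * kl_coeff n y z m \<noteq> 0 \<Longrightarrow>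
      (fst x, kl_coeff n z u 1 * kl_coeff n y z m) \<in> set l"
  using assms unfolding terms_ok_def by blast+

lemma terms_ok_skip:
  assumes l: "terms_ok n y u m xs l" and z: "prep n x z" "kl_coeff n z u 1 * kl_coeff n y z m = 0"
  shows "terms_ok n y u m (x # xs) l"
  unfolding terms_ok_def
proof (intro conjI allI ballI impI)
  fix k a assume "(k, a) \<in> set l"
  from terms_okD(1)[OF l this]
  show "\<exists>x'\<in>set (x # xs). \<exists>z. prep n x' z \<and> k = fst x' \<and> a = kl_coeff n z u 1 * kl_coeff n y z m"
    by (meson list.set_intros(2))
next
  fix x' z' assume x': "x' \<in> set (x # xs)" "prep n x' z'" and nz: "kl_coeff n z' u 1 * kl_coeff n y z' m \<noteq> 0"
  have "x' \<noteq> x" using prep_unique[OF z(1)] x'(2) nz z(2) by blast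
  then show "(fst x', kl_coeff n z' u 1 * kl_coeff n y z' m) \<in> set l"
    using terms_okD(2)[OF l _ x'(2) nz] x'(1) by simp
qed

lemma terms_ok_cons:
  assumes l: "terms_ok n y u m xs l" and z: "prep n x z" "a = kl_coeff n z u 1 * kl_coeff n y z m"
  shows "terms_ok n y u m (x # xs) ((fst x, a) # l)"
  unfolding terms_ok_def
proof (intro conjI allI ballI impI)
  fix k b assume "(k, b) \<in> set ((fst x, a) # l)"
  then consider "k = fst x" "b = a" | "(k, b) \<in> set l" by auto
  then show "\<exists>x'\<in>set (x # xs). \<exists>z. prep n x' z \<and> k = fst x' \<and> b = kl_coeff n z u 1 * kl_coeff n y z m"
  proof cases
    case 1
    then show ?thesis using z by (intro bexI[of _ x] exI[of _ z] conjI) auto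
  next
    case 2
    from terms_okD(1)[OF l this] show ?thesis by (meson list.set_intros(2))
  qed
next
  fix x' z' assume x': "x' \<in> set (x # xs)" "prep n x' z'" and nz: "kl_coeff n z' u 1 * kl_coeff n y z' m \<noteq> 0"
  show "(fst x', kl_coeff n z' u 1 * kl_coeff n y z' m) \<in> set ((fst x, a) # l)"
  proof (cases "x' = x")
    case True
    then have "z' = z" using prep_unique[OF z(1)] x'(2) by blast
    then show ?thesis using z(2) True by simp
  next
    case False
    then show ?thesis using terms_okD(2)[OF l _ x'(2) nz] x'(1) by simp
  qed
qed

lemma fresh_iff: "fresh xs l \<longleftrightarrow> xs \<notin> fst ` set l"
  by (induction xs l rule: fresh.induct) (auto simp: list_eq_iff)

lemma all_fresh_iff: "all_fresh l \<longleftrightarrow> distinct (map fst l)"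
  by (induction l rule: all_fresh.induct) (auto simp: fresh_iff)

lemma sub_all_eq: "sub_all v l = v - sum_list (map snd l)"
  by (induction v l rule: sub_all.induct) auto

text \<open>Once zero terms are dropped on both sides, the distinct keys give a bijection between
  summands and list entries.\<close>

lemma sum_terms_ok:
  assumes l: "terms_ok n y u m xs l" "all_fresh l"
    and xs: "\<forall>x\<in>set xs. \<exists>z. prep n x z \<and> ldesc z s"
    and all: "\<forall>z\<in>kl_corr n s u. kl_coeff n z u 1 * kl_coeff n y z m \<noteq> 0 \<longrightarrow> (\<exists>x\<in>set xs. prep n x z)"
  shows "(\<Sum>z\<in>kl_corr n s u. kl_coeff n z u 1 * kl_coeff n y z m) = sum_list (map snd l)"
proof -
  let ?f = "\<lambda>z. kl_coeff n z u 1 * kl_coeff n y z m"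
  have dist: "distinct (map fst l)" using l(2) by (simp add: all_fresh_iff)
  have fin: "finite (kl_corr n s u)"
    by (rule finite_subset[of _ "symgrp n"]) (auto simp: kl_corr_def symgrp_def intro: finite_permutations)
  have ent: "\<exists>z\<in>symgrp n. ldesc z s \<and> k = map z [0..<n] \<and> a = ?f z" if "(k, a) \<in> set l" for k a
  proof -
    obtain x z where x: "x \<in> set xs" "prep n x z" "k = fst x" "a = ?f z"
      using terms_okD(1)[OF l(1) \<open>(k, a) \<in> set l\<close>] by blast
    moreover have "ldesc z s" using xs x prep_unique by metis
    moreover have "z \<in> symgrp n" "fst x = map z [0..<n]" using x(2) by (cases x; simp add: perm_rep_def)+
    ultimately show ?thesis by blast
  qed
  have "sum_list (map snd l) = (\<Sum>p\<in>set l. snd p)"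
    using dist by (simp add: distinct_map sum_list_distinct_conv_sum_set)
  also have "\<dots> = (\<Sum>p\<in>{p \<in> set l. snd p \<noteq> 0}. snd p)"
    by (rule sum.mono_neutral_right) auto
  also have "\<dots> = (\<Sum>z\<in>{z \<in> kl_corr n s u. ?f z \<noteq> 0}. ?f z)"
  proof (rule sum.reindex_bij_betw [symmetric, of "\<lambda>z. (map z [0..<n], ?f z)" _ _ snd, simplified snd_conv])
    show "bij_betw (\<lambda>z. (map z [0..<n], ?f z)) {z \<in> kl_corr n s u. ?f z \<noteq> 0} {p \<in> set l. snd p \<noteq> 0}"
      unfolding bij_betw_def
    proof
      show "inj_on (\<lambda>z. (map z [0..<n], ?f z)) {z \<in> kl_corr n s u. ?f z \<noteq> 0}"
      proof (rule inj_onI)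
        fix z z' assume "z \<in> {z \<in> kl_corr n s u. ?f z \<noteq> 0}" "z' \<in> {z \<in> kl_corr n s u. ?f z \<noteq> 0}"
          "(map z [0..<n], ?f z) = (map z' [0..<n], ?f z')"
        then have "map z [0..<n] = map z' [0..<n]" "z \<in> symgrp n" "z' \<in> symgrp n"
          unfolding kl_corr_def by blast+
        then show "z = z'" by (metis one_line_map)
      qed
      show "(\<lambda>z. (map z [0..<n], ?f z)) ` {z \<in> kl_corr n s u. ?f z \<noteq> 0} = {p \<in> set l. snd p \<noteq> 0}"
      proof (intro equalityI subsetI)
        fix p assume "p \<in> (\<lambda>z. (map z [0..<n], ?f z)) ` {z \<in> kl_corr n s u. ?f z \<noteq> 0}"
        then obtain z where z: "z \<in> kl_corr n s u" "?f z \<noteq> 0" "p = (map z [0..<n], ?f z)" by blast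
        then obtain x where x: "x \<in> set xs" "prep n x z" using all by blast
        have "(fst x, ?f z) \<in> set l" using x by (rule terms_okD(2)[OF l(1) _ _ z(2)])
        moreover have "fst x = map z [0..<n]" using x(2) by (cases x) (simp add: perm_rep_def)
        ultimately show "p \<in> {p \<in> set l. snd p \<noteq> 0}" using z by simp
      next
        fix p assume p: "p \<in> {p \<in> set l. snd p \<noteq> 0}"
        obtain k a where ka: "p = (k, a)" by (cases p)
        obtain z where z: "z \<in> symgrp n" "ldesc z s" "k = map z [0..<n]" "a = ?f z"
          using ent[of k a] p ka by auto
        have nz: "?f z \<noteq> 0" using p ka z by auto
        then have "kl_mu n z u \<noteq> 0" unfolding kl_mu_eq_kl_coeff by auto
        then have "z \<in> {z \<in> kl_corr n s u. ?f z \<noteq> 0}" using z nz by (simp add: kl_corr_def)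
        then show "p \<in> (\<lambda>z. (map z [0..<n], ?f z)) ` {z \<in> kl_corr n s u. ?f z \<noteq> 0}"
          unfolding ka z(3,4) by blast
      qed
    qed
  qed
  also have "\<dots> = (\<Sum>z\<in>kl_corr n s u. ?f z)"
    by (rule sum.mono_neutral_left[OF fin]) auto
  finally show ?thesis ..
qed

lemma combine_Some:
  "combine a b l = Some v \<Longrightarrow> \<exists>a' b' l'. a = Some a' \<and> b = Some b' \<and> l = Some l' \<and> all_fresh l' \<and> v = a' + b' - sum_list (map snd l')"
  by (cases a; cases b; cases l) (auto simp: sub_all_eq split: if_splits)

lemma require_zero_Some: "require_zero a l = Some v \<Longrightarrow> a = Some 0 \<and> l = Some v"
  by (cases a) (auto split: if_splits)

lemma cons_prod_Some:
  "cons_prod x a b l = Some v \<Longrightarrow> \<exists>a' b' l'. a = Some a' \<and> b = Some b' \<and> l = Some l' \<and> v = (fst x, a' * b') # l'"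
  by (cases x; cases a; cases b; cases l) auto

lemma prep_flip: "prep n p w \<Longrightarrow> prep n (flip p) (pinv w)"
  by (cases p) (simp add: perm_rep_inv)

text \<open>The auxiliary functions receive evaluated arguments, so their claims are conditional on
  what these stand for: in \<open>ev2\<close> a true flag must imply vanishing, in
  \<open>ev3\<close> the argument must be the outcome of \<open>node\<close>. Nothing is claimed
  about \<open>None\<close>.\<close>

lemma ev_sound_aux:
  "ev c m y w = Some v \<Longrightarrow> (\<forall>fy fw. prep n y fy \<longrightarrow> prep n w fw \<longrightarrow> kl_coeff n fy fw m = v)"
  "ev1 c w ym = Some v \<Longrightarrow> (\<forall>ys yi yl m fy fw. ym = (ys, yi, yl, m) \<longrightarrow> perm_rep n ys yi yl fy \<longrightarrow> prep n w fw \<longrightarrow>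
     kl_coeff n fy fw m = v)"
  "ev2 b c m y w = Some v \<Longrightarrow> (\<forall>fy fw. prep n y fy \<longrightarrow> prep n w fw \<longrightarrow> (b \<longrightarrow> kl_coeff n fy fw m = 0) \<longrightarrow> kl_coeff n fy fw m = v)"
  "ev3 t m y c1 c2 zs = Some v \<Longrightarrow> (\<forall>s w fy fw. t = node s m y w \<longrightarrow> prep n y fy \<longrightarrow> prep n w fw \<longrightarrow> kl_coeff n fy fw m = v)"
  "evz zs xs m y u = Some l \<Longrightarrow> (\<forall>fy fu. prep n y fy \<longrightarrow> prep n u fu \<longrightarrow> (\<forall>x\<in>set xs. \<exists>z. prep n x z) \<longrightarrow>
     terms_ok n fy fu m xs l)"
proof (induction c m y w and c w ym and b c m y w and t m y c1 c2 zs and zs xs m y u arbitrary: v and v and v and v and l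
    rule: ev_ev1_ev2_ev3_evz.induct)
  case (1 c m ys yi yl ws wi wl)
  show ?case
  proof (intro allI impI)
    fix fy fw assume y: "prep n (ys, yi, yl) fy" and w: "prep n (ws, wi, wl) fw"
    obtain ys' yi' yl' m' where r: "raise (descents wi) (descents ws) m ys yi yl = (ys', yi', yl', m')"
      by (cases "raise (descents wi) (descents ws) m ys yi yl")
    have rw: "perm_rep n ws wi wl fw" and ry: "perm_rep n ys yi yl fy" using w y by simp_all
    have len: "length (descents wi) = n - 1" "length (descents ws) = n - 1" using perm_rep_length[OF rw] by auto
    obtain y' where y': "perm_rep n ys' yi' yl' y'" "kl_coeff n fy fw m = kl_coeff n y' fw m'"
      using raise_sound[OF ry r len] has_descents_self[OF rw] by blast
    have e: "ev1 c (ws, wi, wl) (raise (descents wi) (descents ws) m ys yi yl) = Some v"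
      using "1.prems" by (simp only: ev.simps)
    have "kl_coeff n y' fw m' = v" using "1.IH"[OF e] r y'(1) w by blast
    then show "kl_coeff n fy fw m = v" using y'(2) by simp
  qed
next
  case (2 c ws wi wl ys yi yl)
  show ?case
  proof (intro allI impI)
    fix ys1 yi1 yl1 and m :: nat and fy fw
    assume eq: "(ys, yi, yl, 0) = (ys1, yi1, yl1, m)" and y: "perm_rep n ys1 yi1 yl1 fy" and w: "prep n (ws, wi, wl) fw"
    have rw: "perm_rep n ws wi wl fw" using w by simp
    have "v = (if ys = ws then 1 else 0)" using 2 by (cases "ys = ws") (auto simp: list_eq_iff)
    then show "kl_coeff n fy fw m = v"
      using eq perm_rep_eq_iff[OF y rw] kl_coeff_zero_index[OF perm_rep_symgrp[OF rw], of fy] by auto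
  qed
next
  case (3 c ws wi wl ys yi yl m)
  show ?case
  proof (intro allI impI)
    fix ys1 yi1 yl1 m1 fy fw
    assume eq: "(ys, yi, yl, Suc m) = (ys1, yi1, yl1, m1)" and y: "perm_rep n ys1 yi1 yl1 fy" and w: "prep n (ws, wi, wl) fw"
    have y': "perm_rep n ys yi yl fy" using y eq by simp
    then have py: "prep n (ys, yi, yl) fy" by simp
    have rw: "perm_rep n ws wi wl fw" using w by simp
    have "kl_coeff n fy fw (Suc m) = 0" if "skip (Suc m) yl wl" by (rule skip_sound[OF that y' rw])
    moreover have e: "ev2 (skip (Suc m) yl wl) c (Suc m) (ys, yi, yl) (ws, wi, wl) = Some v"
      using "3.prems" by (simp only: ev1.simps)
    ultimately have "kl_coeff n fy fw (Suc m) = v" using "3.IH"[OF e] py w by blast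
    then show "kl_coeff n fy fw m1 = v" using eq by simp
  qed
next
  case (6 r m y w)
  then show ?case using rank_zero_sound by auto
next
  case (7 c m y w)
  show ?case
  proof (intro allI impI)
    fix fy fw assume y: "prep n y fy" and w: "prep n w fw"
    have "ev c m (flip y) (flip w) = Some v" using "7.prems" by simp
    from "7.IH"[OF this] have "kl_coeff n (pinv fy) (pinv fw) m = v" using prep_flip[OF y] prep_flip[OF w] by blast
    moreover have "fy \<in> symgrp n" "fw \<in> symgrp n" using y w by (cases y; cases w; simp add: perm_rep_def)+
    ultimately show "kl_coeff n fy fw m = v" using kl_coeff_inv by metis
  qed
next
  case (8 s c1 c2 zs m y w)
  have "ev3 (node s m y w) m y c1 c2 zs = Some v" using "8.prems" by simp
  from "8.IH"[OF this] show ?case by blast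
next
  case (10 sy u xs m y c1 c2 zs)
  have comb: "combine (ev c1 m sy u) (ev c2 (Suc m) y u) (evz zs xs m y u) = Some v" using "10.prems" by simp
  then obtain a b l where abl: "ev c1 m sy u = Some a" "ev c2 (Suc m) y u = Some b" "evz zs xs m y u = Some l"
      "all_fresh l" "v = a + b - sum_list (map snd l)"
    using combine_Some by blast
  show ?case
  proof (intro allI impI)
    fix s w fy fw assume nd: "Some (sy, u, xs) = node s m y w" and y: "prep n y fy" and w: "prep n w fw"
    note N = node_sound[OF nd [symmetric] y w]
    have sym: "fy \<in> symgrp n" "fw \<in> symgrp n" using y w by (cases y; cases w; simp add: perm_rep_def)+
    let ?u = "simple_refl s \<circ> fw"
    have 1: "kl_coeff n (simple_refl s \<circ> fy) ?u m = a" using "10.IH"(1)[OF abl(1)] N(4,5) by blast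
    have 2: "kl_coeff n fy ?u (Suc m) = b" using "10.IH"(2)[OF abl(2)] y N(5) by blast
    have 3: "terms_ok n fy ?u m xs l" using "10.IH"(3)[OF abl(3)] y N(5,6) by blast
    have 4: "(\<Sum>z\<in>kl_corr n s ?u. kl_coeff n z ?u 1 * kl_coeff n fy z m) = sum_list (map snd l)"
      by (rule sum_terms_ok[OF 3 abl(4) N(6,7)])
    show "kl_coeff n fy fw m = v"
      using kl_coeff_rec[OF sym(2,1) N(1-3), of m] unfolding 1 2 4 abl(5) .
  qed
next
  case (14 c zs x xs m y u)
  have "require_zero (ev c (Suc 0) x u) (evz zs xs m y u) = Some l" using "14.prems" by simp
  note R = require_zero_Some[OF this]
  show ?case
  proof (intro allI impI)
    fix fy fu assume y: "prep n y fy" and u: "prep n u fu" and xs: "\<forall>x\<in>set (x # xs). \<exists>z. prep n x z"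
    obtain z where z: "prep n x z" using xs by auto
    have "kl_coeff n z fu (Suc 0) = 0" using "14.IH"(1)[OF conjunct1[OF R]] z u by blast
    then have "kl_coeff n z fu 1 * kl_coeff n fy z m = 0" by simp
    moreover have "terms_ok n fy fu m xs l" using "14.IH"(2)[OF conjunct2[OF R]] y u xs by simp
    ultimately show "terms_ok n fy fu m (x # xs) l" using terms_ok_skip z by blast
  qed
next
  case (15 c zs x xs m y u)
  have "require_zero (ev c m y x) (evz zs xs m y u) = Some l" using "15.prems" by simp
  note R = require_zero_Some[OF this]
  show ?case
  proof (intro allI impI)
    fix fy fu assume y: "prep n y fy" and u: "prep n u fu" and xs: "\<forall>x\<in>set (x # xs). \<exists>z. prep n x z"
    obtain z where z: "prep n x z" using xs by auto
    have "kl_coeff n fy z m = 0" using "15.IH"(1)[OF conjunct1[OF R]] z y by blast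
    then have "kl_coeff n z fu 1 * kl_coeff n fy z m = 0" by simp
    moreover have "terms_ok n fy fu m xs l" using "15.IH"(2)[OF conjunct2[OF R]] y u xs by simp
    ultimately show "terms_ok n fy fu m (x # xs) l" using terms_ok_skip z by blast
  qed
next
  case (16 c d zs x xs m y u)
  have "cons_prod x (ev c (Suc 0) x u) (ev d m y x) (evz zs xs m y u) = Some l" using "16.prems" by simp
  then obtain a b l' where R: "ev c (Suc 0) x u = Some a" "ev d m y x = Some b" "evz zs xs m y u = Some l'"
      "l = (fst x, a * b) # l'"
    using cons_prod_Some by blast
  show ?case
  proof (intro allI impI)
    fix fy fu assume y: "prep n y fy" and u: "prep n u fu" and xs: "\<forall>x\<in>set (x # xs). \<exists>z. prep n x z"
    obtain z where z: "prep n x z" using xs by auto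
    have "kl_coeff n z fu (Suc 0) = a" using "16.IH"(1)[OF R(1)] z u by blast
    moreover have "kl_coeff n fy z m = b" using "16.IH"(2)[OF R(2)] z y by blast
    ultimately have ab: "a * b = kl_coeff n z fu 1 * kl_coeff n fy z m" by simp
    have "terms_ok n fy fu m xs l'" using "16.IH"(3)[OF R(3)] y u xs by simp
    then show "terms_ok n fy fu m (x # xs) l" unfolding R(4) using terms_ok_cons[OF _ z ab] by blast
  qed
qed (auto simp: terms_ok_def)

theorem ev_sound:
  "ev c m y w = Some v \<Longrightarrow> prep n y fy \<Longrightarrow> prep n w fw \<Longrightarrow> kl_coeff n fy fw m = v"
  using ev_sound_aux(1) by blast

section \<open>The two certificates\<close>

lemmas ev_eqs = ev.simps ev1.simps ev2.simps ev3.simps evz.simps flip.simps list_eq.simps same_length.simps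
  cons_opt.simps index_of.simps indices_of.simps count_less.simps inv_count.simps mk_prep1.simps mk_prep.simps
  at_pair.simps set_flag.simps adjacent.simps left_cands.simps mk_preps.simps singleton_if.simps desc_cands1.simps
  desc_cands.simps is_desc.simps keep1.simps keep.simps cons_if.simps keep_all.simps node3.simps node2.simps
  node1.simps node.simps skip.simps rank_fails.simps rank_fails1.simps rank_zero.simps delta.simps
  require_zero.simps cons_prod.simps fresh.simps all_fresh.simps sub_all.simps combine.simps
  count_list_up.simps vec_of.simps zeros.simps mk_rows.simps mk_blocks.simps interval_list_def
  dfs.simps dfs_blocks.simps dfs_entry.simps entry_ok_def rev_append.simps step_ok.simps step_next.simps
  raise.simps find_ascent.simps descents.simps swap_vals.simps
  option.case prod.case list.case if_True if_False simp_thms(1-8)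
  rel_simps arith_simps arith_special add_0_left add_0_right diff_0_right diff_self numeral_One
  even_numeral odd_numeral odd_one dvd_0_right zero_neq_one one_neq_zero zero_less_one
  not_True_eq_False not_False_eq_True mult_1_left mult_1_right mult_zero_left mult_zero_right order.refl less_irrefl

text \<open>Weak congruence rules confine rewriting to the condition or scrutinee until a branch is
  selected, so discarded branches are never evaluated.\<close>

lemmas ev_congs = if_weak_cong option.case_cong_weak prod.case_cong_weak list.case_cong_weak

text \<open>With lengths 32 and 53, index 1 is the coefficient of \<open>q^10\<close>. The outer
  \<open>CI\<close> turns the first reduction into one by a right descent, the one at position 2
  shared by both permutations.\<close>

lemma ev_S16:
  "ev
(CI (CN 2 (CN 1 (CN 0 (CN 2 (CN 1 (CN 6 (CN 5 (CN 4 (CN 3 (CN 2 (CI (CN 11 (CN 10 CZ (CN 7 CZ (CN 6 CZ (CN 3 CZ (CI (CN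
6 (CN 5 (CN 4 (CN 3 (CN 10 (CN 9 (CN 8 (CN 7 (CN 6 (CN 5 (CN 4 (CI (CN 8 (CN 9 (CN 10 (CI (CN 5 CZ (CI (CN 5 (CN 7 (CN 8
CZ CZ []) (CN 8 CZ (CI (CN 7 (CN 10 (CN 12 CZ (CN 14 CZ (CN 9 (CN 8 (CN 10 CZ (CN 11 CZ CZ []) []) CZ []) CZ []) []) [])
(CR 11) []) (CR 8) [ZM (CR 8)])) []) []) (CR 6) [])) [ZM (CN 7 CZ (CN 9 CZ (CN 10 CZ CZ []) []) []), ZM (CN 7 CZ (CR 7)
[]), ZM (CN 7 CZ (CR 7) []), ZM (CN 7 CZ (CN 9 CZ (CR 9) []) []), ZM (CN 7 CZ (CN 9 CZ (CN 10 CZ CZ []) []) []), ZM (CN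
7 CZ (CN 9 CZ (CN 10 CZ CZ []) []) []), ZM (CN 7 CZ (CR 7) []), ZM (CN 7 CZ (CR 7) [])])) (CI (CN 12 (CN 14 CZ (CN 10
(CN 9 (CN 13 (CN 7 CZ (CN 5 CZ (CN 8 CZ (CN 10 CZ (CN 11 (CN 12 CZ CZ []) CZ []) []) [ZM (CR 9)]) [ZM (CR 6)]) [ZH (CN 5
CZ CZ [])]) (CR 14) []) CZ []) (CN 9 CZ CZ []) [ZM (CN 9 CZ CZ [])]) []) (CR 13) [])) [ZB (CI (CN 12 (CN 14 CZ (CN 10
(CN 9 (CN 13 (CN 7 CZ (CN 5 CZ (CN 8 CZ (CN 10 CZ (CN 11 (CN 12 CZ CZ []) CZ []) []) [ZM (CR 9)]) [ZM (CR 6)]) [ZH (CN 5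
CZ CZ [])]) (CR 14) []) CZ []) (CN 9 CZ CZ []) [ZM (CN 9 CZ CZ [])]) []) (CR 13) [])) CZ]) CZ []) (CN 9 CZ (CN 10 CZ CZ
[]) []) [ZM (CN 9 CZ (CN 10 CZ CZ []) [])])) (CR 5) [ZM (CR 5)]) (CR 6) [ZH (CR 5)]) CZ []) (CR 8) []) CZ []) (CR 10)
[ZM (CR 10)]) (CR 11) [ZH (CR 10)]) (CR 4) [ZM (CR 4)]) (CR 5) [ZH (CR 4)]) CZ []) (CR 7) [])) []) []) []) []) (CN 10 CZ
(CN 7 (CN 6 CZ (CN 3 CZ (CN 8 CZ (CN 9 CZ CZ []) []) []) []) (CN 6 CZ (CN 3 (CI (CN 10 (CN 9 (CN 8 (CI (CN 8 (CN 9 (CN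
10 CZ (CI (CN 12 (CN 14 CZ (CN 13 (CN 10 (CN 9 (CI (CN 14 (CN 12 CZ (CN 11 (CN 13 (CN 12 (CI (CN 10 (CN 11 (CN 10 (CI
(CN 10 (CN 8 CZ (CN 7 CZ CZ []) []) (CR 11) [])) (CI (CN 10 (CN 8 (CN 7 CZ CZ []) (CN 7 (CN 6 (CN 5 (CN 4 (CN 3 (CN 9
(CN 8 (CN 6 CZ (CN 5 (CI (CN 6 (CN 7 CZ CZ []) CZ [ZM CZ])) CZ [ZM CZ]) []) (CR 9) [ZM (CR 9)]) (CR 10) [ZH (CR 9)]) (CR
4) []) (CR 5) [ZM (CR 5)]) (CR 6) [ZM (CR 6)]) (CR 7) [ZH (CR 6)]) (CN 5 (CN 4 CZ CZ []) CZ [ZM CZ]) []) [ZM (CN 7 CZ CZ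
[])]) (CR 11) [])) [ZH CZ, ZM (CI (CN 8 (CN 10 CZ (CR 10) []) (CR 9) [])), ZM (CN 6 (CN 7 CZ (CR 8) []) (CR 7) [ZM (CR
7)])]) (CR 12) []) (CR 11) [ZH (CR 12)])) (CR 13) []) (CR 14) []) (CR 12) []) []) (CR 15) [])) (CN 11 (CN 10 (CN 11 (CN
12 CZ (CR 13) []) (CR 12) [ZM (CR 12)]) (CR 11) [ZM (CR 11)]) (CR 12) [ZH (CR 11)]) [ZM (CN 11 (CN 10 (CN 11 (CN 12 CZ
(CR 13) []) (CR 12) [ZM (CR 12)]) (CR 11) [ZM (CR 11)]) (CR 12) [ZH (CR 11)])]) (CN 11 (CI (CN 7 (CN 8 (CN 7 CZ (CN 6
(CN 5 (CN 4 (CN 3 (CN 6 (CN 5 CZ (CR 5) []) (CN 5 (CN 4 (CI (CN 6 (CN 5 (CN 7 (CN 9 CZ (CN 6 (CN 10 (CN 11 (CN 12 CZ CZ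
[]) CZ [ZM CZ]) CZ [ZM CZ]) CZ []) []) (CR 8) [ZH (CR 7)]) (CR 6) [ZM (CR 6)]) (CR 7) [ZH (CR 6)])) (CR 5) []) (CR 5)
[]) [ZH CZ, ZM (CN 5 CZ (CR 5) [])]) (CR 4) []) (CR 5) []) (CR 6) []) (CR 7) [ZH (CR 6)]) [ZM (CR 8)]) (CR 8) []) (CR 8)
[ZH (CR 8)])) (CR 12) []) [ZH (CN 11 (CN 10 (CN 11 (CN 12 CZ (CR 13) []) (CR 12) [ZM (CR 12)]) (CR 11) [ZM (CR 11)]) (CR
12) [ZH (CR 11)]), ZM (CN 6 (CN 5 (CI (CN 12 (CN 11 (CN 14 (CN 13 (CI (CN 4 (CN 3 (CN 7 (CN 9 CZ (CR 9) []) (CR 8) [])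
(CR 4) [ZM (CR 4)]) (CR 5) [ZH (CR 4)])) (CR 14) [ZM (CR 14)]) (CR 15) [ZM (CR 15)]) (CR 12) [ZM (CR 12)]) (CR 13) [ZM
(CR 13)])) CZ []) (CR 7) [ZM (CR 7)]), ZM (CN 6 (CN 5 (CN 4 (CN 3 (CN 7 (CN 9 CZ (CN 6 CZ CZ []) []) (CR 8) []) (CR 4)
[ZM (CR 4)]) (CR 5) [ZH (CR 4)]) CZ []) (CR 7) [ZM (CR 7)])]) (CR 14) []) [ZM (CR 15)]) (CR 13) [])) [ZB (CN 5 (CN 4 (CI
(CN 10 (CN 9 (CN 12 (CN 14 CZ (CN 13 (CN 5 CZ (CN 3 CZ (CN 6 CZ (CN 5 (CN 4 (CN 3 (CN 7 (CN 6 (CN 5 (CN 8 (CN 10 CZ (CN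
11 (CN 12 CZ CZ []) CZ []) []) (CR 9) []) (CR 6) []) (CR 7) [ZH (CR 6)]) (CR 8) []) (CR 4) []) (CR 5) []) (CR 6) [ZH (CR
5)]) []) [ZM (CR 4)]) [ZH (CN 3 CZ CZ [])]) (CR 14) []) []) (CR 13) []) (CR 10) [ZM (CR 10)]) (CR 11) [ZH (CR 10)])) (CR
4) [ZM (CR 4)]) (CR 6) [ZM (CR 6)]) (CN 5 CZ CZ []), ZM (CN 12 (CN 14 CZ (CN 11 CZ CZ []) []) (CR 13) [ZH (CR 12)]), ZM
(CN 5 (CN 4 (CI (CN 10 (CN 12 CZ (CR 12) []) (CR 11) [ZH (CR 10)])) (CR 4) [ZM (CR 4)]) (CR 6) [ZM (CR 6)]), ZB (CI (CN
6 (CN 5 (CN 4 (CN 3 (CN 7 (CN 6 (CN 5 (CN 4 (CN 12 (CN 14 CZ (CN 10 (CN 9 (CN 13 (CN 7 CZ (CN 5 CZ (CN 8 CZ (CN 10 CZ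
(CN 11 (CN 12 CZ CZ []) CZ []) []) [ZM (CR 9)]) [ZM (CR 6)]) [ZH (CN 5 CZ CZ [])]) (CR 14) []) CZ []) (CN 9 CZ CZ [])
[ZM (CN 9 CZ CZ [])]) []) (CR 13) []) (CR 5) [ZM (CR 5)]) (CR 6) [ZH (CR 5)]) CZ []) (CR 8) []) (CR 4) [ZM (CR 4)]) (CR
5) [ZH (CR 4)]) CZ []) (CR 7) [ZM (CR 7)])) (CN 4 CZ CZ []), ZM (CN 5 (CN 4 CZ (CR 4) []) (CR 6) [ZM (CR 6)]), ZH (CI
(CN 3 CZ CZ []))]) CZ []) (CN 9 CZ (CN 12 CZ (CN 14 CZ (CN 11 (CN 10 (CN 11 CZ (CR 12) []) (CR 11) [ZM (CR 11)]) (CR 12)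
[ZH (CR 11)]) []) []) []) [ZM (CN 9 CZ (CN 12 CZ (CN 14 CZ (CN 11 (CN 10 (CN 11 CZ (CR 12) []) (CR 11) [ZM (CR 11)]) (CR
12) [ZH (CR 11)]) []) []) [])])) CZ []) (CR 10) [ZM (CR 10)]) (CR 11) [ZH (CR 10)])) (CI (CN 6 (CN 5 (CN 4 (CN 3 (CN 10
(CN 9 (CN 8 (CN 7 (CN 6 (CN 5 (CN 4 (CI (CN 12 (CN 14 CZ (CN 13 (CN 8 (CN 9 (CI (CN 9 (CN 7 CZ (CN 5 CZ (CN 10 (CI (CN 5
(CN 7 CZ (CN 8 (CN 10 CZ (CN 11 (CN 12 CZ CZ []) CZ []) []) (CR 9) [ZM (CR 9)]) []) (CR 6) [])) CZ []) []) []) (CR 10)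
[ZH (CR 11)])) CZ []) (CN 9 CZ CZ []) [ZM (CN 9 CZ CZ [])]) (CR 14) []) []) (CN 14 (CN 13 (CN 8 (CN 9 (CI (CN 9 (CN 7 CZ
(CN 5 CZ (CN 10 (CI (CN 5 (CN 7 CZ (CN 8 (CN 10 CZ (CN 11 (CN 12 CZ CZ []) CZ []) []) (CR 9) [ZM (CR 9)]) []) (CR 6)
[])) CZ []) []) []) (CR 10) [ZH (CR 11)])) CZ []) (CN 9 CZ CZ []) [ZM (CN 9 CZ CZ [])]) (CR 14) []) (CN 13 (CI (CN 14
(CN 12 (CN 13 (CN 9 (CN 7 CZ (CN 5 CZ (CN 10 (CI (CN 5 (CN 9 (CN 8 (CN 9 (CN 7 (CN 6 (CN 8 CZ (CN 10 CZ CZ []) []) (CR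
7) []) CZ []) (CN 7 (CI (CN 11 (CI (CN 6 (CN 8 CZ CZ []) CZ [])) CZ [ZM CZ])) CZ []) [ZM (CR 10)]) (CR 9) [ZM (CR 9)])
(CR 10) [ZH (CR 9)]) (CR 6) [])) CZ []) [ZM (CR 6)]) [ZM (CR 8)]) (CR 10) [ZH (CR 11)]) (CR 14) []) (CN 13 (CI (CN 8 (CN
9 (CN 10 (CN 11 (CN 12 (CI (CN 9 (CN 10 (CN 7 (CN 5 CZ (CI (CN 5 (CN 7 CZ (CN 8 CZ CZ []) []) (CR 6) [])) []) (CN 5 (CI
(CN 5 (CN 7 CZ (CN 8 CZ CZ []) []) (CR 6) [])) (CI (CN 5 (CN 7 (CN 8 CZ CZ []) CZ []) CZ [])) []) []) (CR 11) []) (CR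
10) [ZH (CR 11)])) (CR 13) []) (CR 12) []) (CR 11) [ZH (CR 12)]) CZ []) (CR 8) [])) (CR 14) []) []) (CR 15) [])) (CR 14)
[]) []) [ZM (CN 14 CZ (CR 14) []), ZH CZ, ZM (CN 14 CZ (CR 14) []), ZM (CN 14 CZ (CI (CN 12 (CN 14 CZ (CR 14) []) (CR
13) [])) []), ZM (CN 14 CZ (CN 8 CZ (CN 9 CZ CZ []) []) []), ZM (CN 14 CZ (CR 14) []), ZB (CN 14 CZ (CN 9 (CN 11 CZ (CN
8 (CN 7 (CN 9 CZ (CN 10 (CN 11 CZ CZ []) CZ []) []) (CR 8) [ZM (CR 8)]) CZ []) []) (CR 10) []) []) (CI (CN 5 CZ (CI (CN
5 CZ CZ [])) [])), ZM (CN 14 CZ (CR 14) []), ZM (CN 14 CZ (CR 14) []), ZM (CN 14 CZ (CN 9 (CN 11 CZ (CN 8 CZ CZ []) [])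
(CR 10) [ZH (CR 9)]) [])])) (CR 5) []) (CR 6) [ZH (CR 5)]) CZ []) (CR 8) []) CZ []) (CR 10) []) (CR 11) [ZH (CR 10)])
(CR 4) []) (CR 5) [ZH (CR 4)]) CZ []) (CR 7) [])) [ZM (CR 4)]) [ZM (CN 5 CZ CZ [])]) []) [ZM (CN 9 CZ CZ [])]) [ZM (CN
10 CZ (CN 7 CZ CZ []) []), ZM (CN 10 CZ (CN 7 CZ CZ []) []), ZH (CI (CN 10 CZ CZ [])), ZB (CN 10 CZ (CN 7 CZ (CN 6 CZ
(CN 3 CZ (CN 8 (CN 9 (CI (CN 6 (CN 5 (CN 4 (CN 3 (CN 10 (CN 9 (CN 8 (CN 7 (CN 6 (CN 5 (CN 4 (CN 12 (CN 10 (CN 9 (CN 14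
(CN 13 (CI (CN 12 CZ (CN 14 (CN 13 (CN 10 (CN 11 (CN 12 (CI (CN 10 (CN 11 (CN 8 CZ (CN 7 CZ (CN 8 CZ CZ []) []) []) (CR
12) [ZM (CR 12)]) (CR 11) [ZH (CR 12)])) (CR 13) []) (CR 12) [ZM (CR 12)]) (CR 11) [ZH (CR 12)]) (CR 14) []) (CR 14) [ZM
(CR 15)]) [])) (CR 14) []) (CR 15) []) CZ []) (CN 9 CZ CZ []) [ZM (CN 9 CZ CZ [])]) (CR 13) []) (CR 5) [ZM (CR 5)]) (CR
6) [ZH (CR 5)]) CZ []) (CR 8) []) CZ []) (CR 10) [ZM (CR 10)]) (CR 11) [ZH (CR 10)]) (CR 4) [ZM (CR 4)]) (CR 5) [ZH (CR
4)]) CZ []) (CR 7) [])) CZ []) (CR 8) [ZM (CR 8)]) []) []) []) []) (CI (CN 12 CZ CZ [])), ZM (CN 10 CZ (CN 7 (CN 6 CZ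
(CN 3 CZ (CN 8 CZ (CR 8) []) []) []) CZ []) []), ZM (CN 10 CZ (CN 7 CZ (CN 6 CZ (CR 6) []) []) []), ZM (CN 10 CZ (CN 7
CZ (CN 6 CZ (CR 6) []) []) []), ZH (CN 14 CZ CZ []), ZH (CI (CN 12 CZ CZ [])), ZH (CN 14 CZ CZ []), ZM (CN 10 CZ (CN 7
CZ CZ []) []), ZM (CN 10 CZ (CN 7 CZ CZ []) []), ZM (CN 7 (CN 6 CZ (CN 8 CZ CZ []) []) CZ []), ZM (CN 7 CZ CZ []), ZM
(CN 10 CZ (CN 7 CZ CZ []) []), ZM (CN 7 (CN 6 CZ (CN 8 CZ CZ []) []) CZ []), ZM (CN 7 (CN 6 CZ (CN 3 CZ (CN 8 CZ CZ [])
[]) []) CZ []), ZM (CN 7 CZ (CN 8 CZ CZ []) []), ZM (CN 7 CZ (CN 6 CZ (CR 6) []) []), ZM (CN 7 CZ (CN 6 CZ (CR 6) [])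
[]), ZM (CN 7 CZ (CN 8 CZ CZ []) []), ZM (CN 7 CZ (CN 6 CZ (CR 6) []) []), ZM (CN 7 CZ (CN 6 CZ (CR 6) []) []), ZM (CN
10 CZ (CN 7 CZ (CR 7) []) []), ZM (CN 10 CZ (CN 7 CZ (CN 6 CZ (CN 3 (CN 8 (CN 9 (CI (CN 10 (CN 9 (CN 8 (CI (CN 5 (CN 4
(CI (CN 10 (CN 12 CZ (CR 12) []) (CR 11) [ZH (CR 10)])) (CR 4) [ZM (CR 4)]) (CR 6) [ZM (CR 6)])) CZ []) (CR 10) [ZM (CR
10)]) (CR 11) [ZH (CR 10)])) CZ []) (CR 9) [ZM (CR 9)]) (CR 4) [ZM (CR 4)]) []) []) []), ZM (CN 10 CZ (CN 7 (CN 6 CZ (CN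
8 CZ (CR 8) []) []) CZ []) []), ZM (CN 10 CZ (CN 7 CZ (CN 6 CZ (CR 6) []) []) []), ZM (CN 10 CZ (CN 7 CZ (CN 6 CZ (CR 6)
[]) []) []), ZH (CI (CN 14 CZ CZ [])), ZB (CN 10 CZ (CN 7 CZ (CN 6 CZ (CN 3 CZ (CI (CN 6 (CN 5 (CN 4 (CN 3 (CN 10 (CN 9
(CN 8 (CN 7 (CN 6 (CN 5 (CN 4 (CI (CN 12 (CN 14 CZ (CN 11 (CN 13 (CN 12 (CN 8 (CN 9 (CN 10 (CN 11 (CN 12 CZ (CN 13 (CI
(CN 7 (CN 5 CZ (CI (CN 5 (CN 7 CZ (CN 8 (CN 9 (CN 10 CZ CZ []) CZ [ZM CZ]) CZ []) []) (CR 6) [])) []) (CR 8) [])) (CR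
14) [ZM (CR 14)]) []) (CR 12) [ZM (CR 12)]) (CR 11) [ZM (CR 11)]) CZ []) (CN 9 (CN 10 (CN 11 CZ (CR 12) []) (CR 11) [ZM
(CR 11)]) (CR 10) []) [ZM (CN 9 (CN 10 (CN 11 CZ (CR 12) []) (CR 11) [ZM (CR 11)]) (CR 10) [])]) (CR 13) []) (CR 14) [ZM
(CR 14)]) (CR 12) []) []) (CR 13) [])) (CR 5) [ZM (CR 5)]) (CR 6) [ZH (CR 5)]) CZ []) (CR 8) []) CZ []) (CR 10) [ZM (CR
10)]) (CR 11) [ZH (CR 10)]) (CR 4) [ZM (CR 4)]) (CR 5) [ZH (CR 4)]) CZ []) (CR 7) [])) []) []) []) []) (CN 4 (CN 3 (CN 4
(CI (CN 6 (CN 8 CZ (CN 5 CZ CZ []) []) (CR 7) [ZH (CR 6)])) (CR 5) []) (CR 4) [ZM (CR 4)]) (CR 5) [ZH (CR 4)]), ZM (CN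
10 CZ (CN 7 (CN 6 CZ (CN 3 CZ (CN 8 CZ (CR 8) []) []) []) CZ []) []), ZM (CN 10 CZ (CN 7 CZ (CN 6 CZ (CR 6) []) []) []),
ZM (CN 10 CZ (CN 7 CZ (CN 6 CZ (CR 6) []) []) []), ZM (CN 7 CZ (CN 10 CZ (CN 6 CZ (CR 6) []) []) []), ZM (CN 10 CZ (CN 7
(CN 6 CZ (CR 6) []) (CR 8) [ZM (CR 8)]) []), ZM (CN 10 CZ (CN 7 CZ CZ []) []), ZM (CN 10 CZ (CN 7 CZ CZ []) []), ZM (CN
10 CZ (CN 7 CZ CZ []) []), ZM (CN 10 CZ (CN 9 CZ (CN 7 CZ (CN 6 CZ (CR 6) []) []) []) []), ZM (CN 10 CZ (CN 9 CZ (CN 7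
(CN 6 CZ (CR 6) []) (CR 8) [ZM (CR 8)]) []) []), ZM (CN 10 CZ (CN 7 CZ CZ []) []), ZM (CN 10 CZ (CN 7 CZ CZ []) []), ZM
(CN 3 CZ (CN 10 CZ (CN 7 CZ CZ []) []) []), ZM (CN 3 CZ (CN 10 CZ (CN 7 CZ CZ []) []) []), ZM (CN 10 CZ (CN 7 CZ CZ [])
[]), ZM (CN 10 CZ (CN 7 CZ CZ []) []), ZM (CN 7 (CN 8 (CN 6 (CN 12 (CN 14 CZ (CR 14) []) (CR 13) []) CZ []) (CR 9) [ZM
(CR 9)]) CZ []), ZM (CN 12 (CN 14 CZ (CR 14) []) (CR 13) []), ZM (CN 12 (CN 14 CZ (CI (CN 12 (CN 14 CZ (CR 14) []) (CR
13) [])) []) (CR 13) []), ZM (CN 7 CZ (CN 6 CZ (CN 3 CZ CZ []) []) []), ZM (CN 10 CZ (CN 7 CZ CZ []) []), ZM (CN 10 CZ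
(CN 7 CZ CZ []) []), ZM (CN 10 CZ (CN 7 CZ CZ []) []), ZM (CN 10 CZ (CN 9 CZ (CN 7 CZ (CN 6 CZ (CR 6) []) []) []) []),
ZM (CN 10 CZ (CN 9 CZ (CN 3 (CN 7 (CN 6 CZ CZ []) (CR 8) [ZM (CR 8)]) (CR 4) [ZM (CR 4)]) []) []), ZM (CN 10 CZ (CN 9 CZ
(CN 3 (CN 8 (CN 7 (CN 6 (CN 5 (CN 4 (CN 3 (CI (CN 10 (CN 9 (CN 8 (CI (CN 12 (CN 14 CZ (CN 11 (CN 13 (CN 10 (CI (CN 6 (CN
5 CZ (CR 5) []) (CR 7) [ZM (CR 7)])) (CR 11) []) (CR 14) [ZM (CR 14)]) (CR 12) [ZM (CR 12)]) []) (CR 13) [])) CZ []) (CR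
10) [ZM (CR 10)]) (CR 11) [ZH (CR 10)])) (CR 4) []) CZ []) (CR 6) []) CZ []) (CR 8) [ZM (CR 8)]) (CR 9) [ZH (CR 8)]) (CR
4) [ZM (CR 4)]) []) []), ZM (CN 10 CZ (CN 7 CZ CZ []) []), ZM (CN 10 CZ (CN 7 CZ CZ []) []), ZM (CN 3 CZ (CN 10 CZ (CN 7
CZ CZ []) []) []), ZM (CN 3 CZ (CN 10 CZ (CN 7 CZ CZ []) []) []), ZM (CN 7 CZ (CN 8 CZ CZ []) []), ZM (CN 7 CZ (CN 8 CZ
CZ []) []), ZM (CN 7 CZ (CN 8 CZ CZ []) []), ZM (CN 10 CZ (CN 7 CZ CZ []) []), ZM (CN 10 CZ (CN 9 CZ (CN 7 CZ (CR 7) [])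
[]) []), ZM (CN 10 CZ (CN 7 CZ CZ []) []), ZM (CN 10 CZ (CN 7 CZ CZ []) []), ZM (CN 10 CZ (CN 7 CZ CZ []) []), ZM (CN 10
CZ (CN 7 CZ CZ []) []), ZM (CN 10 CZ (CN 9 CZ (CN 7 CZ (CR 7) []) []) []), ZM (CN 10 CZ (CN 7 CZ CZ []) []), ZM (CN 10
CZ (CN 7 CZ CZ []) []), ZM (CN 10 CZ (CN 7 CZ CZ []) []), ZM (CN 10 CZ (CN 7 CZ CZ []) []), ZM (CN 10 CZ (CN 7 CZ CZ [])
[]), ZM (CN 7 (CN 8 CZ (CN 6 CZ CZ []) []) CZ []), ZH (CN 10 CZ (CI (CN 5 CZ CZ [])) []), ZM (CN 10 CZ (CN 7 CZ CZ [])
[]), ZM (CN 7 (CN 8 CZ (CN 6 CZ CZ []) []) CZ []), ZM (CN 7 (CI (CN 10 (CN 9 (CN 8 (CN 7 (CN 6 (CN 5 (CN 4 (CN 3 (CN 7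
(CN 6 (CN 5 (CN 4 (CI (CN 12 (CN 14 CZ (CN 13 (CN 6 (CN 8 CZ CZ []) (CN 8 CZ CZ []) [ZM (CN 8 CZ CZ [])]) (CR 14) [])
[]) (CR 13) [])) (CR 5) [ZM (CR 5)]) (CR 6) [ZH (CR 5)]) CZ []) (CR 8) []) (CR 4) [ZM (CR 4)]) (CR 5) [ZH (CR 4)]) CZ
[]) (CR 7) [ZM (CR 7)]) (CR 8) [ZH (CR 7)]) CZ []) (CR 10) [ZM (CR 10)]) (CR 11) [ZH (CR 10)])) CZ []), ZM (CN 10 CZ (CN
7 CZ CZ []) []), ZM (CN 10 CZ (CN 9 CZ (CN 7 CZ (CR 7) []) []) []), ZM (CN 10 CZ (CN 7 CZ CZ []) []), ZM (CN 10 CZ (CN 7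
CZ CZ []) []), ZM (CN 7 CZ (CN 8 CZ CZ []) []), ZM (CN 10 CZ (CN 7 CZ CZ []) []), ZM (CN 7 CZ (CN 6 CZ (CN 8 CZ CZ [])
[]) []), ZM (CN 7 CZ (CN 8 CZ CZ []) []), ZM (CN 7 CZ (CN 8 CZ CZ []) []), ZM (CN 3 CZ (CN 7 CZ (CN 8 CZ CZ []) []) []),
ZM (CN 3 CZ (CN 7 CZ (CN 8 CZ CZ []) []) []), ZM (CN 7 CZ (CN 8 CZ CZ []) []), ZM (CN 7 CZ (CN 8 CZ CZ []) []), ZM (CN 7
CZ (CN 8 CZ CZ []) []), ZM (CN 10 CZ (CN 7 CZ (CN 6 CZ (CN 3 CZ CZ []) []) []) []), ZM (CN 10 CZ (CN 7 (CN 9 (CN 8 (CN 7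
(CN 6 (CN 5 (CN 4 (CN 3 (CN 4 (CN 7 (CN 9 CZ (CR 9) []) CZ []) (CN 7 CZ CZ []) [ZM (CN 7 CZ CZ [])]) (CR 4) [ZM (CR 4)])
(CR 5) [ZH (CR 4)]) (CR 6) [ZM (CR 6)]) CZ []) (CR 8) []) CZ []) (CR 10) []) CZ []) []), ZM (CN 10 CZ (CN 7 CZ (CN 6 CZ
(CR 6) []) []) []), ZM (CN 10 CZ (CN 7 CZ (CN 6 CZ (CR 6) []) []) []), ZM (CN 10 CZ (CN 7 CZ (CN 6 CZ (CN 3 CZ CZ [])
[]) []) []), ZH (CN 6 CZ (CI (CN 3 CZ CZ [])) []), ZH (CI (CN 12 CZ CZ [])), ZH (CI (CN 10 CZ CZ [])), ZM (CN 10 CZ (CN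
7 CZ (CN 6 CZ (CN 3 CZ CZ []) []) []) []), ZM (CN 10 CZ (CN 7 CZ CZ []) []), ZM (CN 10 CZ (CN 7 (CN 6 CZ (CN 8 CZ (CN 3
CZ CZ []) []) []) CZ []) []), ZM (CN 10 CZ (CN 7 CZ (CR 7) []) []), ZM (CN 10 CZ (CN 7 CZ (CN 6 CZ (CN 5 CZ (CR 5) [])
[]) []) []), ZM (CN 10 CZ (CN 3 (CN 7 (CN 9 (CN 8 (CN 7 (CN 6 (CN 5 (CN 4 (CN 3 (CI (CN 10 (CN 9 (CN 8 (CI (CN 12 (CN 14
CZ (CR 14) []) (CR 13) [])) CZ []) (CR 10) [ZM (CR 10)]) (CR 11) [ZH (CR 10)])) (CR 4) []) CZ []) (CR 6) []) CZ []) (CR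
8) []) CZ []) (CR 10) []) CZ []) (CR 4) [ZM (CR 4)]) []), ZM (CN 10 CZ (CN 7 CZ (CN 6 CZ (CR 6) []) []) []), ZM (CN 10
CZ (CN 7 CZ (CN 6 CZ (CR 6) []) []) []), ZM (CN 10 CZ (CN 3 CZ (CN 7 (CN 6 CZ CZ []) CZ []) []) []), ZM (CN 10 CZ (CN 3
CZ (CN 7 (CN 6 CZ CZ []) (CR 8) [ZM (CR 8)]) []) []), ZB (CN 10 CZ (CN 7 CZ (CN 6 CZ (CN 3 CZ (CN 9 (CN 8 (CN 7 (CN 9
(CN 6 (CN 5 (CN 4 (CN 3 (CN 6 (CN 5 (CN 4 (CI (CN 6 (CN 5 (CN 10 (CN 9 (CN 8 (CN 7 (CN 6 (CI (CN 8 (CN 10 CZ (CI (CN 12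
(CN 14 CZ (CN 13 (CN 7 CZ (CN 9 CZ (CN 10 (CN 11 (CN 12 CZ CZ []) CZ [ZM CZ]) CZ []) []) []) (CR 14) []) []) (CR 13)
[])) []) (CN 10 CZ (CI (CN 10 (CN 9 (CN 8 (CN 7 (CN 8 (CN 10 CZ (CN 12 (CN 14 CZ (CN 11 CZ CZ []) []) (CR 13) []) [])
(CR 9) []) (CR 8) [ZM (CR 8)]) (CR 9) [ZH (CR 8)]) CZ []) (CR 11) [])) []) [ZB (CN 10 CZ (CI (CN 10 (CN 9 (CN 8 (CN 7
(CN 8 (CN 10 CZ (CN 12 (CN 14 CZ (CN 11 CZ CZ []) []) (CR 13) []) []) (CR 9) []) (CR 8) [ZM (CR 8)]) (CR 9) [ZH (CR 8)])
CZ []) (CR 11) [])) []) CZ])) (CR 7) [ZM (CR 7)]) (CR 8) [ZH (CR 7)]) CZ []) (CR 10) [ZM (CR 10)]) (CR 11) [ZH (CR 10)])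
(CR 6) [ZM (CR 6)]) (CR 7) [ZH (CR 6)])) (CR 5) []) CZ []) (CR 7) []) (CR 4) []) CZ []) (CR 6) [ZM (CR 6)]) (CR 7) [ZH
(CR 6)]) CZ []) CZ []) CZ []) (CR 10) []) []) []) []) []) (CI (CN 3 CZ CZ [])), ZM (CN 10 CZ (CN 7 CZ CZ []) []), ZH (CI
(CN 3 CZ CZ [])), ZM (CN 10 CZ (CN 7 (CN 6 CZ (CR 6) []) CZ []) []), ZM (CN 10 CZ (CN 7 CZ CZ []) []), ZM (CN 10 CZ (CN
7 CZ CZ []) []), ZH (CI (CN 3 CZ CZ [])), ZH (CI (CN 3 CZ CZ [])), ZH (CN 14 CZ CZ []), ZH (CI (CN 5 CZ CZ [])), ZH (CI
(CN 5 CZ CZ [])), ZM (CN 10 CZ (CN 7 (CN 6 CZ (CN 3 CZ (CN 8 CZ (CR 8) []) []) []) CZ []) []), ZM (CN 10 CZ (CN 7 CZ (CN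
6 CZ (CR 6) []) []) []), ZM (CN 10 CZ (CN 7 CZ (CN 6 CZ (CR 6) []) []) []), ZM (CN 7 CZ (CN 10 CZ (CN 6 CZ (CR 6) [])
[]) []), ZM (CN 10 CZ (CN 7 (CN 6 CZ (CR 6) []) (CR 8) [ZM (CR 8)]) []), ZM (CN 7 CZ (CN 8 CZ CZ []) []), ZM (CN 7 CZ
(CN 10 CZ CZ []) []), ZM (CN 7 CZ (CR 7) []), ZM (CN 7 CZ (CN 10 CZ (CN 6 CZ (CR 6) []) []) []), ZH (CI (CN 14 CZ CZ
[])), ZH (CN 11 (CN 10 (CN 12 (CN 11 (CI (CN 12 (CN 14 (CN 3 CZ (CI (CN 4 (CN 3 (CN 4 CZ CZ []) (CR 4) []) (CR 5) [ZH
(CR 4)])) [ZM (CN 5 CZ (CR 5) [])]) (CR 15) []) (CR 13) [])) CZ []) (CR 13) []) (CR 11) [ZM (CR 11)]) (CR 12) [ZH (CR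
11), ZH (CR 13)]), ZM (CN 10 CZ (CN 7 CZ CZ []) []), ZH (CN 14 (CN 7 (CN 8 CZ CZ []) (CN 8 CZ CZ []) [ZM (CN 8 CZ CZ
[]), ZM (CN 8 CZ CZ []), ZM (CN 8 CZ CZ [])]) (CR 15) []), ZM (CN 10 CZ (CN 7 (CN 6 CZ (CR 6) []) CZ []) []), ZM (CN 10
CZ (CN 7 (CN 6 CZ (CR 6) []) (CR 8) [ZM (CR 8)]) []), ZM (CN 3 CZ (CN 10 CZ (CN 7 CZ (CR 8) []) []) []), ZM (CN 3 CZ (CN
10 CZ (CN 7 CZ (CR 8) []) []) []), ZM (CN 10 CZ (CN 7 CZ (CR 8) []) []), ZM (CN 10 CZ (CN 7 (CN 6 (CN 8 CZ (CR 8) [])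
(CR 7) [ZM (CR 7)]) CZ []) []), ZM (CN 10 CZ (CN 7 CZ (CR 8) []) []), ZM (CN 10 CZ (CN 7 CZ (CR 8) []) [])])) (CR 3) [ZM
(CR 3)]) (CR 4) [ZH (CR 3)]) CZ []) (CR 6) [ZM (CR 6)]) (CR 7) [ZH (CR 6)]) (CR 2) [ZM (CR 2)]) (CR 3) [ZH (CR 2)]) CZ
[]) (CR 2) [ZM (CR 2)]) (CR 3) [ZH (CR 2)]))
  (Suc 0)
  ([5, 4, 1, 0, 9, 8, 3, 2, 13, 12, 7, 6, 11, 10, 15, 14], [3, 2, 7, 6, 1, 0, 11, 10, 5, 4, 13, 12, 9, 8, 15, 14], 32)
  ([12, 8, 1, 0, 13, 9, 4, 2, 15, 10, 5, 3, 11, 6, 14, 7], [3, 2, 7, 11, 6, 10, 13, 15, 1, 5, 9, 12, 0, 4, 14, 8], 53) = Some 5"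
  by (simp only: ev_eqs cong: ev_congs)

text \<open>Both permutations are involutions, so the two lists in each triple coincide. With
  lengths 20 and 31 the value is the coefficient of \<open>q^5\<close>.\<close>

lemma ev_S10:
  "ev
(CN 8 CZ (CN 7 (CI (CN 5 (CN 3 CZ (CN 2 (CN 1 (CI (CN 0 (CI (CN 0 (CN 4 (CN 6 (CI (CN 1 CZ (CI (CN 3 (CN 5 (CN 7 (CN 8
(CN 2 (CN 1 (CN 2 CZ (CI (CN 3 (CN 5 CZ (CN 2 CZ CZ []) []) (CR 4) [ZH (CR 3)])) []) (CR 2) [ZM (CR 2)]) (CR 3) [ZH (CR
2)]) CZ []) (CR 8) [ZM (CR 8)]) (CR 5) [ZM (CR 6)]) (CR 4) [])) [])) (CR 6) [ZM (CR 7)]) (CN 1 CZ (CN 6 (CI (CN 3 (CN 5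
CZ (CN 6 (CN 7 (CN 2 (CN 1 (CN 2 CZ CZ []) CZ [ZM CZ]) CZ [ZH CZ]) CZ [ZM CZ]) CZ []) []) (CR 4) [])) (CR 6) []) [ZM (CR
2)]) []) (CR 1) [])) (CR 1) [])) (CR 2) [ZH (CR 1)]) (CR 3) []) []) (CR 6) [])) (CN 0 (CI (CN 3 (CN 5 (CN 2 (CN 4 (CN 6
(CN 1 (CN 0 (CI (CN 1 CZ (CI (CN 3 (CN 5 (CN 7 (CN 8 (CN 2 (CN 1 (CN 2 CZ (CI (CN 3 (CN 5 CZ (CN 2 CZ CZ []) []) (CR 4)
[ZH (CR 3)])) []) (CR 2) [ZM (CR 2)]) (CR 3) [ZH (CR 2)]) CZ []) (CR 8) [ZM (CR 8)]) (CR 5) [ZM (CR 6)]) (CR 4) []))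
[])) (CR 1) [ZM (CR 1)]) (CR 2) [ZH (CR 1)]) (CR 7) [ZM (CR 7)]) (CR 4) [ZM (CR 4)]) (CR 3) []) (CR 5) []) (CR 4) []))
(CI (CN 3 (CN 2 (CN 1 (CN 0 (CN 5 (CN 4 (CI (CN 1 (CI (CN 3 (CN 2 (CN 1 (CN 6 (CN 5 (CN 2 CZ (CN 7 (CN 8 (CI (CN 3 (CN 5
CZ (CN 2 CZ CZ []) []) (CR 4) [ZH (CR 3)])) CZ []) (CR 8) [ZM (CR 8)]) []) (CR 5) [ZM (CR 6)]) (CR 7) []) (CR 2) []) (CR
3) [ZH (CR 2)]) (CR 4) [])) (CI (CN 3 (CN 2 (CN 1 (CN 6 (CN 5 (CN 2 (CN 7 (CN 8 (CI (CN 3 (CN 5 CZ (CN 2 CZ CZ []) [])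
(CR 4) [ZH (CR 3)])) CZ []) (CR 8) [ZM (CR 8)]) (CI (CN 3 (CN 5 (CN 2 CZ CZ []) CZ []) CZ [ZH CZ])) []) (CR 5) []) (CR
7) []) (CR 2) []) (CR 3) [ZH (CR 2)]) (CR 4) [])) [])) (CR 4) []) (CR 5) []) (CR 1) []) (CR 2) [ZH (CR 1)]) (CR 3) [])
(CR 4) [])) []) [ZH CZ, ZB (CI (CN 3 (CN 5 (CN 2 (CN 4 (CN 6 (CI (CN 0 (CI (CN 1 (CN 0 (CI (CN 1 CZ (CI (CN 3 (CN 5 (CN
7 (CN 8 (CN 2 (CN 1 (CN 2 CZ (CI (CN 3 (CN 5 CZ (CN 2 CZ CZ []) []) (CR 4) [ZH (CR 3)])) []) (CR 2) [ZM (CR 2)]) (CR 3)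
[ZH (CR 2)]) CZ []) (CR 8) [ZM (CR 8)]) (CR 5) [ZM (CR 6)]) (CR 4) [])) [])) (CR 1) [ZM (CR 1)]) (CR 2) [ZH (CR 1)]))
(CR 1) [ZM (CR 1)])) (CR 7) [ZM (CR 7)]) (CR 4) [ZM (CR 4)]) (CR 3) []) CZ []) (CR 4) [ZM (CR 4)])) (CI (CN 5 CZ CZ
[]))]) [ZM (CN 7 CZ (CI (CN 3 (CN 5 CZ (CR 5) []) (CR 4) [ZM (CR 4)])) []), ZB (CN 7 CZ (CN 3 (CN 6 (CN 5 (CN 4 (CN 3
(CN 2 (CN 1 (CN 0 (CN 3 (CN 2 (CN 1 (CN 6 (CN 5 CZ (CN 2 CZ (CN 7 (CI (CN 8 (CN 3 (CN 5 CZ CZ []) CZ []) CZ [ZM CZ])) CZ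
[ZM CZ]) []) []) (CR 7) []) (CR 2) [ZM (CR 2)]) (CR 3) [ZH (CR 2)]) (CR 4) []) (CR 1) [ZM (CR 1)]) (CR 2) [ZH (CR 1)])
(CR 3) [ZM (CR 3)]) (CR 4) [ZH (CR 3)]) CZ []) (CR 6) [ZM (CR 6)]) (CR 7) [ZH (CR 6)]) (CR 4) [ZM (CR 4)]) []) (CN 3 CZ
CZ []), ZM (CN 7 CZ (CN 3 (CN 5 CZ (CR 5) []) (CR 4) [ZM (CR 4)]) [])])
  (Suc 0)
  ([4, 3, 2, 1, 0, 9, 8, 7, 6, 5], [4, 3, 2, 1, 0, 9, 8, 7, 6, 5], 20)
  ([9, 4, 6, 7, 1, 8, 2, 3, 5, 0], [9, 4, 6, 7, 1, 8, 2, 3, 5, 0], 31) = Some 4"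
  by (simp only: ev_eqs cong: ev_congs)

text \<open>Inverses and lengths in the evaluated triples are not taken on trust:
  \<open>mk_prep\<close> recomputes them from the one-line notation, and the triples must
  agree.\<close>

lemma kl_mu_eval:
  assumes "ev c (Suc 0) y w = Some v" "mk_prep ys ys = Some y" "mk_prep ws ws = Some w" "length ys = n" "length ws = n"
  shows "kl_mu n (one_line ys) (one_line ws) = v"
  using ev_sound[OF assms(1), of n "one_line ys" "one_line ws"] mk_prep_sound(1)[OF assms(2)]
    mk_prep_sound(1)[OF assms(3)] assms(4,5)
  by (simp add: kl_mu_eq_kl_coeff)

theorem theorem1:
  shows "kl_mu 16
           (one_line [5,4,1,0,9,8,3,2,13,12,7,6,11,10,15,14])
           (one_line [12,8,1,0,13,9,4,2,15,10,5,3,11,6,14,7]) = 5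
       \<and> kl_mu 10
           (one_line [4,3,2,1,0,9,8,7,6,5])
           (one_line [9,4,6,7,1,8,2,3,5,0]) = 4"
proof (rule conjI, goal_cases)
  case 1
  show ?case by (rule kl_mu_eval[OF ev_S16]) (simp_all only: ev_eqs list.size cong: ev_congs)
next
  case 2
  show ?case by (rule kl_mu_eval[OF ev_S10]) (simp_all only: ev_eqs list.size cong: ev_congs)
qed

end
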